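(* For rooted, ordered, labeled trees $P$ and $T$, the tree inclusion problem can be solved in $O(l_P n_T)$ time and $O(n_T)$ space.
   Context: All trees are rooted, ordered (a left-to-right order among siblings is given) and labeled (each node has a label from an alphabet $\Sigma$, not necessarily of constant size). For a tree $S$, $n_S$ denotes its number of nodes and $l_S$ its number of leaves. Deleting a node $v$ means making the children of $v$ children of the parent of $v$ (inserted in place of $v$ in the left-to-right order among the siblings of $v$) and removing $v$. $P \sqsubseteq T$ means $P$ can be obtained from $T$ by deleting nodes. The tree inclusion problem: determine whether $P \sqsubseteq T$, and if so report all nodes $u$ of $T$ with $P \sqsubseteq T(u)$, where $T(u)$ is the subtree rooted at $u$. It is assumed that $1\le n_P \le n_T$. Model: unit-cost RAM with word size $\Theta(\log n_T)$; space is measured in words. *)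

theory Defs
  imports Complex_Main "HOL-Library.Log_Nat"
begin

section \<open>Ordered labeled trees and tree inclusion\<close>

datatype 'a tree = Node (label: 'a) (children: "'a tree list")

fun num_nodes :: "'a tree \<Rightarrow> nat" where
  "num_nodes (Node a ts) = 1 + sum_list (map num_nodes ts)"

fun num_leaves :: "'a tree \<Rightarrow> nat" where
  "num_leaves (Node a ts) = (if ts = [] then 1 else sum_list (map num_leaves ts))"

text \<open>The nodes of a tree are identified with their preorder numbers \<open>0, ..., num_nodes T - 1\<close>.\<close>

fun subtrees :: "'a tree \<Rightarrow> 'a tree list" where
  "subtrees (Node a ts) = Node a ts # concat (map subtrees ts)"

definition subtree_at :: "'a tree \<Rightarrow> nat \<Rightarrow> 'a tree" where
  "subtree_at T u = subtrees T ! u"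

text \<open>
  Deletion of one node, on ordered forests. The root of a tree may be deleted too, leaving the
  forest of its children. A tree is then included in \<open>T\<close> iff a sequence of deletions leads from
  the one-tree forest \<open>[T]\<close> to the one-tree forest \<open>[P]\<close>.
\<close>

inductive delete_node :: "'a tree list \<Rightarrow> 'a tree list \<Rightarrow> bool" where
  delete_root: "delete_node (xs @ Node a ts # ys) (xs @ ts @ ys)"
| delete_below: "delete_node ts ts' \<Longrightarrow> delete_node (xs @ Node a ts # ys) (xs @ Node a ts' # ys)"

definition tree_included :: "'a tree \<Rightarrow> 'a tree \<Rightarrow> bool" (infix "\<sqsubseteq>" 50) where
  "P \<sqsubseteq> T \<longleftrightarrow> delete_node\<^sup>*\<^sup>* [T] [P]"


section \<open>Unit-cost word RAM\<close>

text \<open>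
  A program is a list of instructions over registers and a random access memory, all of whose
  cells hold \<open>w\<close>-bit words. The memory consists of \<open>S\<close> words; an access beyond it has no
  successor configuration. A program halts when the program counter leaves the program.
  A fixed program mentions only finitely many registers, so these add \<open>O(1)\<close> to the space.
\<close>

datatype binop = Add | Sub | Mul | Div | Mod | BitAnd | BitOr | BitXor | ShiftL | ShiftR

type_synonym reg = nat

datatype instr =
    Const reg nat
  | Move reg reg
  | Bin binop reg reg reg
  | Load reg reg
  | Store reg reg
  | Jump nat
  | JumpEq reg reg nat
  | JumpLess reg reg nat
  | Output reg

fun eval_binop :: "nat \<Rightarrow> binop \<Rightarrow> nat \<Rightarrow> nat \<Rightarrow> nat" where
  "eval_binop w Add x y = (x + y) mod 2 ^ w"
| "eval_binop w Sub x y = (x + 2 ^ w - y) mod 2 ^ w"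
| "eval_binop w Mul x y = (x * y) mod 2 ^ w"
| "eval_binop w Div x y = x div y"
| "eval_binop w Mod x y = x mod y"
| "eval_binop w BitAnd x y = semiring_bit_operations_class.and x y"
| "eval_binop w BitOr x y = semiring_bit_operations_class.or x y"
| "eval_binop w BitXor x y = semiring_bit_operations_class.xor x y"
| "eval_binop w ShiftL x y = (x * 2 ^ y) mod 2 ^ w"
| "eval_binop w ShiftR x y = x div 2 ^ y"

record config =
  pc :: nat
  regs :: "reg \<Rightarrow> nat"
  mem :: "nat \<Rightarrow> nat"
  outs :: "nat list"

definition set_reg :: "reg \<Rightarrow> nat \<Rightarrow> config \<Rightarrow> config" where
  "set_reg r x c = c\<lparr>pc := Suc (pc c), regs := (regs c)(r := x)\<rparr>"

fun exec_instr :: "nat \<Rightarrow> nat \<Rightarrow> instr \<Rightarrow> config \<Rightarrow> config option" where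
  "exec_instr w S (Const r n) c = Some (set_reg r (n mod 2 ^ w) c)"
| "exec_instr w S (Move r s) c = Some (set_reg r (regs c s) c)"
| "exec_instr w S (Bin f r s t) c = Some (set_reg r (eval_binop w f (regs c s) (regs c t)) c)"
| "exec_instr w S (Load r s) c =
    (if regs c s < S then Some (set_reg r (mem c (regs c s)) c) else None)"
| "exec_instr w S (Store r s) c =
    (if regs c r < S then Some (c\<lparr>pc := Suc (pc c), mem := (mem c)(regs c r := regs c s)\<rparr>)
     else None)"
| "exec_instr w S (Jump l) c = Some (c\<lparr>pc := l\<rparr>)"
| "exec_instr w S (JumpEq r s l) c =
    Some (c\<lparr>pc := (if regs c r = regs c s then l else Suc (pc c))\<rparr>)"
| "exec_instr w S (JumpLess r s l) c =
    Some (c\<lparr>pc := (if regs c r < regs c s then l else Suc (pc c))\<rparr>)"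
| "exec_instr w S (Output r) c =
    Some (c\<lparr>pc := Suc (pc c), outs := outs c @ [regs c r]\<rparr>)"

definition step :: "nat \<Rightarrow> nat \<Rightarrow> instr list \<Rightarrow> config \<Rightarrow> config \<Rightarrow> bool" where
  "step w S prog c c' \<longleftrightarrow> pc c < length prog \<and> exec_instr w S (prog ! pc c) c = Some c'"

definition init_config :: "nat list \<Rightarrow> config" where
  "init_config inp =
    \<lparr>pc = 0, regs = (\<lambda>_. 0), mem = (\<lambda>i. if i < length inp then inp ! i else 0), outs = []\<rparr>"

text \<open>
  On a machine with word size \<open>w\<close> and \<open>S\<close> words of memory, which initially hold the input, the
  program halts after exactly \<open>t\<close> unit-cost instructions, having written \<open>out\<close>.
\<close>

definition ram_computes ::
    "nat \<Rightarrow> nat \<Rightarrow> instr list \<Rightarrow> nat list \<Rightarrow> nat \<Rightarrow> nat list \<Rightarrow> bool" where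
  "ram_computes w S prog inp t out \<longleftrightarrow>
    length inp \<le> S \<and>
    (\<exists>c. (step w S prog ^^ t) (init_config inp) c \<and> length prog \<le> pc c \<and> outs c = out)"


section \<open>Tree inclusion on the word RAM\<close>

text \<open>
  A label is a machine word. A tree is given as its preorder sequence of nodes, each by its label
  and its number of children.
\<close>

fun encode_tree :: "nat tree \<Rightarrow> nat list" where
  "encode_tree (Node a ts) = a # length ts # concat (map encode_tree ts)"

definition encode_input :: "nat tree \<Rightarrow> nat tree \<Rightarrow> nat list" where
  "encode_input P T = num_nodes P # num_nodes T # encode_tree P @ encode_tree T"

text \<open>
  The output is \<open>0\<close> if \<open>P\<close> is not included in \<open>T\<close>; otherwise it is \<open>1\<close>, followed by the nodes
  \<open>u\<close> with \<open>P \<sqsubseteq> T(u)\<close>, each exactly once, in any order.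
\<close>

definition correct_answer :: "'a tree \<Rightarrow> 'a tree \<Rightarrow> nat list \<Rightarrow> bool" where
  "correct_answer P T out \<longleftrightarrow>
    (if P \<sqsubseteq> T
     then \<exists>us. out = 1 # us \<and> distinct us \<and>
                set us = {u. u < num_nodes T \<and> P \<sqsubseteq> subtree_at T u}
     else out = [0])"

text \<open>
  Word size \<open>\<Theta>(log n)\<close> with explicit constants. \<open>floorlog 2 n\<close> is the bit length
  \<open>\<lfloor>log 2 n\<rfloor> + 1\<close> of \<open>n > 0\<close>, used because \<open>log 2 1 = 0\<close>.
\<close>

definition log_word_size :: "nat \<Rightarrow> nat \<Rightarrow> nat \<Rightarrow> nat \<Rightarrow> bool" where
  "log_word_size a b n w \<longleftrightarrow> a * floorlog 2 n \<le> w \<and> w \<le> b * floorlog 2 n"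

end

theory Submission
  imports Defs
begin

text \<open>
  Nodes are preorder numbers and \<open>stop x\<close> is the number following the subtree of \<open>x\<close>. For a pattern
  tree \<open>f\<close> let \<open>N f p\<close> be the least \<open>stop x\<close> of a node \<open>x \<ge> p\<close> of \<open>T\<close> to which the root of \<open>f\<close> can be
  mapped. A forest \<open>f\<^sub>1, \<dots>, f\<^sub>k\<close> embeds into the positions from \<open>p\<close> to \<open>q\<close> iff
  \<open>N f\<^sub>k (\<dots> (N f\<^sub>1 p)) \<le> q\<close>, so the array of \<open>N f\<close> is obtained from those of the children of \<open>f\<close> by
  composition and one linear pass. A maximal chain of pattern nodes with a single child is handled in one
  pass, by recording for every node of \<open>T\<close> how much of the chain occurs below it; hence only \<open>O(l\<^sub>P)\<close>
  linear passes are needed.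

  For the space bound, the array of the child with the largest subtree is computed first. During the
  recursion into another child two arrays have to be saved. They hold monotone functions, which are coded by
  \<open>2 n\<^sub>T + 2\<close> bits, and since the size of the pattern at least halves, the saved bits of each position fit
  into a single word.
\<close>


section \<open>Deletion sequences and embeddings\<close>

text \<open>The heavy child need not be much smaller than its parent, so its recursion cannot afford
  anything newly saved; it runs before any composition \<open>A\<close> exists that would have to
  survive. The composition must nevertheless follow the left-to-right order of the siblings, so the
  finished function of the heavy child waits on the bit stacks for its turn. A light child therefore
  sees at most two more functions on the stacks than its parent did, two bits per word, while its
  subtree is at most half as large: a bound on the stack words times the squared subtree size does
  not grow along the recursion. This is the origin of the quadratic demand on \<open>2 ^ w\<close>,
  and through it of the factor \<open>20\<close> in the word size.

  For the time, a bottom of a chain has no child or at least two.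

  Words wrap around and jump targets are absolute; to keep both out of the tree argument, the
  algorithm is verified over exact natural numbers in a while language with a tick counter, and
  compilation costs a constant factor.\<close>

text \<open>Deletions may happen anywhere and in any order. This relation fixes a left-to-right scan
  instead: the first root of the host forest is dissolved into its children or matched with the
  first pattern root. A preorder scan can follow that.\<close>

inductive embeds :: "'a tree list \<Rightarrow> 'a tree list \<Rightarrow> bool" where
  embeds_Nil: "embeds [] []"
| embeds_skip: "embeds F (gs @ G) \<Longrightarrow> embeds F (Node b gs # G)"
| embeds_match: "embeds fs gs \<Longrightarrow> embeds F G \<Longrightarrow> embeds (Node a fs # F) (Node a gs # G)"

abbreviation forest_size :: "'a tree list \<Rightarrow> nat" where
  "forest_size G \<equiv> sum_list (map num_nodes G)"

lemma num_nodes_pos [simp]: "0 < num_nodes t"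
  by (cases t) simp

lemma embeds_append: "embeds F G \<Longrightarrow> embeds F' G' \<Longrightarrow> embeds (F @ F') (G @ G')"
proof (induction F G rule: embeds.induct)
  case (embeds_skip F gs G b)
  then show ?case using embeds.embeds_skip[of "F @ F'" gs "G @ G'"] by simp
next
  case (embeds_match fs gs F G a)
  then show ?case using embeds.embeds_match by simp
qed simp

text \<open>Images keep the order of the pattern trees, so a cut between two host trees induces a
  cut of the pattern. Skipping a root of \<open>G1\<close> replaces it by its children and leaves
  the cut in place.\<close>

lemma embeds_split:
  assumes "embeds F (G1 @ G2)"
  shows "\<exists>F1 F2. F = F1 @ F2 \<and> embeds F1 G1 \<and> embeds F2 G2"
  using assms
proof (induction F "G1 @ G2" arbitrary: G1 rule: embeds.induct)
  case embeds_Nil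
  then show ?case using embeds.embeds_Nil by blast
next
  case (embeds_skip F gs G b)
  show ?case
  proof (cases G1)
    case Nil
    have "embeds F (Node b gs # G)" using embeds_skip.hyps(1) by (rule embeds.embeds_skip)
    then show ?thesis using Nil embeds_skip.hyps(3) embeds.embeds_Nil
      by (intro exI[of _ "[]"] exI[of _ F]) auto
  next
    case (Cons g G1')
    then have G: "g = Node b gs" "G = G1' @ G2" using embeds_skip.hyps(3) by auto
    then obtain F1 F2 where F: "F = F1 @ F2" "embeds F1 (gs @ G1')" "embeds F2 G2"
      using embeds_skip.hyps(2)[of "gs @ G1'"] by auto
    have "embeds F1 G1" using embeds.embeds_skip[OF F(2)] Cons G by simp
    then show ?thesis using F by (intro exI[of _ F1] exI[of _ F2]) simp
  qed
next
  case (embeds_match fs gs F G a)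
  show ?case
  proof (cases G1)
    case Nil
    have "embeds (Node a fs # F) (Node a gs # G)"
      using embeds_match.hyps(1,3) by (rule embeds.embeds_match)
    then show ?thesis using Nil embeds_match.hyps(5) embeds.embeds_Nil
      by (intro exI[of _ "[]"] exI[of _ "Node a fs # F"]) auto
  next
    case (Cons g G1')
    then have G: "g = Node a gs" "G = G1' @ G2" using embeds_match.hyps(5) by auto
    then obtain F1 F2 where F: "F = F1 @ F2" "embeds F1 G1'" "embeds F2 G2"
      using embeds_match.hyps(4)[of "G1'"] by auto
    have "embeds (Node a fs # F1) G1"
      using embeds.embeds_match[OF embeds_match.hyps(1) F(2)] Cons G by simp
    then show ?thesis using F by (intro exI[of _ "Node a fs # F1"] exI[of _ F2]) simp
  qed
qed

lemma embeds_empty [simp]: "embeds [] G"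
proof (induction G rule: measure_induct_rule[where f = forest_size])
  case (less G)
  show ?case
  proof (cases G)
    case (Cons g G')
    obtain b gs where "g = Node b gs" by (cases g)
    then show ?thesis using less[of "gs @ G'"] Cons by (auto intro: embeds_skip)
  qed (simp add: embeds_Nil)
qed

lemma embeds_refl: "embeds G G"
proof (induction G rule: measure_induct_rule[where f = forest_size])
  case (less G)
  show ?case
  proof (cases G)
    case (Cons g G')
    obtain b gs where "g = Node b gs" by (cases g)
    then show ?thesis using less[of gs] less[of G'] Cons by (auto intro: embeds_match)
  qed simp
qed

text \<open>Undoing a deletion inserts one node, which an embedding may skip. As the node sits amid
  siblings or deeper, the pattern is cut along the context with \<open>embeds_split\<close>.\<close>

lemma delete_node_embeds: "delete_node G G' \<Longrightarrow> embeds F G' \<Longrightarrow> embeds F G"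
proof (induction arbitrary: F rule: delete_node.induct)
  case (delete_root xs a ts ys)
  then obtain F1 F2 F3 where "F = F1 @ F2 @ F3" "embeds F1 xs" "embeds F2 ts" "embeds F3 ys"
    by (metis embeds_split)
  moreover from this have "embeds F2 [Node a ts]" by (auto intro: embeds_skip)
  ultimately show ?case
    using embeds_append[of F1 xs "F2 @ F3" "[Node a ts] @ ys"] embeds_append[of F2 "[Node a ts]" F3 ys]
    by simp
next
  case (delete_below ts ts' xs a ys)
  have "embeds F (xs @ [Node a ts'] @ ys)" using delete_below.prems by simp
  then obtain F1 F2 F3 where F: "F = F1 @ F2 @ F3" "embeds F1 xs" "embeds F2 [Node a ts']" "embeds F3 ys"
    by (metis embeds_split)
  have "embeds F2 [Node a ts]"
    using F(3) delete_below.IH by (cases rule: embeds.cases) (auto intro: embeds_skip embeds_match)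
  then show ?case
    using F embeds_append[of F1 xs "F2 @ F3" "[Node a ts] @ ys"] embeds_append[of F2 "[Node a ts]" F3 ys]
    by simp
qed

lemma delete_node_Cons: "delete_node G G' \<Longrightarrow> delete_node (g # G) (g # G')"
  by (induction rule: delete_node.induct)
     (metis append_Cons delete_root, metis append_Cons delete_below)

lemma embeds_delete: "embeds F G \<Longrightarrow> delete_node\<^sup>*\<^sup>* G F"
proof (induction rule: embeds.induct)
  case (embeds_skip F gs G b)
  moreover have "delete_node (Node b gs # G) (gs @ G)" using delete_root[of "[]"] by simp
  ultimately show ?case by (rule_tac converse_rtranclp_into_rtranclp)
next
  case (embeds_match fs gs F G a)
  have "delete_node\<^sup>*\<^sup>* (Node a gs # G) (Node a fs # G)" using embeds_match.IH(1)
  proof (induction rule: rtranclp_induct)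
    case (step y z)
    then show ?case using delete_below[of y z "[]" a G] by (auto intro: rtranclp.rtrancl_into_rtrancl)
  qed simp
  also have "delete_node\<^sup>*\<^sup>* (Node a fs # G) (Node a fs # F)" using embeds_match.IH(2)
    by (induction rule: rtranclp_induct) (auto intro: rtranclp.rtrancl_into_rtrancl delete_node_Cons)
  finally show ?case .
qed simp

lemma tree_included_iff_embeds: "P \<sqsubseteq> T \<longleftrightarrow> embeds [P] [T]"
proof
  assume "P \<sqsubseteq> T"
  then have "delete_node\<^sup>*\<^sup>* [T] [P]" by (simp add: tree_included_def)
  then show "embeds [P] [T]"
    by (induction rule: converse_rtranclp_induct) (auto intro: embeds_refl delete_node_embeds)
qed (simp add: tree_included_def embeds_delete)


section \<open>Greedy matching in the preorder sequence\<close>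

text \<open>A forest is viewed as an interval of positions from \<open>p\<close> to
  \<open>q\<close>, tiled by consecutive subtrees.\<close>

primrec fpath :: "'a tree list \<Rightarrow> nat \<Rightarrow> 'a tree list \<Rightarrow> nat \<Rightarrow> bool" where
  "fpath S p [] q \<longleftrightarrow> p = q"
| "fpath S p (g # gs) q \<longleftrightarrow> p < length S \<and> S ! p = g \<and> fpath S (p + num_nodes g) gs q"

abbreviation stop :: "'a tree list \<Rightarrow> nat \<Rightarrow> nat" where
  "stop S p \<equiv> p + num_nodes (S ! p)"

text \<open>This local property lets the later proofs reason with positions and intervals rather
  than by structural induction on the host tree.\<close>

definition preorder_list :: "'a tree list \<Rightarrow> bool" where
  "preorder_list S \<longleftrightarrow>
    (\<forall>p < length S. fpath S (Suc p) (children (S ! p)) (stop S p) \<and> stop S p \<le> length S)"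

lemma length_subtrees [simp]: "length (subtrees t) = num_nodes t"
  by (induction t rule: subtrees.induct) (simp add: length_concat comp_def cong: map_cong)

lemma nth_subtrees_0 [simp]: "subtrees t ! 0 = t"
  by (cases t) simp

lemma fpath_subtrees:
  "fpath (xs @ concat (map subtrees gs) @ ys) (length xs) gs (length xs + forest_size gs)"
proof (induction gs arbitrary: xs)
  case (Cons g gs)
  have "(xs @ subtrees g @ zs) ! length xs = g" for zs
    using num_nodes_pos[of g] by (simp add: nth_append del: num_nodes_pos)
  then show ?case using Cons[of "xs @ subtrees g"] by (simp add: add.assoc)
qed simp

text \<open>The context \<open>xs\<close>, \<open>ys\<close> is what the induction needs: inside a
  child, all positions are shifted by the part of the list in front of it.\<close>

lemma preorder_subtrees_context:
  assumes "p < num_nodes t"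
  shows "fpath (xs @ subtrees t @ ys) (Suc (length xs + p)) (children (subtrees t ! p))
           (length xs + stop (subtrees t) p) \<and> stop (subtrees t) p \<le> num_nodes t"
  using assms
proof (induction t arbitrary: p xs ys)
  case (Node a ts)
  show ?case
  proof (cases p)
    case 0
    then show ?thesis using fpath_subtrees[of "xs @ [Node a ts]" ts ys] by simp
  next
    case (Suc p')
    then have "p' < length (concat (map subtrees ts))" using Node.prems
      by (simp add: length_concat comp_def)
    \<comment> \<open>Position \<open>p'\<close> falls into the block of one child \<open>t\<close>,
      at offset \<open>i\<close>.\<close>
    then have "\<exists>us t vs i. ts = us @ t # vs \<and> p' = forest_size us + i \<and> i < num_nodes t"
    proof (induction ts arbitrary: p')
      case (Cons t ts)
      show ?case
      proof (cases "p' < num_nodes t")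
        case True
        then show ?thesis by (intro exI[of _ "[]"]) auto
      next
        case False
        then obtain us u vs i where "ts = us @ u # vs" "p' - num_nodes t = forest_size us + i" "i < num_nodes u"
          using Cons.IH[of "p' - num_nodes t"] Cons.prems by fastforce
        then show ?thesis using False
          by (intro exI[of _ "t # us"] exI[of _ u] exI[of _ vs] exI[of _ i]) auto
      qed
    qed simp
    then obtain us t vs i where ts: "ts = us @ t # vs" and i: "p' = forest_size us + i" "i < num_nodes t"
      by blast
    have len: "length (concat (map subtrees us)) = forest_size us"
      by (simp add: length_concat comp_def)
    have nth: "subtrees (Node a ts) ! p = subtrees t ! i"
      using i len by (simp add: ts Suc nth_append)
    have "t \<in> set ts" by (simp add: ts)
    from Node.IH[OF this i(2), of "xs @ Node a ts # concat (map subtrees us)" "concat (map subtrees vs) @ ys"]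
    have IH: "fpath (xs @ subtrees (Node a ts) @ ys)
           (Suc (length xs + Suc (forest_size us) + i)) (children (subtrees t ! i))
           (length xs + Suc (forest_size us) + (i + num_nodes (subtrees t ! i)))"
      "i + num_nodes (subtrees t ! i) \<le> num_nodes t"
      by (simp_all add: ts len)
    then show ?thesis using i unfolding nth by (simp add: Suc ts algebra_simps)
  qed
qed

lemma preorder_list_subtrees: "preorder_list (subtrees t)"
  using preorder_subtrees_context[of _ t "[]" "[]"] by (simp add: preorder_list_def)

lemma preorder_listD:
  assumes "preorder_list S" "p < length S" "S ! p = Node b gs"
  shows "fpath S (Suc p) gs (stop S p)" "stop S p \<le> length S"
  using assms by (auto simp: preorder_list_def)

lemma fpath_le: "fpath S p G q \<Longrightarrow> p \<le> q"
  by (induction G arbitrary: p) (auto dest: add_leD1)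

lemma fpath_append: "fpath S p (G @ H) q \<longleftrightarrow> (\<exists>r. fpath S p G r \<and> fpath S r H q)"
  by (induction G arbitrary: p) auto

lemma fpath_size: "fpath S p G q \<Longrightarrow> q = p + forest_size G"
  by (induction G arbitrary: p) fastforce+

text \<open>Subtree intervals are nested or disjoint: \<open>y\<close> lies in one tile, and it
  either starts that tile or lies in the tiling by the children of its root.\<close>

lemma stop_nested:
  assumes "preorder_list S" "fpath S p G q" "p \<le> y" "y < q"
  shows "stop S y \<le> q"
  using assms(2-)
proof (induction G arbitrary: p q rule: measure_induct_rule[where f = forest_size])
  case (less G)
  show ?case
  proof (cases G)
    case Nil
    then show ?thesis using less.prems by auto
  next
    case (Cons g G')
    obtain b gs where g: "g = Node b gs" by (cases g)
    have p: "p < length S" "S ! p = g" "fpath S (stop S p) G' q" using less.prems Cons by auto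
    have le: "stop S p \<le> q" using fpath_le[OF p(3)] .
    consider "y = p" | "p < y" "y < stop S p" | "stop S p \<le> y" using less.prems by linarith
    then show ?thesis
    proof cases
      case 1
      then show ?thesis using le by simp
    next
      case 2
      have "fpath S (Suc p) gs (stop S p)"
        using preorder_listD[OF assms(1) p(1)] p(2) g by simp
      then have "stop S y \<le> stop S p" using less.IH[of gs "Suc p"] 2 Cons g by simp
      then show ?thesis using le by simp
    next
      case 3
      then show ?thesis using less.IH[of G' "stop S p" q] p less.prems Cons by simp
    qed
  qed
qed

lemma stop_nested':
  assumes "preorder_list S" "x < length S" "x < y" "y < stop S x"
  shows "stop S y \<le> stop S x"
  using assms stop_nested[OF assms(1), of "Suc x" "children (S ! x)" "stop S x" y]
  by (auto simp: preorder_list_def)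

section \<open>Greedy end positions and their optimality\<close>

text \<open>\<open>Suc (length S)\<close> plays the role of infinity.\<close>

definition next_stop :: "'a tree list \<Rightarrow> (nat \<Rightarrow> bool) \<Rightarrow> nat \<Rightarrow> nat" where
  "next_stop S Q p = Min (insert (Suc (length S)) (stop S ` {x. p \<le> x \<and> x < length S \<and> Q x}))"

text \<open>Only the root is pinned to \<open>x\<close>; each child then finishes as early as
  possible after the previous one. Monotonicity of \<open>next_stop\<close> makes this greedy choice
  optimal, so no alternatives have to be tried.\<close>

fun matches :: "'a tree list \<Rightarrow> 'a tree \<Rightarrow> nat \<Rightarrow> bool" where
  "matches S (Node a fs) x \<longleftrightarrow>
    label (S ! x) = a \<and> fold (\<lambda>f. next_stop S (matches S f)) fs (Suc x) \<le> stop S x"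

abbreviation tree_end :: "'a tree list \<Rightarrow> 'a tree \<Rightarrow> nat \<Rightarrow> nat" where
  "tree_end S f \<equiv> next_stop S (matches S f)"

abbreviation forest_end :: "'a tree list \<Rightarrow> 'a tree list \<Rightarrow> nat \<Rightarrow> nat" where
  "forest_end S fs \<equiv> fold (tree_end S) fs"

lemma next_stop_le_iff:
  "q \<le> length S \<Longrightarrow> next_stop S Q p \<le> q \<longleftrightarrow> (\<exists>x. p \<le> x \<and> x < length S \<and> Q x \<and> stop S x \<le> q)"
  unfolding next_stop_def by (subst Min_le_iff) auto

lemma next_stop_le: "next_stop S Q p \<le> Suc (length S)"
  unfolding next_stop_def by (rule Min_le) auto

lemma next_stop_mono: "p \<le> q \<Longrightarrow> next_stop S Q p \<le> next_stop S Q q"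
  unfolding next_stop_def by (rule Min_antimono) auto

lemma next_stop_ge: "p \<le> Suc (length S) \<Longrightarrow> p \<le> next_stop S Q p"
  unfolding next_stop_def by (subst Min_ge_iff) auto

lemma next_stop_beyond: "length S \<le> p \<Longrightarrow> next_stop S Q p = Suc (length S)"
  unfolding next_stop_def by (subst Collect_empty_eq[THEN iffD2]) auto

text \<open>Lowering the start by one admits a single new candidate. This recurrence is why one
  right-to-left pass fills in the whole function.\<close>

lemma next_stop_step:
  assumes "p < length S"
  shows "next_stop S Q p = (if Q p then min (stop S p) (next_stop S Q (Suc p)) else next_stop S Q (Suc p))"
proof -
  let ?X = "\<lambda>p. {x. p \<le> x \<and> x < length S \<and> Q x}"
  let ?M = "\<lambda>p. insert (Suc (length S)) (stop S ` ?X p)"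
  have X: "?X p = (if Q p then insert p (?X (Suc p)) else ?X (Suc p))"
    using assms by (auto simp: Suc_le_eq order_le_less)
  show ?thesis
  proof (cases "Q p")
    case True
    then have "?M p = insert (stop S p) (?M (Suc p))" using X by auto
    moreover have "finite (?M (Suc p))" by simp
    ultimately have "Min (?M p) = min (stop S p) (Min (?M (Suc p)))"
      using Min_insert[of "?M (Suc p)" "stop S p"] by simp
    then show ?thesis using True unfolding next_stop_def by simp
  qed (use X in \<open>simp add: next_stop_def\<close>)
qed

lemma forest_end_mono: "p \<le> q \<Longrightarrow> forest_end S F p \<le> forest_end S F q"
  by (induction F arbitrary: p q) (auto intro: next_stop_mono)

lemma forest_end_le: "p \<le> Suc (length S) \<Longrightarrow> forest_end S F p \<le> Suc (length S)"
  by (induction F arbitrary: p) (auto intro: next_stop_le)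

lemma forest_end_ge: "p \<le> Suc (length S) \<Longrightarrow> p \<le> forest_end S F p"
proof (induction F arbitrary: p)
  case (Cons f F)
  have "p \<le> tree_end S f p" using next_stop_ge[OF Cons.prems] .
  also have "\<dots> \<le> forest_end S (f # F) p" using Cons.IH[OF next_stop_le] by simp
  finally show ?case .
qed simp

text \<open>Exchange argument: in any embedding the first pattern tree ends no earlier than its
  greedy end, and by monotonicity an earlier start never delays the remaining trees.\<close>

lemma embeds_forest_end:
  assumes "preorder_list S"
  shows "embeds F G \<Longrightarrow> fpath S p G q \<Longrightarrow> q \<le> length S \<Longrightarrow> forest_end S F p \<le> q"
proof (induction arbitrary: p q rule: embeds.induct)
  case (embeds_skip F gs G b)
  have p: "p < length S" "S ! p = Node b gs" "fpath S (stop S p) G q" using embeds_skip.prems by auto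
  have "fpath S (Suc p) (gs @ G) q"
    using preorder_listD[OF assms p(1,2)] p(3) unfolding fpath_append by blast
  then have "forest_end S F (Suc p) \<le> q" using embeds_skip.IH embeds_skip.prems by blast
  then show ?case using forest_end_mono[of p "Suc p" S F] by linarith
next
  case (embeds_match fs gs F G a)
  then have p: "p < length S" "S ! p = Node a gs" "fpath S (stop S p) G q" by auto
  note gs = preorder_listD[OF assms p(1,2)]
  have "matches S (Node a fs) p" using embeds_match.IH(1)[OF gs] p by simp
  then have "tree_end S (Node a fs) p \<le> stop S p"
    using p(1) gs(2) next_stop_le_iff[OF gs(2), of "matches S (Node a fs)" p] by blast
  then have "forest_end S F (tree_end S (Node a fs) p) \<le> forest_end S F (stop S p)"
    by (rule forest_end_mono)
  also have "\<dots> \<le> q" using embeds_match.IH(2) p(3) embeds_match.prems(2) by blast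
  finally show ?case by (simp only: fold_simps)
qed simp

text \<open>The embedding can be read off the greedy ends: the first root of \<open>G\<close> is
  matched if it realises the earliest end of the first pattern tree; otherwise that end is the same
  from \<open>Suc p\<close> on, and the root can be skipped.\<close>

lemma forest_end_embeds:
  assumes "preorder_list S"
  shows "fpath S p G q \<Longrightarrow> q \<le> length S \<Longrightarrow> forest_end S F p \<le> q \<Longrightarrow> embeds F G"
proof (induction G arbitrary: F p q rule: measure_induct_rule[where f = forest_size])
  case (less G)
  show ?case
  proof (cases F)
    case (Cons f F')
    obtain a fs where f: "f = Node a fs" by (cases f)
    have F': "forest_end S F' (tree_end S f p) \<le> q" using less.prems Cons by simp
    have "tree_end S f p \<le> q" using forest_end_ge[OF next_stop_le] F' le_trans by blast
    then obtain x where "p \<le> x" "stop S x \<le> q" using next_stop_le_iff[OF less.prems(2)] by blast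
    moreover have "x < stop S x" by simp
    ultimately have "p < q" by linarith
    then have "G \<noteq> []" using less.prems(1) by auto
    then obtain b gs G' where G: "G = Node b gs # G'" by (metis neq_Nil_conv tree.exhaust)
    then have p: "p < length S" "S ! p = Node b gs" "fpath S (stop S p) G' q" using less.prems by auto
    note gs = preorder_listD[OF assms p(1,2)]
    show ?thesis
    proof (cases "matches S f p \<and> stop S p \<le> tree_end S f (Suc p)")
      case True
      then have "tree_end S f p = stop S p" using next_stop_step[OF p(1), of "matches S f"] by simp
      then have "embeds F' G'" using less.IH[of G'] F' p less.prems G by simp
      moreover have "embeds fs gs" using less.IH[of gs] gs True f G by simp
      moreover have "a = b" using True f p by simp
      ultimately show ?thesis using Cons G f by (auto intro: embeds_match)
    next
      case False
      then have "tree_end S f p = tree_end S f (Suc p)" using next_stop_step[OF p(1), of "matches S f"] by auto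
      then have "forest_end S F (Suc p) \<le> q" using F' Cons by simp
      moreover have "fpath S (Suc p) (gs @ G') q" using gs p by (auto simp: fpath_append)
      ultimately show ?thesis using less.IH[of "gs @ G'"] less.prems G by (auto intro: embeds_skip)
    qed
  qed simp
qed

lemma tree_included_iff_tree_end:
  assumes "x < num_nodes T"
  shows "P \<sqsubseteq> subtree_at T x \<longleftrightarrow> tree_end (subtrees T) P x \<le> stop (subtrees T) x"
proof -
  let ?S = "subtrees T"
  have "fpath ?S x [?S ! x] (stop ?S x)" "stop ?S x \<le> length ?S"
    using assms preorder_list_subtrees[of T] by (auto simp: preorder_list_def)
  then show ?thesis
    using embeds_forest_end[OF preorder_list_subtrees, of "[P]" "[?S ! x]" T x "stop ?S x"]
      forest_end_embeds[OF preorder_list_subtrees, of T x "[?S ! x]" "stop ?S x" "[P]"]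
    by (auto simp: tree_included_iff_embeds subtree_at_def)
qed

section \<open>A while language compiled to the word RAM\<close>

record state =
  vars :: "nat \<Rightarrow> nat"
  arr :: "nat \<Rightarrow> nat \<Rightarrow> nat"
  written :: "nat list"
  ticks :: nat

datatype exp = N nat | V nat | Op binop exp exp | Rd nat exp | In exp
datatype bexp = Less exp exp | Eq exp exp | And bexp bexp
datatype com =
    Assign nat exp
  | Write nat exp exp
  | Emit exp
  | Seq com com
  | If bexp com com
  | While bexp com

fun nat_op :: "binop \<Rightarrow> nat \<Rightarrow> nat \<Rightarrow> nat" where
  "nat_op Add x y = x + y"
| "nat_op Sub x y = x - y"
| "nat_op Mul x y = x * y"
| "nat_op Div x y = x div y"
| "nat_op Mod x y = x mod y"
| "nat_op _ x y = 0"

fun op_ok :: "nat \<Rightarrow> binop \<Rightarrow> nat \<Rightarrow> nat \<Rightarrow> bool" where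
  "op_ok w Add x y \<longleftrightarrow> x + y < 2 ^ w"
| "op_ok w Sub x y \<longleftrightarrow> y \<le> x \<and> x < 2 ^ w"
| "op_ok w Mul x y \<longleftrightarrow> x * y < 2 ^ w"
| "op_ok w Div x y \<longleftrightarrow> True"
| "op_ok w Mod x y \<longleftrightarrow> True"
| "op_ok w _ x y \<longleftrightarrow> False"

lemma eval_binop_nat_op: "op_ok w f x y \<Longrightarrow> eval_binop w f x y = nat_op f x y"
proof (cases f)
  case Sub
  assume "op_ok w f x y"
  then have "y \<le> x" "x < 2 ^ w" using Sub by auto
  then have "(x + 2 ^ w - y) mod 2 ^ w = (x - y + 2 ^ w) mod 2 ^ w" by simp
  then show ?thesis using Sub \<open>x < 2 ^ w\<close> by simp
qed auto

definition tick :: "state \<Rightarrow> state" where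
  "tick s = s\<lparr>ticks := Suc (ticks s)\<rparr>"

lemma tick_simps [simp]:
  "vars (tick s) = vars s" "arr (tick s) = arr s" "written (tick s) = written s"
  "ticks (tick s) = Suc (ticks s)"
  by (simp_all add: tick_def)

text \<open>
  The semantics is stuck unless all intermediate values fit into words and all array indices are
  below the array length \<open>M\<close>, so that exact natural number arithmetic is faithful.
\<close>

locale while_language =
  fixes w :: nat and inp :: "nat list" and M :: nat
begin

fun aval :: "state \<Rightarrow> exp \<Rightarrow> nat" where
  "aval s (N n) = n"
| "aval s (V x) = vars s x"
| "aval s (Op f e1 e2) = nat_op f (aval s e1) (aval s e2)"
| "aval s (Rd k e) = arr s k (aval s e)"
| "aval s (In e) = inp ! aval s e"

fun aok :: "state \<Rightarrow> exp \<Rightarrow> bool" where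
  "aok s (N n) \<longleftrightarrow> n < 2 ^ w"
| "aok s (V x) \<longleftrightarrow> True"
| "aok s (Op f e1 e2) \<longleftrightarrow> aok s e1 \<and> aok s e2 \<and> op_ok w f (aval s e1) (aval s e2)"
| "aok s (Rd k e) \<longleftrightarrow> aok s e \<and> aval s e < M"
| "aok s (In e) \<longleftrightarrow> aok s e \<and> aval s e < length inp"

fun bval :: "state \<Rightarrow> bexp \<Rightarrow> bool" where
  "bval s (Less e1 e2) \<longleftrightarrow> aval s e1 < aval s e2"
| "bval s (Eq e1 e2) \<longleftrightarrow> aval s e1 = aval s e2"
| "bval s (And b1 b2) \<longleftrightarrow> bval s b1 \<and> bval s b2"

fun bok :: "state \<Rightarrow> bexp \<Rightarrow> bool" where
  "bok s (Less e1 e2) \<longleftrightarrow> aok s e1 \<and> aok s e2"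
| "bok s (Eq e1 e2) \<longleftrightarrow> aok s e1 \<and> aok s e2"
| "bok s (And b1 b2) \<longleftrightarrow> bok s b1 \<and> (bval s b1 \<longrightarrow> bok s b2)"

text \<open>Ticks are charged for assignments, writes, outputs and tests. Evaluating an expression
  is free: its number of instructions is fixed by the program text and is absorbed into the constant
  factor of the compiler.\<close>

inductive exec :: "com \<Rightarrow> state \<Rightarrow> state \<Rightarrow> bool" where
  exec_Assign: "aok s e \<Longrightarrow> exec (Assign x e) s (tick (s\<lparr>vars := (vars s)(x := aval s e)\<rparr>))"
| exec_Write: "aok s e1 \<Longrightarrow> aok s e2 \<Longrightarrow> aval s e1 < M \<Longrightarrow>
    exec (Write k e1 e2) s
      (tick (s\<lparr>arr := (arr s)(k := (arr s k)(aval s e1 := aval s e2))\<rparr>))"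
| exec_Emit: "aok s e \<Longrightarrow> exec (Emit e) s (tick (s\<lparr>written := written s @ [aval s e]\<rparr>))"
| exec_Seq: "exec c1 s s' \<Longrightarrow> exec c2 s' s'' \<Longrightarrow> exec (Seq c1 c2) s s''"
| exec_If: "bok s b \<Longrightarrow> exec (if bval s b then c1 else c2) (tick s) s' \<Longrightarrow> exec (If b c1 c2) s s'"
| exec_While_False: "bok s b \<Longrightarrow> \<not> bval s b \<Longrightarrow> exec (While b c) s (tick s)"
| exec_While_True: "bok s b \<Longrightarrow> bval s b \<Longrightarrow> exec c (tick s) s' \<Longrightarrow> exec (While b c) s' s'' \<Longrightarrow>
    exec (While b c) s s''"

text \<open>This is total correctness, and since \<open>ticks\<close> belongs to the state,
  postconditions also express time bounds.\<close>

definition wp :: "com \<Rightarrow> (state \<Rightarrow> bool) \<Rightarrow> state \<Rightarrow> bool" where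
  "wp c Q s \<longleftrightarrow> (\<exists>s'. exec c s s' \<and> Q s')"

inductive_cases exec_AssignE: "exec (Assign x e) s s'"
inductive_cases exec_WriteE: "exec (Write k e1 e2) s s'"
inductive_cases exec_EmitE: "exec (Emit e) s s'"
inductive_cases exec_SeqE: "exec (Seq c1 c2) s s'"
inductive_cases exec_IfE: "exec (If b c1 c2) s s'"

lemma wp_Assign [simp]:
  "wp (Assign x e) Q s \<longleftrightarrow> aok s e \<and> Q (tick (s\<lparr>vars := (vars s)(x := aval s e)\<rparr>))"
  unfolding wp_def by (auto elim: exec_AssignE intro: exec_Assign)

lemma wp_Write [simp]:
  "wp (Write k e1 e2) Q s \<longleftrightarrow> aok s e1 \<and> aok s e2 \<and> aval s e1 < M \<and>
     Q (tick (s\<lparr>arr := (arr s)(k := (arr s k)(aval s e1 := aval s e2))\<rparr>))"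
  unfolding wp_def by (auto elim: exec_WriteE intro: exec_Write)

lemma wp_Emit [simp]:
  "wp (Emit e) Q s \<longleftrightarrow> aok s e \<and> Q (tick (s\<lparr>written := written s @ [aval s e]\<rparr>))"
  unfolding wp_def by (auto elim: exec_EmitE intro: exec_Emit)

lemma wp_Seq [simp]: "wp (Seq c1 c2) Q = wp c1 (wp c2 Q)"
  unfolding wp_def fun_eq_iff by (blast elim: exec_SeqE intro: exec_Seq)

lemma wp_If [simp]:
  "wp (If b c1 c2) Q s \<longleftrightarrow>
     bok s b \<and> (bval s b \<longrightarrow> wp c1 Q (tick s)) \<and> (\<not> bval s b \<longrightarrow> wp c2 Q (tick s))"
  unfolding wp_def using exec_If[of s b c1 c2] by (cases "bval s b") (auto elim!: exec_IfE)

lemma wp_mono: "wp c Q s \<Longrightarrow> (\<And>s'. Q s' \<Longrightarrow> Q' s') \<Longrightarrow> wp c Q' s"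
  unfolding wp_def by blast

lemma wp_While:
  fixes measure :: "state \<Rightarrow> nat"
  assumes "I s"
    and "\<And>s. I s \<Longrightarrow> bok s b"
    and "\<And>s. I s \<Longrightarrow> bval s b \<Longrightarrow> wp c (\<lambda>s'. I s' \<and> measure s' < measure s) (tick s)"
    and "\<And>s. I s \<Longrightarrow> \<not> bval s b \<Longrightarrow> Q (tick s)"
  shows "wp (While b c) Q s"
  using assms(1)
proof (induction s rule: measure_induct_rule[where f = measure])
  case (less s)
  show ?case
  proof (cases "bval s b")
    case True
    then obtain s' where "exec c (tick s) s'" "I s'" "measure s' < measure s"
      using assms(3) less.prems unfolding wp_def by blast
    moreover from this obtain s'' where "exec (While b c) s' s''" "Q s''"
      using less.IH unfolding wp_def by blast
    ultimately show ?thesis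
      unfolding wp_def using exec_While_True[OF assms(2)[OF less.prems] True] by blast
  next
    case False
    then show ?thesis
      unfolding wp_def using exec_While_False[OF assms(2)[OF less.prems] False] assms(4) less.prems by blast
  qed
qed

end

section \<open>The compiler\<close>

text \<open>
  Register 0 holds the length of the input, registers 1 to 19 the program variables, and those
  from 20 on intermediate results. The nine arrays are interleaved behind the input.
\<close>

abbreviation num_arrays :: nat where "num_arrays \<equiv> 9"

text \<open>Register \<open>d\<close> is the top of an expression stack: the value is delivered
  there and lower registers survive, so a first operand stays intact while the second is
  computed.\<close>

fun compile_exp :: "exp \<Rightarrow> nat \<Rightarrow> instr list" where
  "compile_exp (N n) d = [Const d n]"
| "compile_exp (V x) d = [Move d x]"
| "compile_exp (Op f e1 e2) d =
    compile_exp e1 d @ compile_exp e2 (Suc d) @ [Bin f d d (Suc d)]"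
| "compile_exp (Rd k e) d = compile_exp e d @
    [Const (Suc d) num_arrays, Bin Mul d d (Suc d), Bin Add d d 0, Const (Suc d) k,
     Bin Add d d (Suc d), Load d d]"
| "compile_exp (In e) d = compile_exp e d @ [Load d d]"

fun bexp_length :: "bexp \<Rightarrow> nat" where
  "bexp_length (Less e1 e2) = length (compile_exp e1 20) + length (compile_exp e2 21) + 2"
| "bexp_length (Eq e1 e2) = length (compile_exp e1 20) + length (compile_exp e2 21) + 2"
| "bexp_length (And b1 b2) = bexp_length b1 + bexp_length b2"

text \<open>Jump targets are absolute, hence the start address \<open>p\<close>. A true test falls
  out at the end of its code and a false one goes to \<open>l\<close>; in \<open>And\<close> the end
  of the first test is the start of the second, which gives short-circuit evaluation.\<close>

fun compile_bexp :: "bexp \<Rightarrow> nat \<Rightarrow> nat \<Rightarrow> instr list" where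
  "compile_bexp (Less e1 e2) p l = compile_exp e1 20 @ compile_exp e2 21 @
    [JumpLess 20 21 (p + bexp_length (Less e1 e2)), Jump l]"
| "compile_bexp (Eq e1 e2) p l = compile_exp e1 20 @ compile_exp e2 21 @
    [JumpEq 20 21 (p + bexp_length (Eq e1 e2)), Jump l]"
| "compile_bexp (And b1 b2) p l = compile_bexp b1 p l @ compile_bexp b2 (p + bexp_length b1) l"

fun com_length :: "com \<Rightarrow> nat" where
  "com_length (Assign x e) = length (compile_exp e 20) + 1"
| "com_length (Write k e1 e2) = length (compile_exp e1 20) + length (compile_exp e2 21) + 6"
| "com_length (Emit e) = length (compile_exp e 20) + 1"
| "com_length (Seq c1 c2) = com_length c1 + com_length c2"
| "com_length (If b c1 c2) = bexp_length b + com_length c1 + com_length c2 + 1"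
| "com_length (While b c) = bexp_length b + com_length c + 1"

fun compile :: "com \<Rightarrow> nat \<Rightarrow> instr list" where
  "compile (Assign x e) p = compile_exp e 20 @ [Move x 20]"
| "compile (Write k e1 e2) p = compile_exp e1 20 @ compile_exp e2 21 @
    [Const 22 num_arrays, Bin Mul 20 20 22, Bin Add 20 20 0, Const 22 k, Bin Add 20 20 22,
     Store 20 21]"
| "compile (Emit e) p = compile_exp e 20 @ [Output 20]"
| "compile (Seq c1 c2) p = compile c1 p @ compile c2 (p + com_length c1)"
| "compile (If b c1 c2) p =
    compile_bexp b p (p + bexp_length b + com_length c1 + 1) @
    compile c1 (p + bexp_length b) @
    [Jump (p + com_length (If b c1 c2))] @
    compile c2 (p + bexp_length b + com_length c1 + 1)"
| "compile (While b c) p =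
    compile_bexp b p (p + com_length (While b c)) @ compile c (p + bexp_length b) @ [Jump p]"

lemma length_compile_bexp [simp]: "length (compile_bexp b p l) = bexp_length b"
  by (induction b arbitrary: p) auto

lemma length_compile [simp]: "length (compile c p) = com_length c"
  by (induction c arbitrary: p) auto

fun wf_exp :: "exp \<Rightarrow> bool" where
  "wf_exp (N n) \<longleftrightarrow> True"
| "wf_exp (V x) \<longleftrightarrow> 0 < x \<and> x < 20"
| "wf_exp (Op f e1 e2) \<longleftrightarrow> wf_exp e1 \<and> wf_exp e2"
| "wf_exp (Rd k e) \<longleftrightarrow> k < num_arrays \<and> wf_exp e"
| "wf_exp (In e) \<longleftrightarrow> wf_exp e"

fun wf_bexp :: "bexp \<Rightarrow> bool" where
  "wf_bexp (Less e1 e2) \<longleftrightarrow> wf_exp e1 \<and> wf_exp e2"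
| "wf_bexp (Eq e1 e2) \<longleftrightarrow> wf_exp e1 \<and> wf_exp e2"
| "wf_bexp (And b1 b2) \<longleftrightarrow> wf_bexp b1 \<and> wf_bexp b2"

fun wf_com :: "com \<Rightarrow> bool" where
  "wf_com (Assign x e) \<longleftrightarrow> 0 < x \<and> x < 20 \<and> wf_exp e"
| "wf_com (Write k e1 e2) \<longleftrightarrow> k < num_arrays \<and> wf_exp e1 \<and> wf_exp e2"
| "wf_com (Emit e) \<longleftrightarrow> wf_exp e"
| "wf_com (Seq c1 c2) \<longleftrightarrow> wf_com c1 \<and> wf_com c2"
| "wf_com (If b c1 c2) \<longleftrightarrow> wf_bexp b \<and> wf_com c1 \<and> wf_com c2"
| "wf_com (While b c) \<longleftrightarrow> wf_bexp b \<and> wf_com c"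

definition code_at :: "instr list \<Rightarrow> nat \<Rightarrow> instr list \<Rightarrow> bool" where
  "code_at prog p xs \<longleftrightarrow> (\<exists>us vs. prog = us @ xs @ vs \<and> length us = p)"

lemma code_at_append: "code_at prog p (xs @ ys) \<longleftrightarrow> code_at prog p xs \<and> code_at prog (p + length xs) ys"
proof
  assume "code_at prog p (xs @ ys)"
  then obtain us vs where "prog = us @ (xs @ ys) @ vs" "length us = p" by (auto simp: code_at_def)
  then have "prog = us @ xs @ (ys @ vs)" "prog = (us @ xs) @ ys @ vs" "length us = p" by auto
  then show "code_at prog p xs \<and> code_at prog (p + length xs) ys"
    unfolding code_at_def by (metis length_append)
next
  assume A: "code_at prog p xs \<and> code_at prog (p + length xs) ys"
  then obtain us vs us' vs' where 1: "prog = us @ xs @ vs" "length us = p"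
    and 2: "prog = us' @ ys @ vs'" "length us' = p + length xs" unfolding code_at_def by metis
  have "us' = take (p + length xs) prog" using 2 by simp
  also have "\<dots> = us @ xs" using 1 by simp
  finally have "prog = us @ (xs @ ys) @ vs'" using 2 by simp
  then show "code_at prog p (xs @ ys)" using 1 unfolding code_at_def by blast
qed

lemma code_at_Cons:
  "code_at prog p (x # xs) \<longleftrightarrow> p < length prog \<and> prog ! p = x \<and> code_at prog (Suc p) xs"
proof -
  have "code_at prog p [x] \<longleftrightarrow> p < length prog \<and> prog ! p = x"
    unfolding code_at_def
    by (auto simp: nth_append) (metis append_Cons append_Nil id_take_nth_drop length_take min.absorb4)
  then show ?thesis using code_at_append[of prog p "[x]" xs] by simp
qed

section \<open>Simulation of compiled code on the word RAM\<close>

locale while_machine = while_language w inp M for w :: nat and inp :: "nat list" and M :: nat +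
  fixes S :: nat and prog :: "instr list"
  assumes space: "length inp + num_arrays * M \<le> S" "length inp + num_arrays * M < 2 ^ w"
begin

definition runs :: "nat \<Rightarrow> config \<Rightarrow> config \<Rightarrow> bool" where
  "runs t = step w S prog ^^ t"

lemma runs_0: "runs 0 c c"
  by (simp add: runs_def)

lemma runs_trans: "runs t c c' \<Longrightarrow> runs t' c' c'' \<Longrightarrow> runs (t + t') c c''"
  by (auto simp: runs_def relpowp_add)

lemma runs_1:
  "code_at prog p [i] \<Longrightarrow> pc c = p \<Longrightarrow> exec_instr w S i c = Some c' \<Longrightarrow> runs (Suc 0) c c'"
  by (auto simp: runs_def code_at_Cons step_def)

fun straight :: "instr \<Rightarrow> bool" where
  "straight (Jump l) \<longleftrightarrow> False"
| "straight (JumpEq r s l) \<longleftrightarrow> False"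
| "straight (JumpLess r s l) \<longleftrightarrow> False"
| "straight _ \<longleftrightarrow> True"

fun exec_straight :: "instr list \<Rightarrow> config \<Rightarrow> config option" where
  "exec_straight [] c = Some c"
| "exec_straight (i # is) c =
    (if straight i then case exec_instr w S i c of Some c' \<Rightarrow> exec_straight is c' | None \<Rightarrow> None
     else None)"

lemma pc_straight: "straight i \<Longrightarrow> exec_instr w S i c = Some c' \<Longrightarrow> pc c' = Suc (pc c)"
  by (cases i) (auto simp: set_reg_def split: if_splits)

lemma runs_straight:
  "exec_straight is c = Some c' \<Longrightarrow> code_at prog (pc c) is \<Longrightarrow>
   runs (length is) c c' \<and> pc c' = pc c + length is"
proof (induction "is" arbitrary: c)
  case (Cons i "is")
  from Cons.prems(1) obtain c1 where i: "straight i" and c1: "exec_instr w S i c = Some c1"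
    and rest: "exec_straight is c1 = Some c'" by (auto split: if_splits option.splits)
  have "code_at prog (pc c) [i]" "code_at prog (pc c1) is"
    using Cons.prems(2) pc_straight[OF i c1] code_at_append[of prog "pc c" "[i]" "is"] by simp_all
  moreover from this have "runs (Suc 0) c c1" using runs_1 c1 by blast
  ultimately show ?case
    using Cons.IH[OF rest] pc_straight[OF i c1] runs_trans[of "Suc 0" c c1] by auto
qed (simp add: runs_0)

definition represents :: "state \<Rightarrow> config \<Rightarrow> bool" where
  "represents s c \<longleftrightarrow>
    (\<forall>x. 0 < x \<and> x < 20 \<longrightarrow> regs c x = vars s x) \<and> regs c 0 = length inp \<and>
    (\<forall>i < length inp. mem c i = inp ! i) \<and>
    (\<forall>k < num_arrays. \<forall>i < M. mem c (length inp + num_arrays * i + k) = arr s k i) \<and>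
    outs c = written s"

definition frame :: "nat \<Rightarrow> config \<Rightarrow> config \<Rightarrow> bool" where
  "frame d c c' \<longleftrightarrow> (\<forall>r < d. regs c' r = regs c r) \<and> mem c' = mem c \<and> outs c' = outs c"

lemma represents_frame: "represents s c \<Longrightarrow> frame d c c' \<Longrightarrow> 20 \<le> d \<Longrightarrow> represents s c'"
  by (auto simp: represents_def frame_def)

lemma address_less: "i < M \<Longrightarrow> k < num_arrays \<Longrightarrow> length inp + num_arrays * i + k < length inp + num_arrays * M"
  by simp

lemma address_bounds:
  assumes "i < M" "k < num_arrays"
  shows "num_arrays mod 2 ^ w = num_arrays" "k mod 2 ^ w = k"
    "(i * num_arrays) mod 2 ^ w = i * num_arrays"
    "(i * num_arrays + length inp) mod 2 ^ w = i * num_arrays + length inp"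
    "(i * num_arrays + length inp + k) mod 2 ^ w = i * num_arrays + length inp + k"
proof -
  have "1 \<le> M" using assms(1) by simp
  then have "num_arrays < 2 ^ w" using space(2) by simp
  then show "num_arrays mod 2 ^ w = num_arrays" "k mod 2 ^ w = k" using assms(2) by simp_all
qed (use address_less[OF assms] space in \<open>auto intro!: mod_less\<close>)

lemma address_inj:
  assumes "k < num_arrays" "k' < num_arrays"
  shows "length inp + num_arrays * i + k = length inp + num_arrays * i' + k' \<longleftrightarrow> i = i' \<and> k = k'"
proof (cases i i' rule: linorder_cases)
  case less
  then have "Suc i \<le> i'" by simp
  then have "num_arrays * Suc i \<le> num_arrays * i'" by (rule mult_le_mono2)
  then show ?thesis using less assms by simp
next
  case greater
  then have "Suc i' \<le> i" by simp
  then have "num_arrays * Suc i' \<le> num_arrays * i" by (rule mult_le_mono2)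
  then show ?thesis using greater assms by simp
qed simp

lemma set_reg_simps [simp]:
  "pc (set_reg r x c) = Suc (pc c)" "regs (set_reg r x c) = (regs c)(r := x)"
  "mem (set_reg r x c) = mem c" "outs (set_reg r x c) = outs c"
  by (simp_all add: set_reg_def)

text \<open>Reading and writing an array share this address computation. No step wraps around, as
  all addresses lie below \<open>2 ^ w\<close>; the scratch register \<open>t\<close> is left with
  the array number.\<close>

lemma exec_address:
  assumes "regs c a = i" "regs c 0 = length inp" "i < M" "k < num_arrays" "a \<noteq> t" "0 < a" "0 < t"
  shows "exec_straight ([Const t num_arrays, Bin Mul a a t, Bin Add a a 0, Const t k, Bin Add a a t] @ is) c =
    exec_straight is (c\<lparr>pc := pc c + 5,
      regs := (regs c)(a := length inp + num_arrays * i + k, t := k)\<rparr>)"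
proof -
  note bounds = address_bounds[OF assms(3,4)]
  let ?c1 = "set_reg t num_arrays c"
  let ?c2 = "set_reg a (i * num_arrays) ?c1"
  let ?c3 = "set_reg a (i * num_arrays + length inp) ?c2"
  let ?c4 = "set_reg t k ?c3"
  let ?c5 = "set_reg a (i * num_arrays + length inp + k) ?c4"
  have "exec_instr w S (Const t num_arrays) c = Some ?c1"
    "exec_instr w S (Bin Mul a a t) ?c1 = Some ?c2"
    "exec_instr w S (Bin Add a a 0) ?c2 = Some ?c3"
    "exec_instr w S (Const t k) ?c3 = Some ?c4"
    "exec_instr w S (Bin Add a a t) ?c4 = Some ?c5"
    using assms by (simp_all only: exec_instr.simps eval_binop.simps set_reg_simps fun_upd_apply bounds
        if_True if_False simp_thms) (simp_all add: bounds)
  then have "exec_straight ([Const t num_arrays, Bin Mul a a t, Bin Add a a 0, Const t k, Bin Add a a t] @ is) c =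
      exec_straight is ?c5" by simp
  also have "?c5 = c\<lparr>pc := pc c + 5, regs := (regs c)(a := length inp + num_arrays * i + k, t := k)\<rparr>"
    using assms by (auto simp: set_reg_def fun_eq_iff)
  finally show ?thesis .
qed

lemma compile_exp_correct:
  assumes "wf_exp e" "aok s e" "code_at prog p (compile_exp e d)" "represents s c" "pc c = p" "20 \<le> d"
  shows "\<exists>c'. runs (length (compile_exp e d)) c c' \<and> pc c' = p + length (compile_exp e d) \<and>
           regs c' d = aval s e \<and> frame d c c'"
  using assms
proof (induction e arbitrary: d c p)
  case (N n)
  then show ?case
    by (intro exI[of _ "set_reg d n c"]) (auto simp: set_reg_def frame_def intro!: runs_1)
next
  case (V x)
  then have "regs c x = vars s x" by (simp add: represents_def)
  then show ?case using V
    by (intro exI[of _ "set_reg d (vars s x) c"]) (auto simp: set_reg_def frame_def intro!: runs_1)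
next
  case (Op f e1 e2)
  let ?l1 = "length (compile_exp e1 d)" and ?l2 = "length (compile_exp e2 (Suc d))"
  have code: "code_at prog p (compile_exp e1 d)" "code_at prog (p + ?l1) (compile_exp e2 (Suc d))"
    "code_at prog (p + ?l1 + ?l2) [Bin f d d (Suc d)]"
    using Op.prems by (auto simp: code_at_append)
  obtain c1 where c1: "runs ?l1 c c1" "pc c1 = p + ?l1" "regs c1 d = aval s e1" "frame d c c1"
    using Op.IH(1)[OF _ _ code(1)] Op.prems by auto
  have "represents s c1" using represents_frame c1(4) Op.prems by blast
  then obtain c2 where c2: "runs ?l2 c1 c2" "pc c2 = p + ?l1 + ?l2" "regs c2 (Suc d) = aval s e2"
    "frame (Suc d) c1 c2"
    using Op.IH(2)[OF _ _ code(2)] c1 Op.prems by auto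
  have d: "regs c2 d = aval s e1" using c1 c2 by (simp add: frame_def)
  let ?c = "set_reg d (aval s (Op f e1 e2)) c2"
  have "exec_instr w S (Bin f d d (Suc d)) c2 = Some ?c"
    using Op.prems d c2 by (simp add: eval_binop_nat_op)
  then have "runs (Suc 0) c2 ?c" using code(3) c2 runs_1 by blast
  then have "runs (?l1 + ?l2 + Suc 0) c ?c" using c1 c2 runs_trans by blast
  moreover have "frame d c ?c" using c1 c2 by (auto simp: frame_def set_reg_def)
  ultimately show ?case using c2 by (intro exI[of _ ?c]) (simp add: set_reg_def)
next
  case (Rd k e)
  let ?l = "length (compile_exp e d)" and ?i = "aval s e"
  let ?a = "length inp + num_arrays * ?i + k"
  have code: "code_at prog p (compile_exp e d)"
    "code_at prog (p + ?l) [Const (Suc d) num_arrays, Bin Mul d d (Suc d), Bin Add d d 0,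
       Const (Suc d) k, Bin Add d d (Suc d), Load d d]"
    using Rd.prems by (auto simp: code_at_append)
  obtain c1 where c1: "runs ?l c c1" "pc c1 = p + ?l" "regs c1 d = ?i" "frame d c c1"
    using Rd.IH[OF _ _ code(1)] Rd.prems by auto
  have rep: "represents s c1" using represents_frame c1(4) Rd.prems by blast
  have a: "?a < length inp + num_arrays * M" using Rd.prems by (intro address_less) auto
  have mem: "mem c1 ?a = arr s k ?i" using rep Rd.prems by (simp add: represents_def)
  have regs0: "regs c1 0 = length inp" using rep by (simp add: represents_def)
  have k: "k < num_arrays" and i: "?i < M" using Rd.prems by auto
  let ?c = "c1\<lparr>pc := p + ?l + 6, regs := (regs c1)(d := arr s k ?i, Suc d := k)\<rparr>"
  let ?is = "[Const (Suc d) num_arrays, Bin Mul d d (Suc d), Bin Add d d 0,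
       Const (Suc d) k, Bin Add d d (Suc d), Load d d]"
  have "exec_straight ?is c1 = exec_straight [Load d d]
      (c1\<lparr>pc := pc c1 + 5, regs := (regs c1)(d := ?a, Suc d := k)\<rparr>)"
    using exec_address[OF c1(3) regs0 i k, of "Suc d" "[Load d d]"] Rd.prems(6)
    by (simp only: append.simps)
  also have "\<dots> = Some ?c"
    using c1(2) Rd.prems(6) a space mem by (simp add: set_reg_def fun_upd_twist)
  finally have "exec_straight ?is c1 = Some ?c" .
  from runs_straight[OF this, unfolded c1(2), OF code(2)]
  have "runs (?l + length ?is) c ?c" using runs_trans[OF c1(1)] by blast
  then show ?case using c1 by (intro exI[of _ ?c]) (auto simp: frame_def)
next
  case (In e)
  let ?l = "length (compile_exp e d)"
  have code: "code_at prog p (compile_exp e d)" "code_at prog (p + ?l) [Load d d]"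
    using In.prems by (auto simp: code_at_append)
  obtain c1 where c1: "runs ?l c c1" "pc c1 = p + ?l" "regs c1 d = aval s e" "frame d c c1"
    using In.IH[OF _ _ code(1)] In.prems by auto
  have "represents s c1" using represents_frame c1(4) In.prems by blast
  then have "mem c1 (aval s e) = inp ! aval s e" using In.prems by (simp add: represents_def)
  then have "exec_instr w S (Load d d) c1 = Some (set_reg d (inp ! aval s e) c1)"
    using c1 In.prems space by simp
  then have "runs (Suc 0) c1 (set_reg d (inp ! aval s e) c1)" using code c1 runs_1 by blast
  then have "runs (?l + Suc 0) c (set_reg d (inp ! aval s e) c1)" using c1 runs_trans by blast
  then show ?case using c1
    by (intro exI[of _ "set_reg d (inp ! aval s e) c1"]) (auto simp: frame_def set_reg_def)
qed


text \<open>Abstracting the jump \<open>J\<close> and its relation \<open>R\<close> lets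
  \<open>Less\<close> and \<open>Eq\<close> share one argument. A fulfilled comparison leaps over
  the \<open>Jump l\<close> behind it.\<close>

lemma compare_correct:
  assumes "wf_exp e1" "wf_exp e2" "aok s e1" "aok s e2"
    and J: "\<And>c. exec_instr w S (J 20 21 q) c = Some (c\<lparr>pc := (if R (regs c 20) (regs c 21) then q else Suc (pc c))\<rparr>)"
    and code: "code_at prog p (compile_exp e1 20 @ compile_exp e2 21 @ [J 20 21 q, Jump l])"
    and q: "q = p + length (compile_exp e1 20) + length (compile_exp e2 21) + 2"
    and rep: "represents s c" "pc c = p"
  shows "\<exists>t c'. t \<le> length (compile_exp e1 20) + length (compile_exp e2 21) + 2 \<and> runs t c c' \<and>
           represents s c' \<and> pc c' = (if R (aval s e1) (aval s e2) then q else l)"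
proof -
  let ?l1 = "length (compile_exp e1 20)" and ?l2 = "length (compile_exp e2 21)"
  have code: "code_at prog p (compile_exp e1 20)" "code_at prog (p + ?l1) (compile_exp e2 21)"
    "code_at prog (p + ?l1 + ?l2) [J 20 21 q]" "code_at prog (Suc (p + ?l1 + ?l2)) [Jump l]"
    using code code_at_append[of prog _ "[J 20 21 q]" "[Jump l]"] by (auto simp: code_at_append)
  obtain c1 where c1: "runs ?l1 c c1" "pc c1 = p + ?l1" "regs c1 20 = aval s e1" "frame 20 c c1"
    using compile_exp_correct[OF assms(1,3) code(1) rep] by auto
  have rep1: "represents s c1" using represents_frame[OF rep(1) c1(4)] by simp
  obtain c2 where c2: "runs ?l2 c1 c2" "pc c2 = p + ?l1 + ?l2" "regs c2 21 = aval s e2" "frame 21 c1 c2"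
    using compile_exp_correct[OF assms(2,4) code(2) rep1 c1(2)] by auto
  have rep2: "represents s c2" using represents_frame[OF rep1 c2(4)] by simp
  have eq: "regs c2 20 = aval s e1" using c1 c2 by (simp add: frame_def)
  have run2: "runs (?l1 + ?l2) c c2" using c1 c2 runs_trans by blast
  let ?c = "c2\<lparr>pc := (if R (regs c2 20) (regs c2 21) then q else Suc (pc c2))\<rparr>"
  have "runs (Suc 0) c2 ?c" using code(3) c2(2) J[of c2] by (rule runs_1)
  then have run3: "runs (?l1 + ?l2 + Suc 0) c ?c" using run2 runs_trans by blast
  show ?thesis
  proof (cases "R (aval s e1) (aval s e2)")
    case True
    then show ?thesis using run3 rep2 eq c2
      by (intro exI[of _ "?l1 + ?l2 + Suc 0"] exI[of _ ?c]) (simp add: represents_def)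
  next
    case False
    have "runs (Suc 0) ?c (?c\<lparr>pc := l\<rparr>)"
      using code(4) c2 eq False by (intro runs_1) auto
    then have "runs (?l1 + ?l2 + Suc 0 + Suc 0) c (?c\<lparr>pc := l\<rparr>)" using run3 runs_trans by blast
    then show ?thesis using rep2 False
      by (intro exI[of _ "?l1 + ?l2 + Suc 0 + Suc 0"] exI[of _ "?c\<lparr>pc := l\<rparr>"]) (simp add: represents_def)
  qed
qed

lemma compile_bexp_correct:
  assumes "wf_bexp b" "bok s b" "code_at prog p (compile_bexp b p l)" "represents s c" "pc c = p"
  shows "\<exists>t c'. t \<le> bexp_length b \<and> runs t c c' \<and> represents s c' \<and>
           pc c' = (if bval s b then p + bexp_length b else l)"
  using assms
proof (induction b arbitrary: c p)
  case (Less e1 e2)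
  then show ?case using compare_correct[of e1 e2 s JumpLess "p + bexp_length (Less e1 e2)" "(<)" p l c] by simp
next
  case (Eq e1 e2)
  then show ?case using compare_correct[of e1 e2 s JumpEq "p + bexp_length (Eq e1 e2)" "(=)" p l c] by simp
next
  case (And b1 b2)
  have code: "code_at prog p (compile_bexp b1 p l)"
    "code_at prog (p + bexp_length b1) (compile_bexp b2 (p + bexp_length b1) l)"
    using And.prems by (auto simp: code_at_append)
  obtain t1 c1 where c1: "t1 \<le> bexp_length b1" "runs t1 c c1" "represents s c1"
    "pc c1 = (if bval s b1 then p + bexp_length b1 else l)"
    using And.IH(1)[OF _ _ code(1) And.prems(4,5)] And.prems(1,2) by auto
  show ?case
  proof (cases "bval s b1")
    case True
    then obtain t2 c2 where c2: "t2 \<le> bexp_length b2" "runs t2 c1 c2" "represents s c2"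
      "pc c2 = (if bval s b2 then p + bexp_length b1 + bexp_length b2 else l)"
      using And.IH(2)[OF _ _ code(2) c1(3)] And.prems(1,2) c1(4) by auto
    have "runs (t1 + t2) c c2" using c1 c2 runs_trans by blast
    then show ?thesis using True c1 c2 by (intro exI[of _ "t1 + t2"] exI[of _ c2]) auto
  next
    case False
    then show ?thesis using c1 by (intro exI[of _ t1] exI[of _ c1]) auto
  qed
qed

lemma exec_ticks: "exec com s s' \<Longrightarrow> ticks s \<le> ticks s'"
  by (induction rule: exec.induct) auto

text \<open>Every tick is charged with \<open>com_length com\<close> instructions. The tick of a
  test covers the code of the test and the jump closing the branch or the loop round; the ticks of a
  subcommand cover its own instructions.\<close>

lemma compile_correct:
  assumes "exec com s s'" "wf_com com" "code_at prog p (compile com p)" "represents s c" "pc c = p"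
  shows "\<exists>t c'. t \<le> com_length com * (ticks s' - ticks s) \<and> runs t c c' \<and> represents s' c' \<and>
           pc c' = p + com_length com"
  using assms
proof (induction arbitrary: c p rule: exec.induct)
  case (exec_Assign s e x)
  let ?l = "length (compile_exp e 20)"
  have code: "code_at prog p (compile_exp e 20)" "code_at prog (p + ?l) [Move x 20]"
    using exec_Assign.prems by (auto simp: code_at_append)
  obtain c1 where c1: "runs ?l c c1" "pc c1 = p + ?l" "regs c1 20 = aval s e" "frame 20 c c1"
    using compile_exp_correct[OF _ exec_Assign.hyps code(1) exec_Assign.prems(3,4)] exec_Assign.prems(1) by auto
  have rep: "represents s c1" using represents_frame c1 exec_Assign.prems by blast
  let ?c = "set_reg x (aval s e) c1"
  have "runs (Suc 0) c1 ?c" using code(2) c1 by (intro runs_1) auto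
  then have "runs (?l + Suc 0) c ?c" using c1 runs_trans by blast
  moreover have "represents (tick (s\<lparr>vars := (vars s)(x := aval s e)\<rparr>)) ?c"
    using rep exec_Assign.prems by (auto simp: represents_def set_reg_def)
  ultimately show ?case using c1
    by (intro exI[of _ "?l + Suc 0"] exI[of _ ?c]) (simp add: set_reg_def)
next
  case (exec_Write s e1 e2 k)
  let ?l1 = "length (compile_exp e1 20)" and ?l2 = "length (compile_exp e2 21)"
  let ?i = "aval s e1" and ?x = "aval s e2"
  let ?a = "length inp + num_arrays * ?i + k"
  let ?is = "[Const 22 num_arrays, Bin Mul 20 20 22, Bin Add 20 20 0, Const 22 k, Bin Add 20 20 22,
     Store 20 21]"
  have code: "code_at prog p (compile_exp e1 20)" "code_at prog (p + ?l1) (compile_exp e2 21)"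
    "code_at prog (p + ?l1 + ?l2) ?is"
    using exec_Write.prems by (auto simp: code_at_append)
  obtain c1 where c1: "runs ?l1 c c1" "pc c1 = p + ?l1" "regs c1 20 = ?i" "frame 20 c c1"
    using compile_exp_correct[OF _ exec_Write.hyps(1) code(1) exec_Write.prems(3,4)] exec_Write.prems(1) by auto
  have rep1: "represents s c1" using represents_frame c1 exec_Write.prems by blast
  obtain c2 where c2: "runs ?l2 c1 c2" "pc c2 = p + ?l1 + ?l2" "regs c2 21 = ?x" "frame 21 c1 c2"
    using compile_exp_correct[OF _ exec_Write.hyps(2) code(2) rep1 c1(2)] exec_Write.prems(1) by auto
  have rep: "represents s c2" using represents_frame c2 rep1 by fastforce
  have regs: "regs c2 20 = ?i" "regs c2 0 = length inp"
    using c1 c2 rep by (auto simp: frame_def represents_def)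
  have k: "k < num_arrays" using exec_Write.prems by simp
  have a: "?a < length inp + num_arrays * M" using exec_Write.hyps k by (intro address_less) auto
  let ?c = "c2\<lparr>pc := p + ?l1 + ?l2 + 6, regs := (regs c2)(20 := ?a, 22 := k), mem := (mem c2)(?a := ?x)\<rparr>"
  have "exec_straight ?is c2 = exec_straight [Store 20 21]
      (c2\<lparr>pc := pc c2 + 5, regs := (regs c2)(20 := ?a, 22 := k)\<rparr>)"
    using exec_address[OF regs exec_Write.hyps(3) k, of 22 "[Store 20 21]"]
    by (simp only: append.simps zero_less_numeral)
  also have "\<dots> = Some ?c" using c2 a space by simp
  finally have "exec_straight ?is c2 = Some ?c" .
  from runs_straight[OF this, unfolded c2(2), OF code(3)]
  have "runs (?l1 + ?l2 + length ?is) c ?c" using runs_trans[OF runs_trans[OF c1(1) c2(1)]] by blast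
  moreover have "represents (tick (s\<lparr>arr := (arr s)(k := (arr s k)(?i := ?x))\<rparr>)) ?c"
    using rep k address_inj unfolding represents_def by (auto simp: frame_def)
  ultimately show ?case by (intro exI[of _ "?l1 + ?l2 + length ?is"] exI[of _ ?c]) simp
next
  case (exec_Emit s e)
  let ?l = "length (compile_exp e 20)"
  have code: "code_at prog p (compile_exp e 20)" "code_at prog (p + ?l) [Output 20]"
    using exec_Emit.prems by (auto simp: code_at_append)
  obtain c1 where c1: "runs ?l c c1" "pc c1 = p + ?l" "regs c1 20 = aval s e" "frame 20 c c1"
    using compile_exp_correct[OF _ exec_Emit.hyps code(1) exec_Emit.prems(3,4)] exec_Emit.prems(1) by auto
  have rep: "represents s c1" using represents_frame c1 exec_Emit.prems by blast
  let ?c = "c1\<lparr>pc := Suc (pc c1), outs := outs c1 @ [regs c1 20]\<rparr>"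
  have "runs (Suc 0) c1 ?c" using code(2) c1 by (intro runs_1) auto
  then have "runs (?l + Suc 0) c ?c" using c1 runs_trans by blast
  moreover have "represents (tick (s\<lparr>written := written s @ [aval s e]\<rparr>)) ?c"
    using rep c1 by (auto simp: represents_def)
  ultimately show ?case using c1 by (intro exI[of _ "?l + Suc 0"] exI[of _ ?c]) simp
next
  case (exec_Seq c1 s s' c2 s'')
  have code: "code_at prog p (compile c1 p)"
    "code_at prog (p + com_length c1) (compile c2 (p + com_length c1))"
    using exec_Seq.prems by (auto simp: code_at_append)
  obtain t1 d1 where 1: "t1 \<le> com_length c1 * (ticks s' - ticks s)" "runs t1 c d1" "represents s' d1"
    "pc d1 = p + com_length c1"
    using exec_Seq.IH(1)[OF _ code(1) exec_Seq.prems(3,4)] exec_Seq.prems(1) by auto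
  obtain t2 d2 where 2: "t2 \<le> com_length c2 * (ticks s'' - ticks s')" "runs t2 d1 d2"
    "represents s'' d2" "pc d2 = p + com_length c1 + com_length c2"
    using exec_Seq.IH(2)[OF _ code(2) 1(3,4)] exec_Seq.prems(1) by auto
  have "t1 + t2 \<le> com_length (Seq c1 c2) * (ticks s' - ticks s) + com_length (Seq c1 c2) * (ticks s'' - ticks s')"
    using 1(1) 2(1) by (simp add: distrib_right)
  also have "\<dots> = com_length (Seq c1 c2) * (ticks s'' - ticks s)"
    using exec_ticks[OF exec_Seq.hyps(1)] exec_ticks[OF exec_Seq.hyps(2)]
    by (simp flip: distrib_left)
  finally show ?case using 1 2 runs_trans
    by (intro exI[of _ "t1 + t2"] exI[of _ d2]) auto
next
  case (exec_If s b c1 c2 s')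
  let ?b = "bexp_length b" and ?l1 = "com_length c1" and ?l2 = "com_length c2"
  have code: "code_at prog p (compile_bexp b p (p + ?b + ?l1 + 1))"
    "code_at prog (p + ?b) (compile c1 (p + ?b))"
    "code_at prog (p + ?b + ?l1) [Jump (p + com_length (If b c1 c2))]"
    "code_at prog (p + ?b + ?l1 + 1) (compile c2 (p + ?b + ?l1 + 1))"
    using exec_If.prems(2) by (simp_all only: compile.simps code_at_append length_compile
        length_compile_bexp list.size add_0_right add_Suc_right One_nat_def)
  have ticks: "Suc (ticks s) \<le> ticks s'" using exec_ticks[OF exec_If.hyps(2)] by simp
  let ?L = "?b + ?l1 + ?l2 + 1"
  have total: "?b + x * (ticks s' - Suc (ticks s)) + 1 \<le> ?L * (ticks s' - ticks s)" if "x \<le> ?l1 + ?l2" for x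
  proof -
    have "x * (ticks s' - Suc (ticks s)) \<le> ?L * (ticks s' - Suc (ticks s))"
      using that by (intro mult_right_mono) auto
    moreover have "ticks s' - ticks s = Suc (ticks s' - Suc (ticks s))" using ticks by simp
    ultimately show ?thesis by simp
  qed
  obtain t0 d0 where 0: "t0 \<le> ?b" "runs t0 c d0" "represents s d0"
    "pc d0 = (if bval s b then p + ?b else p + ?b + ?l1 + 1)"
    using compile_bexp_correct[OF _ exec_If.hyps(1) code(1) exec_If.prems(3,4)] exec_If.prems(1) by auto
  have rep0: "represents (tick s) d0" using 0(3) by (simp add: represents_def)
  show ?case
  proof (cases "bval s b")
    case True
    then obtain t1 d1 where 1: "t1 \<le> ?l1 * (ticks s' - Suc (ticks s))" "runs t1 d0 d1"
      "represents s' d1" "pc d1 = p + ?b + ?l1"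
      using exec_If.IH[of "p + ?b" d0] code(2) rep0 0(4) exec_If.prems(1) by auto
    let ?c = "d1\<lparr>pc := p + com_length (If b c1 c2)\<rparr>"
    have "runs (Suc 0) d1 ?c" using code(3) 1(4) by (intro runs_1) auto
    then have "runs (t0 + (t1 + Suc 0)) c ?c" using 0 1 runs_trans by blast
    moreover have "represents s' ?c" using 1(3) by (simp add: represents_def)
    moreover have "t0 + (t1 + Suc 0) \<le> ?L * (ticks s' - ticks s)" using total[of ?l1] 0 1 by simp
    ultimately show ?thesis by (intro exI[of _ "t0 + (t1 + Suc 0)"] exI[of _ ?c]) (simp add: ac_simps)
  next
    case False
    then obtain t1 d1 where 1: "t1 \<le> ?l2 * (ticks s' - Suc (ticks s))" "runs t1 d0 d1"
      "represents s' d1" "pc d1 = p + ?b + ?l1 + 1 + ?l2"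
      using exec_If.IH[of "p + ?b + ?l1 + 1" d0] code(4) rep0 0(4) exec_If.prems(1) by auto
    have "runs (t0 + t1) c d1" using 0 1 runs_trans by blast
    moreover have "t0 + t1 \<le> ?L * (ticks s' - ticks s)" using total[of ?l2] 0 1 by simp
    ultimately show ?thesis using 1 by (intro exI[of _ "t0 + t1"] exI[of _ d1]) (simp add: ac_simps)
  qed
next
  case (exec_While_False s b body)
  let ?b = "bexp_length b"
  have code: "code_at prog p (compile_bexp b p (p + com_length (While b body)))"
    using exec_While_False.prems(2) by (simp add: code_at_append)
  obtain t0 d0 where 0: "t0 \<le> ?b" "runs t0 c d0" "represents s d0" "pc d0 = p + com_length (While b body)"
    using compile_bexp_correct[OF _ exec_While_False.hyps(1) code exec_While_False.prems(3,4)]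
      exec_While_False.hyps(2) exec_While_False.prems(1) by auto
  have "represents (tick s) d0" using 0(3) by (simp add: represents_def)
  then show ?case using 0 by (intro exI[of _ t0] exI[of _ d0]) simp
next
  case (exec_While_True s b body s' s'')
  let ?b = "bexp_length b" and ?l = "com_length body"
  have code: "code_at prog p (compile_bexp b p (p + com_length (While b body)))"
    "code_at prog (p + ?b) (compile body (p + ?b))" "code_at prog (p + ?b + ?l) [Jump p]"
    using exec_While_True.prems(2) by (simp_all add: code_at_append)
  obtain t0 d0 where 0: "t0 \<le> ?b" "runs t0 c d0" "represents s d0" "pc d0 = p + ?b"
    using compile_bexp_correct[OF _ exec_While_True.hyps(1) code(1) exec_While_True.prems(3,4)]
      exec_While_True.hyps(2) exec_While_True.prems(1) by auto
  have "represents (tick s) d0" using 0(3) by (simp add: represents_def)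
  then obtain t1 d1 where 1: "t1 \<le> ?l * (ticks s' - Suc (ticks s))" "runs t1 d0 d1"
      "represents s' d1" "pc d1 = p + ?b + ?l"
    using exec_While_True.IH(1)[OF _ code(2) _ 0(4)] exec_While_True.prems(1) by auto
  let ?c = "d1\<lparr>pc := p\<rparr>"
  have jump: "runs (Suc 0) d1 ?c" using code(3) 1(4) by (intro runs_1) auto
  have "represents s' ?c" using 1(3) by (simp add: represents_def)
  then obtain t2 d2 where 2: "t2 \<le> com_length (While b body) * (ticks s'' - ticks s')" "runs t2 ?c d2"
      "represents s'' d2" "pc d2 = p + com_length (While b body)"
    using exec_While_True.IH(2)[OF exec_While_True.prems(1,2), of ?c] by auto
  have ticks: "Suc (ticks s) \<le> ticks s'" "ticks s' \<le> ticks s''"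
    using exec_ticks[OF exec_While_True.hyps(3)] exec_ticks[OF exec_While_True.hyps(4)] by simp_all
  have "t0 + (t1 + (Suc 0 + t2)) \<le>
      com_length (While b body) * Suc (ticks s' - Suc (ticks s)) +
      com_length (While b body) * (ticks s'' - ticks s')"
    using 0(1) 1(1) 2(1) by (simp add: distrib_right)
  also have "\<dots> = com_length (While b body) * (ticks s'' - ticks s)"
  proof -
    have "Suc (ticks s' - Suc (ticks s)) + (ticks s'' - ticks s') = ticks s'' - ticks s"
      using ticks by simp
    then show ?thesis by (simp only: distrib_left[symmetric])
  qed
  finally have "t0 + (t1 + (Suc 0 + t2)) \<le> com_length (While b body) * (ticks s'' - ticks s)" .
  moreover have "runs (t0 + (t1 + (Suc 0 + t2))) c d2" using 0 1 jump 2 runs_trans by blast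
  ultimately show ?case using 2 by blast
qed

end


text \<open>The initial code computes the length of the input, which the program needs in register 0.\<close>

definition ram_program :: "com \<Rightarrow> instr list" where
  "ram_program c =
    [Const 2 1, Load 2 2, Load 1 1, Bin Add 0 1 2, Bin Add 0 0 0, Const 1 2, Bin Add 0 0 1] @ compile c 7"

definition initial_state :: "(nat \<Rightarrow> nat) \<Rightarrow> state" where
  "initial_state vs = \<lparr>vars = vs, arr = \<lambda>_ _. 0, written = [], ticks = 0\<rparr>"

text \<open>The start-up code leaves values behind in registers \<open>1\<close> and
  \<open>2\<close>, which are program variables afterwards. Hence the program has to be correct from
  every initial valuation \<open>vs\<close>.\<close>

lemma ram_program_computes:
  assumes inp: "length inp = 2 + 2 * (inp ! 0 + inp ! 1)"
    and space: "length inp + num_arrays * M \<le> S" "length inp + num_arrays * M < 2 ^ w"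
    and wf: "wf_com c"
    and wp: "\<And>vs. while_language.wp w inp M c Q (initial_state vs)"
  shows "\<exists>t s. Q s \<and> ram_computes w S (ram_program c) inp t (written s) \<and>
           t \<le> 7 + com_length c * ticks s"
proof -
  interpret while_machine w inp M S "ram_program c" by unfold_locales (rule space)+
  let ?is = "[Const 2 1, Load 2 2, Load 1 1, Bin Add 0 1 2, Bin Add 0 0 0, Const 1 2, Bin Add 0 0 1]"
  let ?c = "(init_config inp)\<lparr>pc := 7,
    regs := (\<lambda>_. 0)(2 := inp ! 1, 1 := 2, 0 := length inp)\<rparr>"
  have code: "code_at (ram_program c) 0 ?is" "code_at (ram_program c) 7 (compile c 7)"
    using code_at_append[of "ram_program c" 0 ?is "compile c 7"]
    by (auto simp: ram_program_def code_at_def)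
  have "(2 :: nat) < 2 ^ w" using space(2) inp by linarith
  then have 1: "1 mod 2 ^ w = (1 :: nat)" "2 mod 2 ^ w = (2 :: nat)"
    by (cases w; simp)+
  have S: "0 < S" "Suc 0 < S" using space(1) inp by linarith+
  have len: "0 < length inp" "Suc 0 < length inp" using inp by linarith+
  have "inp ! 0 + inp ! 1 + (inp ! 0 + inp ! 1) + 2 = length inp" using inp by simp
  moreover have "length inp < 2 ^ w" using space(2) by (rule le_less_trans[rotated]) simp
  ultimately have "inp ! 0 + inp ! 1 + (inp ! 0 + inp ! 1) + 2 < 2 ^ w" by simp
  then have 2: "(inp ! 0 + inp ! 1) mod 2 ^ w = inp ! 0 + inp ! 1"
    "(inp ! 0 + inp ! 1 + (inp ! 0 + inp ! 1)) mod 2 ^ w = inp ! 0 + inp ! 1 + (inp ! 0 + inp ! 1)"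
    "(inp ! 0 + inp ! 1 + (inp ! 0 + inp ! 1) + 2) mod 2 ^ w = length inp"
    using inp by simp_all
  let ?c1 = "set_reg 2 1 (init_config inp)"
  let ?c2 = "set_reg 2 (inp ! 1) ?c1"
  \<comment> \<open>Register \<open>1\<close> still holds its initial \<open>0\<close>, so
    \<open>Load 1 1\<close> fetches the first input cell.\<close>
  let ?c3 = "set_reg 1 (inp ! 0) ?c2"
  let ?c4 = "set_reg 0 (inp ! 0 + inp ! 1) ?c3"
  let ?c5 = "set_reg 0 (inp ! 0 + inp ! 1 + (inp ! 0 + inp ! 1)) ?c4"
  let ?c6 = "set_reg 1 2 ?c5"
  let ?c7 = "set_reg 0 (length inp) ?c6"
  have "exec_instr w S (Const 2 1) (init_config inp) = Some ?c1"
    "exec_instr w S (Load 2 2) ?c1 = Some ?c2"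
    "exec_instr w S (Load 1 1) ?c2 = Some ?c3"
    "exec_instr w S (Bin Add 0 1 2) ?c3 = Some ?c4"
    "exec_instr w S (Bin Add 0 0 0) ?c4 = Some ?c5"
    "exec_instr w S (Const 1 2) ?c5 = Some ?c6"
    "exec_instr w S (Bin Add 0 0 1) ?c6 = Some ?c7"
    using 1 2 S len by (simp_all add: init_config_def)
  then have "exec_straight ?is (init_config inp) = Some ?c7"
    by (simp only: exec_straight.simps straight.simps option.case if_True)
  also have "?c7 = ?c" by (auto simp: set_reg_def init_config_def fun_eq_iff)
  finally have exec: "exec_straight ?is (init_config inp) = Some ?c" .
  have "runs (length ?is) (init_config inp) ?c"
    using runs_straight[OF exec] code(1) by (simp add: init_config_def)
  moreover have "length ?is = 7" by simp
  ultimately have run: "runs 7 (init_config inp) ?c" by (simp only:)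
  let ?s = "initial_state (regs ?c)"
  have rep: "represents ?s ?c" by (auto simp: represents_def initial_state_def init_config_def)
  obtain s where s: "exec c ?s s" "Q s" using wp unfolding wp_def by blast
  have "pc ?c = 7" by simp
  from compile_correct[OF s(1) wf code(2) rep this] obtain t c'
    where t: "t \<le> com_length c * (ticks s - ticks ?s)" "runs t ?c c'" "represents s c'"
      "pc c' = 7 + com_length c" by blast
  have "length (ram_program c) \<le> pc c'" using t(4) by (simp add: ram_program_def)
  moreover have "runs (7 + t) (init_config inp) c'" using run t(2) runs_trans by blast
  moreover have "length inp \<le> S" using space by simp
  moreover have "outs c' = written s" using t(3) by (simp add: represents_def)
  ultimately have "ram_computes w S (ram_program c) inp (7 + t) (written s)"
    unfolding ram_computes_def runs_def by blast
  moreover have "7 + t \<le> 7 + com_length c * ticks s" using t(1) by (simp add: initial_state_def)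
  ultimately show ?thesis using s(2) by blast
qed

section \<open>Pattern chains\<close>

abbreviation occurs :: "'a tree list \<Rightarrow> 'a tree \<Rightarrow> nat \<Rightarrow> bool" where
  "occurs S f x \<equiv> tree_end S f x \<le> stop S x"

lemma matches_iff:
  "matches S f x \<longleftrightarrow> label (S ! x) = label f \<and> forest_end S (children f) (Suc x) \<le> stop S x"
  by (cases f) simp

lemma matches_occurs:
  assumes "preorder_list S" "x < length S" "matches S f x"
  shows "occurs S f x"
proof -
  have "stop S x \<le> length S" using assms by (simp add: preorder_list_def)
  then show ?thesis using assms next_stop_le_iff by blast
qed

lemma tree_end_Suc_le_iff:
  assumes "preorder_list S" "x < length S"
  shows "tree_end S f (Suc x) \<le> stop S x \<longleftrightarrow> (\<exists>y. x < y \<and> y < stop S x \<and> occurs S f y)"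
proof
  have le: "stop S x \<le> length S" using assms by (simp add: preorder_list_def)
  {
    assume "tree_end S f (Suc x) \<le> stop S x"
    then obtain y where y: "Suc x \<le> y" "y < length S" "matches S f y" "stop S y \<le> stop S x"
      using next_stop_le_iff[OF le, of "matches S f" "Suc x"] by blast
    moreover have "y < stop S y" by simp
    ultimately have "x < y \<and> y < stop S x" by linarith
    then show "\<exists>y. x < y \<and> y < stop S x \<and> occurs S f y"
      using matches_occurs[OF assms(1) y(2,3)] by blast
  next
    assume "\<exists>y. x < y \<and> y < stop S x \<and> occurs S f y"
    then obtain y where y: "x < y" "y < stop S x" "occurs S f y" by blast
    have "tree_end S f (Suc x) \<le> tree_end S f y" using y by (intro next_stop_mono) simp
    also have "\<dots> \<le> stop S y" using y by simp
    also have "\<dots> \<le> stop S x" using stop_nested'[OF assms] y by blast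
    finally show "tree_end S f (Suc x) \<le> stop S x" .
  }
qed

lemma occurs_iff:
  assumes "preorder_list S" "x < length S"
  shows "occurs S f x \<longleftrightarrow> matches S f x \<or> (\<exists>y. x < y \<and> y < stop S x \<and> occurs S f y)"
  unfolding tree_end_Suc_le_iff[OF assms, symmetric] next_stop_step[OF assms(2)]
  by (auto simp: min_le_iff_disj)

lemma occurs_up:
  assumes "preorder_list S" "x < length S" "x \<le> y" "y < stop S x" "occurs S f y"
  shows "occurs S f x"
  using assms occurs_iff[OF assms(1,2)] by (metis le_neq_implies_less)

lemma tree_end_step:
  assumes "preorder_list S" "x < length S"
  shows "tree_end S f x =
    (if occurs S f x then min (stop S x) (tree_end S f (Suc x)) else tree_end S f (Suc x))"
  using next_stop_step[OF assms(2), of "matches S f"] matches_occurs[OF assms]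
  by (auto simp: min_def)

text \<open>
  For a chain \<open>Q v, \<dots>, Q u\<close> of nested pattern trees, the trees that occur at \<open>x\<close> are those from
  some level \<open>e\<close> downwards.
\<close>

definition is_level ::
    "'a tree list \<Rightarrow> (nat \<Rightarrow> 'a tree) \<Rightarrow> nat \<Rightarrow> nat \<Rightarrow> nat set \<Rightarrow> nat \<Rightarrow> bool" where
  "is_level S Q v u X e \<longleftrightarrow>
    v \<le> e \<and> e \<le> Suc u \<and> (\<forall>j. v \<le> j \<and> j \<le> u \<longrightarrow> (\<exists>y\<in>X. occurs S (Q j) y) \<longleftrightarrow> e \<le> j)"

lemma is_level_empty: "v \<le> u \<Longrightarrow> is_level S Q v u {} (Suc u)"
  by (auto simp: is_level_def)

text \<open>By \<open>occurs_up\<close> an occurrence anywhere in the subtree of \<open>q\<close>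
  also shows at \<open>q\<close> itself, so one value stands for the whole interval of that subtree.
  A node then needs only one read per child.\<close>

lemma is_level_jump:
  assumes "preorder_list S" "q < length S" "x < q"
    and "is_level S Q v u {x<..<q} m" "is_level S Q v u {q} e"
  shows "is_level S Q v u {x<..<stop S q} (min m e)"
proof -
  have "(\<exists>y\<in>{x<..<stop S q}. occurs S f y) \<longleftrightarrow> (\<exists>y\<in>{x<..<q}. occurs S f y) \<or> occurs S f q" for f
  proof
    assume "\<exists>y\<in>{x<..<stop S q}. occurs S f y"
    then obtain y where y: "x < y" "y < stop S q" "occurs S f y" by auto
    show "(\<exists>y\<in>{x<..<q}. occurs S f y) \<or> occurs S f q"
    proof (cases "y < q")
      case False
      then show ?thesis using occurs_up[OF assms(1,2) _ y(2,3)] by simp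
    qed (use y in auto)
  next
    assume *: "(\<exists>y\<in>{x<..<q}. occurs S f y) \<or> occurs S f q"
    have "q < stop S q" by simp
    with * assms(3) show "\<exists>y\<in>{x<..<stop S q}. occurs S f y"
      by (meson greaterThanLessThan_iff less_trans)
  qed
  then show ?thesis using assms(4,5) unfolding is_level_def by (auto simp: min_le_iff_disj)
qed

text \<open>Matching the root of \<open>Q j\<close> at \<open>x\<close> requires
  \<open>Q (Suc j)\<close> strictly below \<open>x\<close>, that is \<open>m \<le> Suc j\<close>. So
  \<open>x\<close> can improve the level by at most one, and a single label comparison decides it.
  If \<open>m = Suc u\<close>, no tree of the chain occurs below, and the children of the bottom
  tree are tested directly.\<close>

lemma is_level_step:
  assumes S: "preorder_list S" "x < length S"
    and chain: "\<And>j. v \<le> j \<Longrightarrow> j < u \<Longrightarrow> children (Q j) = [Q (Suc j)]"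
    and m: "is_level S Q v u {x<..<stop S x} m"
  shows "is_level S Q v u {x}
    (if v < m \<and> label (S ! x) = label (Q (m - 1)) \<and>
        (m \<le> u \<or> forest_end S (children (Q u)) (Suc x) \<le> stop S x) then m - 1 else m)"
    (is "is_level _ _ _ _ _ ?e")
proof -
  have inner: "(\<exists>y. x < y \<and> y < stop S x \<and> occurs S (Q j) y) \<longleftrightarrow> m \<le> j" if "v \<le> j" "j \<le> u" for j
  proof -
    have "(\<exists>y. x < y \<and> y < stop S x \<and> occurs S (Q j) y) \<longleftrightarrow> (\<exists>y\<in>{x<..<stop S x}. occurs S (Q j) y)"
      by auto
    then show ?thesis using m that unfolding is_level_def by blast
  qed
  have "occurs S (Q j) x \<longleftrightarrow> ?e \<le> j" if j: "v \<le> j" "j \<le> u" for j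
  proof -
    have "forest_end S (children (Q j)) (Suc x) \<le> stop S x \<longleftrightarrow> m \<le> Suc j" if "j < u"
      using chain[OF j(1) that] tree_end_Suc_le_iff[OF S, of "Q (Suc j)"] inner[of "Suc j"] j that
      by simp
    then have "occurs S (Q j) x \<longleftrightarrow> m \<le> j \<or> (label (S ! x) = label (Q j) \<and>
        (if j < u then m \<le> Suc j else forest_end S (children (Q u)) (Suc x) \<le> stop S x))"
      using occurs_iff[OF S, of "Q j"] inner[OF j] j by (auto simp: matches_iff)
    moreover have "v \<le> m" "m \<le> Suc u" using m by (auto simp: is_level_def)
    ultimately show ?thesis
    proof (cases "m \<le> j")
      case False
      then consider "m = Suc j" | "Suc j < m" by linarith
      then show ?thesis
      proof cases
        case 1
        then show ?thesis using \<open>occurs S (Q j) x \<longleftrightarrow> _\<close> j by auto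
      next
        case 2
        then show ?thesis using \<open>occurs S (Q j) x \<longleftrightarrow> _\<close> j \<open>m \<le> Suc u\<close> by auto
      qed
    qed auto
  qed
  moreover have "v \<le> ?e" "?e \<le> Suc u" using m by (auto simp: is_level_def)
  ultimately show ?thesis by (auto simp: is_level_def)
qed

text \<open>Once the ends are known, the program recognises leaves and single children from them
  alone: a first child is the only one if its subtree ends together with that of
  \<open>u\<close>.\<close>

lemma only_child_iff:
  assumes "preorder_list S" "u < length S"
  shows "Suc u < stop S u \<and> stop S (Suc u) = stop S u \<longleftrightarrow> children (S ! u) = [S ! Suc u]"
    and "Suc u < stop S u \<longleftrightarrow> children (S ! u) \<noteq> []"
proof -
  have path: "fpath S (Suc u) (children (S ! u)) (stop S u)"
    using assms by (simp add: preorder_list_def)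
  show "Suc u < stop S u \<longleftrightarrow> children (S ! u) \<noteq> []"
  proof (cases "children (S ! u)")
    case (Cons g gs)
    then have "S ! Suc u = g" "fpath S (stop S (Suc u)) gs (stop S u)" using path by auto
    from fpath_le[OF this(2)] have "Suc u < stop S u"
      using num_nodes_pos[of "S ! Suc u"] by linarith
    then show ?thesis using Cons by simp
  qed (use path in simp)
  show "Suc u < stop S u \<and> stop S (Suc u) = stop S u \<longleftrightarrow> children (S ! u) = [S ! Suc u]"
  proof (cases "children (S ! u)")
    case (Cons g gs)
    then have g: "S ! Suc u = g" "fpath S (stop S (Suc u)) gs (stop S u)" using path by auto
    show ?thesis
    proof (cases gs)
      case Nil
      then show ?thesis using Cons g num_nodes_pos[of "S ! Suc u"] by (auto simp del: num_nodes_pos)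
    next
      case (Cons g' gs')
      then have "fpath S (stop S (Suc u) + num_nodes g') gs' (stop S u)" using g by auto
      from fpath_le[OF this] show ?thesis using num_nodes_pos[of g'] \<open>children (S ! u) = g # gs\<close> Cons
        by (auto simp del: num_nodes_pos)
    qed
  qed (use path in simp)
qed


section \<open>Monotone functions as bit sequences\<close>

text \<open>
  A monotone function on \<open>{0..n}\<close> with values up to \<open>Suc n\<close> is determined by the set of the
  numbers \<open>p + f p\<close>, a subset of \<open>{..<2 * n + 2}\<close>. Each memory word serves as a stack of bits, so
  that \<open>2 * n + 2\<close> words hold logarithmically many such functions.
\<close>

definition marked :: "nat \<Rightarrow> (nat \<Rightarrow> nat) \<Rightarrow> nat \<Rightarrow> bool" where
  "marked n f t \<longleftrightarrow> (\<exists>p \<le> n. p + f p = t)"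

definition push_marks :: "nat \<Rightarrow> (nat \<Rightarrow> nat) \<Rightarrow> (nat \<Rightarrow> nat) \<Rightarrow> nat \<Rightarrow> nat" where
  "push_marks n f B t = 2 * B t + of_bool (marked n f t)"

text \<open>The state of a scan over the bits: \<open>p\<close> is the number of marks before bit
  \<open>t\<close>, hence the argument whose mark comes next. The value \<open>p = Suc n\<close>
  means that all marks have been passed.\<close>

definition next_mark :: "nat \<Rightarrow> (nat \<Rightarrow> nat) \<Rightarrow> nat \<Rightarrow> nat \<Rightarrow> bool" where
  "next_mark n f t p \<longleftrightarrow> p \<le> Suc n \<and> (\<forall>i < p. i + f i < t) \<and> (p \<le> n \<longrightarrow> t \<le> p + f p)"

lemma next_mark_0: "next_mark n f 0 0"
  by (simp add: next_mark_def)

text \<open>For monotone \<open>f\<close> the sums \<open>p + f p\<close> increase strictly, so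
  marks appear in the order of their arguments and a mark at \<open>t\<close> reveals
  \<open>f p\<close> as \<open>t - p\<close>.\<close>

lemma next_mark_marked:
  assumes "mono_on {..n} f" "next_mark n f t p"
  shows "marked n f t \<longleftrightarrow> p \<le> n \<and> p + f p = t"
proof
  assume "marked n f t"
  then obtain p' where p': "p' \<le> n" "p' + f p' = t" by (auto simp: marked_def)
  then have "\<not> p' < p" using assms(2) by (auto simp: next_mark_def)
  moreover have "\<not> p < p'"
  proof
    assume "p < p'"
    then have "f p \<le> f p'" using assms(1) p' by (auto intro: mono_onD)
    then show False using \<open>p < p'\<close> p' assms(2) by (auto simp: next_mark_def)
  qed
  ultimately show "p \<le> n \<and> p + f p = t" using p' by auto
qed (auto simp: marked_def)

lemma next_mark_Suc:
  assumes "mono_on {..n} f" "next_mark n f t p"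
  shows "next_mark n f (Suc t) (if marked n f t then Suc p else p)"
proof (cases "marked n f t")
  case True
  then have p: "p \<le> n" "p + f p = t" using next_mark_marked[OF assms] by auto
  have "Suc p \<le> n \<Longrightarrow> f p \<le> f (Suc p)" using assms(1) by (auto intro: mono_onD)
  then show ?thesis using assms(2) p True by (auto simp: next_mark_def less_Suc_eq)
next
  case False
  then have "p \<le> n \<Longrightarrow> p + f p \<noteq> t" using next_mark_marked[OF assms] by auto
  then show ?thesis using assms(2) False by (fastforce simp: next_mark_def less_Suc_eq)
qed


section \<open>Input encoding\<close>

lemma nth_concat_pairs:
  assumes "i < length xs"
  shows "concat (map (\<lambda>x. [f x, g x]) xs) ! (2 * i) = f (xs ! i)"
    and "concat (map (\<lambda>x. [f x, g x]) xs) ! Suc (2 * i) = g (xs ! i)"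
  using assms by (induction xs arbitrary: i) (auto simp: nth_Cons split: nat.split)

lemma encode_tree_subtrees:
  "encode_tree t = concat (map (\<lambda>t. [label t, length (children t)]) (subtrees t))"
proof (induction t)
  case (Node a ts)
  then have "concat (map encode_tree ts) =
      concat (map (\<lambda>t. [label t, length (children t)]) (concat (map subtrees ts)))"
    by (induction ts) auto
  then show ?case by simp
qed

lemma length_encode_tree [simp]: "length (encode_tree t) = 2 * num_nodes t"
  unfolding encode_tree_subtrees by (simp add: length_concat comp_def sum_list_triv)

lemma nth_encode_tree:
  assumes "i < num_nodes t"
  shows "encode_tree t ! (2 * i) = label (subtrees t ! i)"
    and "encode_tree t ! Suc (2 * i) = length (children (subtrees t ! i))"
  using nth_concat_pairs[of i "subtrees t" label "\<lambda>t. length (children t)"] assms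
  by (simp_all add: encode_tree_subtrees)

lemma encode_input_nth:
  "encode_input P T ! 0 = num_nodes P"
  "encode_input P T ! 1 = num_nodes T"
  "length (encode_input P T) = 2 + 2 * (num_nodes P + num_nodes T)"
  "i < num_nodes P \<Longrightarrow> encode_input P T ! (2 + 2 * i) = label (subtrees P ! i)"
  "i < num_nodes P \<Longrightarrow> encode_input P T ! (3 + 2 * i) = length (children (subtrees P ! i))"
  "j < num_nodes T \<Longrightarrow> encode_input P T ! (2 + 2 * num_nodes P + 2 * j) = label (subtrees T ! j)"
  "j < num_nodes T \<Longrightarrow>
     encode_input P T ! (3 + 2 * num_nodes P + 2 * j) = length (children (subtrees T ! j))"
  by (simp_all add: encode_input_def nth_append nth_Cons' numeral_eq_Suc
      nth_encode_tree[unfolded mult_2])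

text \<open>
  The number of iterations of \<open>stop\<close> that lead from \<open>p\<close> to the end. As a potential it shows that
  iterating over the children of every node takes linear time in total.
\<close>

function jumps :: "'a tree list \<Rightarrow> nat \<Rightarrow> nat" where
  "jumps S p = (if p < length S then Suc (jumps S (stop S p)) else 0)"
  by auto
termination
  by (relation "measure (\<lambda>(S, p). length S - p)") (auto simp: diff_less_mono2)

declare jumps.simps [simp del]

lemma jumps_stop: "p < length S \<Longrightarrow> jumps S p = Suc (jumps S (stop S p))"
  by (simp add: jumps.simps)

section \<open>The tree inclusion program\<close>

text \<open>
  In the variables, \<open>v\<close> and \<open>u\<close> are the top and the bottom of the current chain of the pattern, \<open>h\<close> is the
  child of \<open>u\<close> with the largest subtree and \<open>c\<close> the current child. The array \<open>R\<close> receives the function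
  \<open>N\<close> of the pattern tree just finished, \<open>A\<close> the composition over the children of \<open>u\<close> before \<open>c\<close>, \<open>E\<close> the
  levels of a chain, and \<open>S\<close> is the array of bit stacks. The last three arrays are indexed by chain tops.
\<close>

abbreviation (input) "vnP \<equiv> 1 :: nat"
abbreviation (input) "vnT \<equiv> 2 :: nat"
abbreviation (input) "vv \<equiv> 3 :: nat"
abbreviation (input) "vu \<equiv> 4 :: nat"
abbreviation (input) "vc \<equiv> 5 :: nat"
abbreviation (input) "vh \<equiv> 6 :: nat"
abbreviation (input) "vmode \<equiv> 7 :: nat"
abbreviation (input) "vx \<equiv> 8 :: nat"
abbreviation (input) "vq \<equiv> 9 :: nat"
abbreviation (input) "vj \<equiv> 10 :: nat"
abbreviation (input) "vp \<equiv> 11 :: nat"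
abbreviation (input) "vt \<equiv> 12 :: nat"
abbreviation (input) "vm \<equiv> 13 :: nat"

abbreviation (input) "aendP \<equiv> 0 :: nat"
abbreviation (input) "aendT \<equiv> 1 :: nat"
abbreviation (input) "aA \<equiv> 2 :: nat"
abbreviation (input) "aR \<equiv> 3 :: nat"
abbreviation (input) "aE \<equiv> 4 :: nat"
abbreviation (input) "aS \<equiv> 5 :: nat"
abbreviation (input) "aparent \<equiv> 6 :: nat"
abbreviation (input) "abottom \<equiv> 7 :: nat"
abbreviation (input) "aheavy \<equiv> 8 :: nat"

abbreviation plus_exp (infixl "\<oplus>" 65) where "e1 \<oplus> e2 \<equiv> Op Add e1 e2"
abbreviation minus_exp (infixl "\<ominus>" 65) where "e1 \<ominus> e2 \<equiv> Op Sub e1 e2"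
abbreviation times_exp (infixl "\<otimes>" 70) where "e1 \<otimes> e2 \<equiv> Op Mul e1 e2"
abbreviation assign_var (infix "\<leftarrow>" 62) where "x \<leftarrow> e \<equiv> Assign x e"
abbreviation seq_com (infixr ";;" 60) where "c1 ;; c2 \<equiv> Seq c1 c2"

definition "incr x = (x \<leftarrow> V x \<oplus> N 1)"

text \<open>Nodes are treated from last to first, so the ends of all children of \<open>x\<close>
  are known: starting at \<open>x + 1\<close>, as many hops as \<open>x\<close> has children lead to
  its end. The offset \<open>b\<close> is the input cell with the child count of node
  \<open>0\<close>.\<close>

definition "ends_com k len b =
  vx \<leftarrow> V len;;
  While (Less (N 0) (V vx)) (
    vx \<leftarrow> V vx \<ominus> N 1;;
    vq \<leftarrow> V vx \<oplus> N 1;;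
    vj \<leftarrow> In (b \<oplus> N 2 \<otimes> V vx);;
    While (Less (N 0) (V vj)) (
      vq \<leftarrow> Rd k (V vq);;
      vj \<leftarrow> V vj \<ominus> N 1);;
    Write k (V vx) (V vq))"

definition "chain_com =
  vu \<leftarrow> V vv;;
  While (And (Less (V vu \<oplus> N 1) (Rd aendP (V vu))) (Eq (Rd aendP (V vu \<oplus> N 1)) (Rd aendP (V vu))))
    (incr vu)"

text \<open>Subtree sizes are differences of end and start; the comparison is rearranged into one of
  sums. An assignment of a variable to itself stands for the missing skip command.\<close>

definition "heavy_com =
  vh \<leftarrow> V vu \<oplus> N 1;;
  vc \<leftarrow> V vu \<oplus> N 1;;
  While (Less (V vc) (Rd aendP (V vu))) (
    If (Less (Rd aendP (V vh) \<oplus> V vc) (Rd aendP (V vc) \<oplus> V vh))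
      (vh \<leftarrow> V vc)
      (vh \<leftarrow> V vh);;
    vc \<leftarrow> Rd aendP (V vc))"

definition "ident_com =
  vp \<leftarrow> N 0;;
  While (Less (V vp) (V vnT \<oplus> N 2)) (
    Write aA (V vp) (V vp);;
    incr vp)"

definition "compose_com =
  vp \<leftarrow> N 0;;
  While (Less (V vp) (V vnT \<oplus> N 2)) (
    Write aA (V vp) (Rd aR (Rd aA (V vp)));;
    incr vp)"

definition "push_com k =
  vp \<leftarrow> N 0;;
  vt \<leftarrow> N 0;;
  While (Less (V vt) (N 2 \<otimes> V vnT \<oplus> N 2)) (
    If (Eq (Rd k (V vp) \<oplus> V vp) (V vt))
      (Write aS (V vt) (N 2 \<otimes> Rd aS (V vt) \<oplus> N 1);; incr vp)
      (Write aS (V vt) (N 2 \<otimes> Rd aS (V vt)));;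
    incr vt)"

text \<open>Argument \<open>nT + 1\<close> has no mark of its own. Its value is always
  \<open>nT + 1\<close> and is put back by the last write.\<close>

definition "pop_com k =
  vp \<leftarrow> N 0;;
  vt \<leftarrow> N 0;;
  While (Less (V vt) (N 2 \<otimes> V vnT \<oplus> N 2)) (
    If (Eq (Op Mod (Rd aS (V vt)) (N 2)) (N 1))
      (Write k (V vp) (V vt \<ominus> V vp);; incr vp)
      (vp \<leftarrow> V vp);;
    Write aS (V vt) (Op Div (Rd aS (V vt)) (N 2));;
    incr vt);;
  Write k (V vnT \<oplus> N 1) (V vnT \<oplus> N 1)"

text \<open>Initially \<open>vm\<close> is \<open>u + 1\<close>, meaning that no tree of the chain
  has been found. The label of pattern node \<open>i\<close> is input cell \<open>2 + 2 * i\<close>,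
  so cell \<open>2 * m\<close> belongs to node \<open>m - 1\<close>, the next candidate up the
  chain.\<close>

definition "levels_com =
  vx \<leftarrow> V vnT;;
  While (Less (N 0) (V vx)) (
    vx \<leftarrow> V vx \<ominus> N 1;;
    vm \<leftarrow> V vu \<oplus> N 1;;
    vq \<leftarrow> V vx \<oplus> N 1;;
    While (Less (V vq) (Rd aendT (V vx))) (
      If (Less (Rd aE (V vq)) (V vm)) (vm \<leftarrow> Rd aE (V vq)) (vm \<leftarrow> V vm);;
      vq \<leftarrow> Rd aendT (V vq));;
    If (And (Less (V vv) (V vm)) (Eq (In (N 2 \<oplus> N 2 \<otimes> V vnP \<oplus> N 2 \<otimes> V vx)) (In (N 2 \<otimes> V vm))))
      (If (Less (V vu) (V vm))
        (If (Less (Rd aendT (V vx)) (Rd aA (V vx \<oplus> N 1)))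
          (vm \<leftarrow> V vm)
          (vm \<leftarrow> V vm \<ominus> N 1))
        (vm \<leftarrow> V vm \<ominus> N 1))
      (vm \<leftarrow> V vm);;
    Write aE (V vx) (V vm))"

definition "result_com =
  Write aR (V vnT \<oplus> N 1) (V vnT \<oplus> N 1);;
  Write aR (V vnT) (V vnT \<oplus> N 1);;
  vx \<leftarrow> V vnT;;
  While (Less (N 0) (V vx)) (
    vx \<leftarrow> V vx \<ominus> N 1;;
    If (And (Eq (Rd aE (V vx)) (V vv)) (Less (Rd aendT (V vx)) (Rd aR (V vx \<oplus> N 1))))
      (Write aR (V vx) (Rd aendT (V vx)))
      (Write aR (V vx) (Rd aR (V vx \<oplus> N 1))))"

definition changes :: "nat set \<Rightarrow> nat set \<Rightarrow> state \<Rightarrow> state \<Rightarrow> bool" where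
  "changes X K s s' \<longleftrightarrow> (\<forall>y. y \<notin> X \<longrightarrow> vars s' y = vars s y) \<and> (\<forall>k. k \<notin> K \<longrightarrow> arr s' k = arr s k) \<and>
    written s' = written s"

section \<open>Correctness of the passes\<close>

text \<open>The quadratic bound serves the bit stacks, whose words are bounded through squared
  subtree sizes; the factor \<open>1000\<close> leaves room for all addresses and intermediate
  sums.\<close>

locale inclusion_problem =
  fixes P T :: "nat tree" and w :: nat
  assumes size_le: "num_nodes P \<le> num_nodes T"
    and word: "1000 * (num_nodes T + 1) * (num_nodes T + 1) < 2 ^ w"
begin

abbreviation "nP \<equiv> num_nodes P"
abbreviation "nT \<equiv> num_nodes T"
abbreviation "SP \<equiv> subtrees P"
abbreviation "ST \<equiv> subtrees T"
abbreviation "M \<equiv> 2 * nT + 4"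

sublocale while_language w "encode_input P T" M .

lemma small: "x \<le> 100 * (nT + 1) \<Longrightarrow> x < 2 ^ w"
proof -
  assume "x \<le> 100 * (nT + 1)"
  also have "\<dots> \<le> 1000 * (nT + 1) * (nT + 1)" by simp
  finally show ?thesis using word by (rule le_less_trans)
qed

lemma wp_ident:
  assumes "vars s vnT = nT"
    and Q: "\<And>s'. changes {vp} {aA} s s' \<Longrightarrow> (\<forall>p \<le> Suc nT. arr s' aA p = p) \<Longrightarrow>
      ticks s' \<le> ticks s + 20 * (nT + 1) \<Longrightarrow> Q s'"
  shows "wp ident_com Q s"
  unfolding ident_com_def incr_def wp_Seq wp_Assign
  apply (intro conjI)
   apply (simp add: small)
  apply (rule wp_While[where I = "\<lambda>s'. changes {vp} {aA} s s' \<and> vars s' vp \<le> nT + 2 \<and>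
      (\<forall>p < vars s' vp. arr s' aA p = p) \<and> ticks s' \<le> ticks s + 1 + 3 * vars s' vp"
        and measure = "\<lambda>s'. nT + 2 - vars s' vp"])
     apply (simp add: changes_def)
  using assms(1) apply (auto simp: changes_def small)[1]
   using assms(1) apply (auto simp: changes_def small less_Suc_eq)[1]
  apply (rule Q)
  using assms(1) apply (auto simp: changes_def small less_Suc_eq_le)
  done

lemma wp_compose:
  assumes "vars s vnT = nT" "\<forall>p \<le> Suc nT. arr s aA p \<le> Suc nT"
    and Q: "\<And>s'. changes {vp} {aA} s s' \<Longrightarrow> (\<forall>p \<le> Suc nT. arr s' aA p = arr s aR (arr s aA p)) \<Longrightarrow>
      ticks s' \<le> ticks s + 20 * (nT + 1) \<Longrightarrow> Q s'"
  shows "wp compose_com Q s"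
proof -
  have less_M: "arr s aA p < M" if "p \<le> Suc nT" for p
    using assms(2) that by (rule_tac le_less_trans[of _ "Suc nT"]) auto
  show ?thesis
  unfolding compose_com_def incr_def wp_Seq wp_Assign
  apply (intro conjI)
   apply (simp add: small)
  apply (rule wp_While[where I = "\<lambda>s'. changes {vp} {aA} s s' \<and> vars s' vp \<le> nT + 2 \<and>
      (\<forall>p < vars s' vp. arr s' aA p = arr s aR (arr s aA p)) \<and> 
      (\<forall>p \<ge> vars s' vp. arr s' aA p = arr s aA p) \<and> ticks s' \<le> ticks s + 1 + 3 * vars s' vp"
        and measure = "\<lambda>s'. nT + 2 - vars s' vp"])
     apply (simp add: changes_def)
  using assms(1) apply (auto simp: changes_def small)[1]
  using assms(1,2) apply (auto simp: changes_def small less_M less_Suc_eq)[1]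
  apply (rule Q)
  using assms(1) apply (auto simp: changes_def small less_Suc_eq_le)
  done
qed


definition env :: "state \<Rightarrow> bool" where
  "env s \<longleftrightarrow> vars s vnP = nP \<and> vars s vnT = nT \<and>
    (\<forall>i < nP. arr s aendP i = stop SP i) \<and> (\<forall>i < nT. arr s aendT i = stop ST i)"

lemma preP: "preorder_list SP" and preT: "preorder_list ST"
  by (rule preorder_list_subtrees)+

lemma stopP_le: "i < nP \<Longrightarrow> stop SP i \<le> nP" and stopT_le: "i < nT \<Longrightarrow> stop ST i \<le> nT"
  using preP preT by (auto simp: preorder_list_def)

text \<open>A push doubles a stack word and may add one. A strict bound \<open>D\<close> on the
  words is carried along instead of a stack depth, and it doubles as well.\<close>

lemma wp_push:
  assumes "vars s vnT = nT" "k \<noteq> aS"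
    and f: "mono_on {..nT} (arr s k)" "\<forall>p \<le> nT. arr s k p \<le> Suc nT" "arr s k (Suc nT) = Suc nT"
    and D: "\<forall>t < 2 * nT + 2. arr s aS t < D" "2 * D \<le> 2 ^ w"
    and Q: "\<And>s'. changes {vp, vt} {aS} s s' \<Longrightarrow>
      (\<forall>t < 2 * nT + 2. arr s' aS t = push_marks nT (arr s k) (arr s aS) t) \<Longrightarrow>
      ticks s' \<le> ticks s + 20 * (nT + 1) \<Longrightarrow> Q s'"
  shows "wp (push_com k) Q s"
proof -
  have le: "arr s k p \<le> Suc nT" if "next_mark nT (arr s k) t p" for t p
    using that f by (cases "p = Suc nT") (auto simp: next_mark_def)
  \<comment> \<open>After the last mark, \<open>p = Suc nT\<close> with entry \<open>Suc nT\<close>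
    acts as a sentinel: the sum \<open>2 * nT + 2\<close> is out of the range of
    \<open>t\<close>.\<close>
  have iff: "arr s k p + p = t \<longleftrightarrow> marked nT (arr s k) t" if "next_mark nT (arr s k) t p" "t < 2 * nT + 2" for p t
    using next_mark_marked[OF f(1) that(1)] that f(3)
    by (cases "p = Suc nT") (auto simp: next_mark_def)
  have D': "2 * arr s aS t + 1 < 2 ^ w" if "t < 2 * nT + 2" for t
  proof -
    have "arr s aS t < D" using D(1) that by blast
    then have "2 * arr s aS t + 1 < 2 * D" by simp
    then show ?thesis using D(2) by simp
  qed
  let ?I = "\<lambda>s'. changes {vp, vt} {aS} s s' \<and> vars s' vt \<le> 2 * nT + 2 \<and>
      next_mark nT (arr s k) (vars s' vt) (vars s' vp) \<and>
      (\<forall>t < vars s' vt. arr s' aS t = push_marks nT (arr s k) (arr s aS) t) \<and>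
      (\<forall>t \<ge> vars s' vt. arr s' aS t = arr s aS t) \<and> ticks s' \<le> ticks s + 2 + 5 * vars s' vt"
  show ?thesis
    unfolding push_com_def incr_def wp_Seq wp_Assign
    apply (intro conjI)
      apply (simp add: small)
     apply (simp add: small)
    apply (rule wp_While[where I = ?I and measure = "\<lambda>s'. 2 * nT + 2 - vars s' vt"])
    subgoal by (simp add: changes_def next_mark_0)
    subgoal using assms(1) by (auto simp: changes_def small)
    subgoal for s'
    proof -
      assume I: "?I s'" and "bval s' (Less (V vt) (N 2 \<otimes> V vnT \<oplus> N 2))"
      then have t: "vars s' vt < 2 * nT + 2" using assms(1) by (auto simp: changes_def)
      have mark: "next_mark nT (arr s k) (vars s' vt) (vars s' vp)" using I by blast
      have p: "vars s' vp \<le> Suc nT" using mark by (simp add: next_mark_def)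
      have k: "arr s' k = arr s k" using I assms(2) by (auto simp: changes_def)
      show ?thesis
        using I t p k le[OF mark] iff[OF mark t] D'[OF t] next_mark_Suc[OF f(1) mark]
        by (auto simp: changes_def small push_marks_def less_Suc_eq)
    qed
    subgoal for s'
      using assms(1) by (intro Q) (auto simp: changes_def)
    done
qed

lemma wp_pop:
  assumes "vars s vnT = nT" "k \<noteq> aS"
    and f: "mono_on {..nT} f" "\<forall>p \<le> nT. f p \<le> Suc nT"
    and B: "\<forall>t < 2 * nT + 2. arr s aS t = push_marks nT f B t"
    and Q: "\<And>s'. changes {vp, vt} {k, aS} s s' \<Longrightarrow> (\<forall>t < 2 * nT + 2. arr s' aS t = B t) \<Longrightarrow>
      (\<forall>p \<le> nT. arr s' k p = f p) \<Longrightarrow> arr s' k (Suc nT) = Suc nT \<Longrightarrow>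
      ticks s' \<le> ticks s + 20 * (nT + 1) \<Longrightarrow> Q s'"
  shows "wp (pop_com k) Q s"
proof -
  let ?I = "\<lambda>s'. changes {vp, vt} {k, aS} s s' \<and> vars s' vt \<le> 2 * nT + 2 \<and>
      next_mark nT f (vars s' vt) (vars s' vp) \<and> (\<forall>p < vars s' vp. arr s' k p = f p) \<and>
      (\<forall>t < vars s' vt. arr s' aS t = B t) \<and>
      (\<forall>t \<ge> vars s' vt. arr s' aS t = arr s aS t) \<and> ticks s' \<le> ticks s + 2 + 6 * vars s' vt"
  have stack: "arr s aS t mod 2 = Suc 0 \<longleftrightarrow> marked nT f t" "arr s aS t div 2 = B t" if "t < 2 * nT + 2" for t
    using B that by (auto simp: push_marks_def)
  show ?thesis
    unfolding pop_com_def incr_def wp_Seq wp_Assign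
    apply (intro conjI)
      apply (simp add: small)
     apply (simp add: small)
    apply (rule wp_While[where I = ?I and measure = "\<lambda>s'. 2 * nT + 2 - vars s' vt"])
    subgoal by (simp add: changes_def next_mark_0)
    subgoal using assms(1) by (auto simp: changes_def small)
    subgoal for s'
    proof -
      assume I: "?I s'" and "bval s' (Less (V vt) (N 2 \<otimes> V vnT \<oplus> N 2))"
      then have t: "vars s' vt < 2 * nT + 2" using assms(1) by (auto simp: changes_def)
      have mark: "next_mark nT f (vars s' vt) (vars s' vp)" using I by blast
      have p: "vars s' vp \<le> Suc nT" using mark by (simp add: next_mark_def)
      have S: "arr s' aS (vars s' vt) = arr s aS (vars s' vt)" using I by blast
      show ?thesis
      proof (cases "marked nT f (vars s' vt)")
        case True
        then have "vars s' vp \<le> nT" "vars s' vp + f (vars s' vp) = vars s' vt"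
          using next_mark_marked[OF f(1) mark] by auto
        then show ?thesis
          using I t p S stack[OF t] True next_mark_Suc[OF f(1) mark] assms(2)
          by (auto simp: changes_def small less_Suc_eq)
      next
        case False
        then show ?thesis
          using I t p S stack[OF t] next_mark_Suc[OF f(1) mark] assms(2)
          by (auto simp: changes_def small less_Suc_eq)
      qed
    qed
    subgoal for s'
    proof -
      assume I: "?I s'" and "\<not> bval s' (Less (V vt) (N 2 \<otimes> V vnT \<oplus> N 2))"
      then have t: "vars s' vt = 2 * nT + 2" using assms(1) by (auto simp: changes_def)
      \<comment> \<open>Marks are at most \<open>nT + (nT + 1)\<close>, so a completed scan has
        passed all of them and every entry has been restored.\<close>
      have "vars s' vp \<le> nT \<Longrightarrow> 2 * nT + 2 \<le> vars s' vp + f (vars s' vp)"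
        using I t by (auto simp: next_mark_def)
      then have "\<not> vars s' vp \<le> nT" using f(2) by force
      then show ?thesis using I t assms(1,2)
        by (auto simp: changes_def small intro!: Q)
    qed
    done
qed


lemma length_le_forest_size: "length gs \<le> forest_size gs"
proof (induction gs)
  case (Cons g gs)
  then show ?case using num_nodes_pos[of g] by (simp del: num_nodes_pos)
qed simp

lemma wp_ends:
  assumes t: "t = P \<or> t = T" and s: "vars s len = num_nodes t" "len \<notin> {vx, vq, vj}"
    and b: "\<And>s'. (\<forall>y. y \<notin> {vx, vq, vj} \<longrightarrow> vars s' y = vars s y) \<Longrightarrow> aok s' b \<and> aval s' b = bv"
      "\<And>i. i < num_nodes t \<Longrightarrow> bv + 2 * i < length (encode_input P T) \<and>
        encode_input P T ! (bv + 2 * i) = length (children (subtrees t ! i))"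
    and Q: "\<And>s'. changes {vx, vq, vj} {k} s s' \<Longrightarrow> (\<forall>i < num_nodes t. arr s' k i = stop (subtrees t) i) \<Longrightarrow>
      ticks s' \<le> ticks s + 20 * (nT + 1) \<Longrightarrow> Q s'"
  shows "wp (ends_com k len b) Q s"
proof -
  let ?S = "subtrees t" and ?n = "num_nodes t"
  have pre: "preorder_list ?S" by (rule preorder_list_subtrees)
  have n: "?n \<le> nT" using t size_le by auto
  have inp_len: "length (encode_input P T) < 2 ^ w"
    using size_le by (intro small) (simp add: encode_input_nth)
  \<comment> \<open>Amortisation: a hop costs three ticks and lowers \<open>jumps\<close> by one,
    while moving from the end of \<open>x\<close> back to \<open>x\<close> raises it by only one.
    The ten ticks per node cover this and the fixed work.\<close>
  let ?I = "\<lambda>s'. changes {vx, vq, vj} {k} s s' \<and> vars s' vx \<le> ?n \<and>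
      (\<forall>i. vars s' vx \<le> i \<and> i < ?n \<longrightarrow> arr s' k i = stop ?S i) \<and>
      ticks s' + 3 * jumps ?S (vars s' vx) \<le> ticks s + 1 + 10 * (?n - vars s' vx)"
  show ?thesis
    unfolding ends_com_def wp_Seq wp_Assign
    apply (intro conjI)
     apply simp
    apply (rule wp_While[where I = ?I and measure = "\<lambda>s'. vars s' vx"])
    subgoal using s by (simp add: changes_def jumps.simps)
    subgoal by simp
    subgoal for s1
    proof -
      assume I1: "?I s1" and "bval s1 (Less (N 0) (V vx))"
      then have x: "0 < vars s1 vx" by simp
      define x where "x = vars s1 vx - 1"
      have xn: "x < ?n" and vx: "vars s1 vx = Suc x" using I1 x by (auto simp: x_def)
      have path: "fpath ?S (Suc x) (children (?S ! x)) (stop ?S x)" and stop_le: "stop ?S x \<le> ?n"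
        using pre xn by (auto simp: preorder_list_def)
      have B: "bv + 2 * x < length (encode_input P T)"
        "encode_input P T ! (bv + 2 * x) = length (children (?S ! x))" using b(2)[OF xn] by auto
      let ?J = "\<lambda>s'. changes {vx, vq, vj} {k} s s' \<and> vars s' vx = x \<and> arr s' k = arr s1 k \<and>
        (\<exists>gs. fpath ?S (vars s' vq) gs (stop ?S x) \<and> length gs = vars s' vj) \<and> Suc x \<le> vars s' vq \<and>
        ticks s' + 3 * jumps ?S (vars s' vq) \<le> ticks s + 1 + 10 * (?n - x) - 5"
      have b1: "aok s' b \<and> aval s' b = bv" if "\<forall>y. y \<notin> {vx, vq, vj} \<longrightarrow> vars s' y = vars s1 y" for s'
        using I1 that by (intro b(1)) (simp add: changes_def)
      show ?thesis
        unfolding wp_Seq wp_Assign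
        apply (intro conjI)
           apply (use xn vx n in \<open>simp add: small\<close>)
          apply (use xn vx n in \<open>simp add: small\<close>)
        subgoal using xn vx n B b1 inp_len by (auto simp: small)
        apply (rule wp_While[where I = ?J and measure = "\<lambda>s'. vars s' vj"])
        subgoal using I1 vx xn path B b1 by (auto simp: changes_def)
        subgoal by simp
        subgoal for s2
        proof -
          assume J: "?J s2" and "bval s2 (Less (N 0) (V vj))"
          then obtain gs where gs: "fpath ?S (vars s2 vq) gs (stop ?S x)" "length gs = vars s2 vj" "0 < vars s2 vj"
            by auto
          then obtain g gs' where g: "gs = g # gs'" by (cases gs) auto
          then have q: "vars s2 vq < ?n" "fpath ?S (stop ?S (vars s2 vq)) gs' (stop ?S x)" using gs by auto
          have "length gs \<le> ?n"
            using length_le_forest_size[of gs] fpath_size[OF gs(1)] stop_le by linarith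
          then have "vars s2 vj < 2 ^ w" using gs n by (intro small) simp
          moreover have "arr s2 k (vars s2 vq) = stop ?S (vars s2 vq)" using I1 J q vx by auto
          moreover have "jumps ?S (vars s2 vq) = Suc (jumps ?S (stop ?S (vars s2 vq)))"
            using q by (intro jumps_stop) simp
          ultimately show ?thesis using J q gs g n
            by (auto simp: changes_def intro!: exI[of _ gs'])
        qed
        subgoal for s2
        proof -
          assume J: "?J s2" and "\<not> bval s2 (Less (N 0) (V vj))"
          then have "vars s2 vq = stop ?S x" by auto
          moreover have "jumps ?S x = Suc (jumps ?S (stop ?S x))"
            using xn by (intro jumps_stop) simp
          moreover have "\<forall>i. x < i \<and> i < ?n \<longrightarrow> arr s1 k i = stop ?S i" using I1 vx by auto
          moreover have "ticks s2 + 3 * jumps ?S (vars s2 vq) + 5 \<le> ticks s + 1 + 10 * (?n - x)"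
            using J xn by auto
          ultimately show ?thesis using J vx xn n
            by (auto simp: changes_def small order_le_less)
        qed
        done
    qed
    subgoal for s1
      using n by (intro Q) (auto simp: changes_def)
    done
qed

lemma wp_chain:
  assumes "env s" "vars s vv = v" "v < nP"
    and Q: "\<And>s' u. changes {vu} {} s s' \<Longrightarrow> vars s' vu = u \<Longrightarrow> v \<le> u \<Longrightarrow> u < nP \<Longrightarrow>
      (\<forall>j. v \<le> j \<and> j < u \<longrightarrow> children (SP ! j) = [SP ! Suc j]) \<Longrightarrow> length (children (SP ! u)) \<noteq> 1 \<Longrightarrow>
      stop SP u = stop SP v \<Longrightarrow>
      num_leaves (SP ! u) = num_leaves (SP ! v) \<Longrightarrow> ticks s' \<le> ticks s + 20 * (nT + 1) \<Longrightarrow> Q s'"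
  shows "wp chain_com Q s"
proof -
  let ?I = "\<lambda>s'. changes {vu} {} s s' \<and> v \<le> vars s' vu \<and> vars s' vu < nP \<and>
      (\<forall>j. v \<le> j \<and> j < vars s' vu \<longrightarrow> children (SP ! j) = [SP ! Suc j]) \<and>
      stop SP (vars s' vu) = stop SP v \<and> num_leaves (SP ! vars s' vu) = num_leaves (SP ! v) \<and>
      ticks s' \<le> ticks s + 1 + 2 * vars s' vu"
  \<comment> \<open>For the last node, cell \<open>Suc u\<close> has no specified content; there the
    first comparison already fails.\<close>
  have only: "Suc u < arr s aendP u \<and> arr s aendP (Suc u) = arr s aendP u \<longleftrightarrow> children (SP ! u) = [SP ! Suc u]"
    if "u < nP" for u
  proof (cases "Suc u < nP")
    case True
    then show ?thesis using only_child_iff(1)[OF preP, of u] assms(1) that by (simp add: env_def)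
  next
    case False
    then have "\<not> Suc u < stop SP u" using stopP_le[OF that] by linarith
    then show ?thesis using only_child_iff[OF preP, of u] assms(1) that by (simp add: env_def)
  qed
  show ?thesis
    unfolding chain_com_def incr_def wp_Seq wp_Assign
    apply (intro conjI)
     apply simp
    apply (rule wp_While[where I = ?I and measure = "\<lambda>s'. nP - vars s' vu"])
    subgoal using assms by (auto simp: changes_def)
    subgoal using size_le by (auto simp: small)
    subgoal for s'
    proof -
      assume I: "?I s'"
        and "bval s' (And (Less (V vu \<oplus> N 1) (Rd aendP (V vu))) (Eq (Rd aendP (V vu \<oplus> N 1)) (Rd aendP (V vu))))"
      then have arr: "arr s' aendP = arr s aendP" by (auto simp: changes_def)
      let ?u = "vars s' vu"
      have u: "?u < nP" and B: "Suc ?u < arr s aendP ?u" "arr s aendP (Suc ?u) = arr s aendP ?u"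
        using I arr \<open>bval _ _\<close> by auto
      then have only': "children (SP ! ?u) = [SP ! Suc ?u]" using only[OF u] by blast
      have "Suc ?u < nP" using B stopP_le[OF u] u assms(1) by (simp add: env_def)
      moreover have "stop SP (Suc ?u) = stop SP ?u"
        using only_child_iff(1)[OF preP, of ?u] only' u by simp
      moreover have "num_leaves (SP ! ?u) = num_leaves (SP ! Suc ?u)"
        using only' by (cases "SP ! ?u") simp
      ultimately show ?thesis using I only' size_le
        by (auto simp: changes_def small less_Suc_eq)
    qed
    subgoal for s'
    proof -
      assume I: "?I s'"
        and "\<not> bval s' (And (Less (V vu \<oplus> N 1) (Rd aendP (V vu))) (Eq (Rd aendP (V vu \<oplus> N 1)) (Rd aendP (V vu))))"
      moreover from I have arr: "arr s' aendP = arr s aendP" by (auto simp: changes_def)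
      let ?u = "vars s' vu"
      have u: "?u < nP" using I by blast
      ultimately have N: "children (SP ! ?u) \<noteq> [SP ! Suc ?u]" using only[OF u] arr by auto
      have path: "fpath SP (Suc ?u) (children (SP ! ?u)) (stop SP ?u)"
        using preP u by (simp add: preorder_list_def)
      have "length (children (SP ! ?u)) \<noteq> 1"
      proof
        assume "length (children (SP ! ?u)) = 1"
        then obtain g where "children (SP ! ?u) = [g]" by (auto simp: length_Suc_conv)
        then show False using path N by auto
      qed
      then show ?thesis using I u size_le by (intro Q[of _ ?u]) (auto simp: changes_def)
    qed
    done
qed

lemma wp_heavy:
  assumes "env s" "vars s vu = u" "u < nP" "children (SP ! u) \<noteq> []"
    and Q: "\<And>s' ds es h. changes {vh, vc} {} s s' \<Longrightarrow> vars s' vh = h \<Longrightarrow>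
      children (SP ! u) = ds @ SP ! h # es \<Longrightarrow> fpath SP (Suc u) ds h \<Longrightarrow>
      (\<forall>g \<in> set (children (SP ! u)). num_nodes g \<le> num_nodes (SP ! h)) \<Longrightarrow>
      ticks s' \<le> ticks s + 20 * (nT + 1) \<Longrightarrow> Q s'"
  shows "wp heavy_com Q s"
proof -
  have path: "fpath SP (Suc u) (children (SP ! u)) (stop SP u)" and stop_le: "stop SP u \<le> nP"
    using preP assms by (auto simp: preorder_list_def)
  obtain g0 gs0 where g0: "children (SP ! u) = g0 # gs0" using assms(4) by (cases "children (SP ! u)") auto
  then have first: "children (SP ! u) = [] @ SP ! Suc u # gs0" and "Suc u < nP" using path by auto
  \<comment> \<open>Two decompositions of the children are kept: one at the candidate
    \<open>h\<close>, and one at \<open>c\<close>, where no child already passed is larger than the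
    candidate. Each round moves \<open>c\<close> forward, which pays for its four ticks.\<close>
  let ?I = "\<lambda>s'. changes {vh, vc} {} s s' \<and>
      (\<exists>ds es. children (SP ! u) = ds @ SP ! vars s' vh # es \<and> fpath SP (Suc u) ds (vars s' vh)) \<and>
      (\<exists>ds es. children (SP ! u) = ds @ es \<and> fpath SP (Suc u) ds (vars s' vc) \<and>
        fpath SP (vars s' vc) es (stop SP u) \<and> (\<forall>g \<in> set ds. num_nodes g \<le> num_nodes (SP ! vars s' vh))) \<and>
      vars s' vh < nP \<and> vars s' vc \<le> stop SP u \<and>
      ticks s' + 4 * (nP - vars s' vc) \<le> ticks s + 2 + 4 * nP"
  show ?thesis
    unfolding heavy_com_def wp_Seq wp_Assign
    apply (intro conjI)
      apply (use assms size_le in \<open>simp add: small\<close>)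
     apply (use assms size_le in \<open>simp add: small\<close>)
    apply (rule wp_While[where I = ?I and measure = "\<lambda>s'. nP - vars s' vc"])
    subgoal
    proof -
      have "\<exists>ds es. children (SP ! u) = ds @ SP ! Suc u # es \<and> fpath SP (Suc u) ds (Suc u)"
        using first by (intro exI[of _ "[]"] exI[of _ gs0]) simp
      moreover have "\<exists>ds es. children (SP ! u) = ds @ es \<and> fpath SP (Suc u) ds (Suc u) \<and>
          fpath SP (Suc u) es (stop SP u) \<and> (\<forall>g \<in> set ds. num_nodes g \<le> num_nodes (SP ! Suc u))"
        using path by (intro exI[of _ "[]"] exI[of _ "children (SP ! u)"]) simp
      ultimately show ?thesis
        using assms(2) \<open>Suc u < nP\<close> fpath_le[OF path] by (simp add: changes_def)
    qed
    subgoal using assms(1,2,3) size_le by (auto simp: small changes_def)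
    subgoal for s'
    proof -
      assume I: "?I s'" and "bval s' (Less (V vc) (Rd aendP (V vu)))"
      let ?c = "vars s' vc" and ?h = "vars s' vh"
      have arr: "\<And>i. i < nP \<Longrightarrow> arr s' aendP i = stop SP i" and vu: "vars s' vu = u"
        using I assms(1,2) by (auto simp: changes_def env_def)
      have c: "?c < stop SP u" using \<open>bval _ _\<close> arr vu assms(3) by simp
      have h: "?h < nP" using I by blast
      have cn: "?c < nP" using c stop_le by linarith
      obtain ds es where D: "children (SP ! u) = ds @ es" "fpath SP (Suc u) ds ?c" "fpath SP ?c es (stop SP u)"
        "\<forall>g \<in> set ds. num_nodes g \<le> num_nodes (SP ! ?h)" using I by blast
      obtain es' where es: "es = SP ! ?c # es'" "fpath SP (stop SP ?c) es' (stop SP u)"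
        using D(3) c by (cases es) auto
      have path': "fpath SP (Suc u) (ds @ [SP ! ?c]) (stop SP ?c)"
        using D(2) cn by (auto simp: fpath_append)
      have le: "stop SP ?c \<le> stop SP u" using fpath_le[OF es(2)] .
      have lt: "?c < stop SP ?c" by simp
      have bounds: "stop SP ?h + ?c < 2 ^ w" "stop SP ?c + ?h < 2 ^ w" "?c < M" "?h < M"
        using stopP_le[OF h] stopP_le[OF cn] h cn size_le by (auto intro!: small)
      have ticks: "ticks s' + 4 * (nP - ?c) \<le> ticks s + 2 + 4 * nP" using I by blast
      have measure: "nP - stop SP ?c < nP - ?c" using lt cn by (intro diff_less_mono2)
      have time: "ticks s' + 4 + 4 * (nP - stop SP ?c) \<le> ticks s + 2 + 4 * nP"
        using ticks lt le stop_le by linarith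
      show ?thesis
      proof (cases "stop SP ?h + ?c < stop SP ?c + ?h")
        case True
        then have "\<forall>g \<in> set (ds @ [SP ! ?c]). num_nodes g \<le> num_nodes (SP ! ?c)" using D(4) by fastforce
        then have "\<exists>ds es. children (SP ! u) = ds @ es \<and> fpath SP (Suc u) ds (stop SP ?c) \<and>
          fpath SP (stop SP ?c) es (stop SP u) \<and> (\<forall>g \<in> set ds. num_nodes g \<le> num_nodes (SP ! ?c))"
          using D(1) es path' by (intro exI[of _ "ds @ [SP ! ?c]"] exI[of _ es']) simp
        moreover have "\<exists>ds es. children (SP ! u) = ds @ SP ! ?c # es \<and> fpath SP (Suc u) ds ?c"
          using D(1,2) es(1) by blast
        ultimately show ?thesis using True I arr[OF h] arr[OF cn] bounds cn le measure time stop_le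
          by (simp add: changes_def)
      next
        case False
        then have "\<forall>g \<in> set (ds @ [SP ! ?c]). num_nodes g \<le> num_nodes (SP ! ?h)" using D(4) by auto
        then have "\<exists>ds es. children (SP ! u) = ds @ es \<and> fpath SP (Suc u) ds (stop SP ?c) \<and>
          fpath SP (stop SP ?c) es (stop SP u) \<and> (\<forall>g \<in> set ds. num_nodes g \<le> num_nodes (SP ! ?h))"
          using D(1) es path' by (intro exI[of _ "ds @ [SP ! ?c]"] exI[of _ es']) simp
        then show ?thesis using False I arr[OF h] arr[OF cn] bounds cn le measure time stop_le
          by (simp add: changes_def)
      qed
    qed
    subgoal for s'
    proof -
      assume I: "?I s'" and "\<not> bval s' (Less (V vc) (Rd aendP (V vu)))"
      moreover have "arr s' aendP u = stop SP u" "vars s' vu = u"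
        using I assms(1,2,3) by (auto simp: changes_def env_def)
      ultimately have c: "vars s' vc = stop SP u" by auto
      obtain ds es where D: "children (SP ! u) = ds @ es" "fpath SP (vars s' vc) es (stop SP u)"
        "\<forall>g \<in> set ds. num_nodes g \<le> num_nodes (SP ! vars s' vh)" using I by blast
      have "length es = 0" using fpath_size[OF D(2)] c length_le_forest_size[of es] by linarith
      then have max: "\<forall>g \<in> set (children (SP ! u)). num_nodes g \<le> num_nodes (SP ! vars s' vh)" using D by simp
      obtain ds' es' where H: "children (SP ! u) = ds' @ SP ! vars s' vh # es'" "fpath SP (Suc u) ds' (vars s' vh)"
        using I by blast
      show ?thesis using I size_le
        by (intro Q[OF _ _ H]) (use max in \<open>auto simp: changes_def\<close>)
    qed
    done
qed


lemma wp_levels: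
  assumes env: "env s" and vu: "vars s vu = u" "vars s vv = v" "v \<le> u" "u < nP"
    and chain: "\<forall>j. v \<le> j \<and> j < u \<longrightarrow> children (SP ! j) = [SP ! Suc j]"
    and A: "\<forall>p \<le> Suc nT. arr s aA p = forest_end ST (children (SP ! u)) p"
    and Q: "\<And>s'. changes {vx, vq, vm} {aE} s s' \<Longrightarrow>
      (\<forall>x < nT. is_level ST ((!) SP) v u {x} (arr s' aE x)) \<Longrightarrow>
      ticks s' \<le> ticks s + 20 * (nT + 1) \<Longrightarrow> Q s'"
  shows "wp levels_com Q s"
proof -
  let ?level = "is_level ST ((!) SP) v u"
  \<comment> \<open>Same potential as for the ends: visiting a child costs two tests and two
    assignments, hence the factor \<open>4\<close> on \<open>jumps\<close>.\<close>
  let ?I = "\<lambda>s'. changes {vx, vq, vm} {aE} s s' \<and> vars s' vx \<le> nT \<and>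
      (\<forall>x. vars s' vx \<le> x \<and> x < nT \<longrightarrow> ?level {x} (arr s' aE x)) \<and>
      ticks s' + 4 * jumps ST (vars s' vx) \<le> ticks s + 1 + 15 * (nT - vars s' vx)"
  show ?thesis
    unfolding levels_com_def wp_Seq wp_Assign
    apply (intro conjI)
     apply simp
    apply (rule wp_While[where I = ?I and measure = "\<lambda>s'. vars s' vx"])
    subgoal using env by (auto simp: changes_def jumps.simps[of ST nT] env_def)
    subgoal by simp
    subgoal for s1
    proof -
      assume I1: "?I s1" and "bval s1 (Less (N 0) (V vx))"
      then have x: "0 < vars s1 vx" by simp
      define x where "x = vars s1 vx - 1"
      have xn: "x < nT" and vx: "vars s1 vx = Suc x" using I1 x by (auto simp: x_def)
      have stop_le: "stop ST x \<le> nT" using stopT_le[OF xn] .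
      have E1: "?level {y} (arr s1 aE y)" if "x < y" "y < nT" for y
        using I1 vx that by auto
      let ?J = "\<lambda>s'. changes {vx, vq, vm} {aE} s s' \<and> vars s' vx = x \<and> arr s' aE = arr s1 aE \<and>
        x < vars s' vq \<and> vars s' vq \<le> stop ST x \<and> ?level {x<..<vars s' vq} (vars s' vm) \<and>
        ticks s' + 4 * jumps ST (vars s' vq) + 11 \<le> ticks s + 1 + 15 * (nT - x)"
      show ?thesis
        unfolding wp_Seq wp_Assign
        apply (intro conjI)
           apply (use xn vx in \<open>simp add: small\<close>)
          apply (use I1 xn vx vu size_le in \<open>simp add: small changes_def\<close>)
         apply (use xn vx in \<open>simp add: small\<close>)
        apply (rule wp_While[where I = ?J and measure = "\<lambda>s'. nT - vars s' vq"])
        subgoal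
        proof -
          have "{x<..<Suc x} = {}" by auto
          then show ?thesis using I1 vx xn vu by (auto simp: changes_def is_level_empty Suc_le_eq)
        qed
        subgoal using xn by simp
        subgoal for s2
        proof -
          assume J: "?J s2" and guard: "bval s2 (Less (V vq) (Rd aendT (V vx)))"
          let ?q = "vars s2 vq" and ?m = "vars s2 vm"
          have arr: "arr s2 aendT i = stop ST i" if "i < nT" for i
            using J env that by (auto simp: changes_def env_def)
          have q: "x < ?q" "?q < stop ST x" using J guard arr[OF xn] by auto
          then have qn: "?q < nT" using stop_le by linarith
          have "?level {x<..<stop ST ?q} (min ?m (arr s1 aE ?q))"
            using J qn q(1) E1[OF q(1) qn] by (intro is_level_jump[OF preT]) auto
          moreover have "jumps ST ?q = Suc (jumps ST (stop ST ?q))" using qn by (intro jumps_stop) simp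
          moreover have "stop ST ?q \<le> stop ST x" using q xn by (intro stop_nested'[OF preT]) auto
          moreover have "nT - stop ST ?q < nT - ?q" using qn by (intro diff_less_mono2) auto
          moreover have "?q < stop ST ?q" by simp
          then have "x < stop ST ?q" using q(1) by linarith
          ultimately show ?thesis using J arr[OF qn] qn
            by (auto simp: changes_def min_def not_less split: if_splits)
        qed
        subgoal for s2
        proof -
          assume J: "?J s2" and guard: "\<not> bval s2 (Less (V vq) (Rd aendT (V vx)))"
          let ?m = "vars s2 vm"
          have arr: "arr s2 aendT x = stop ST x" "arr s2 aA (Suc x) = forest_end ST (children (SP ! u)) (Suc x)"
            and vars: "vars s2 vnT = nT" "vars s2 vnP = nP" "vars s2 vv = v" "vars s2 vu = u" "vars s2 vx = x"
            using J env A xn vu by (auto simp: changes_def env_def)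
          have "vars s2 vq = stop ST x" using J guard arr by auto
          then have m: "?level {x<..<stop ST x} ?m" using J by simp
          then have mu: "v \<le> ?m" "?m \<le> Suc u" by (simp_all add: is_level_def)
          let ?c = "forest_end ST (children (SP ! u)) (Suc x) \<le> stop ST x"
          have step: "?level {x} (if v < ?m \<and> label (ST ! x) = label (SP ! (?m - 1)) \<and>
              (?m \<le> u \<or> ?c) then ?m - 1 else ?m)"
            using chain xn by (intro is_level_step[OF preT _ _ m]) auto
          have ix: "2 + 2 * nP + 2 * x < length (encode_input P T)"
            "encode_input P T ! (2 + 2 * nP + 2 * x) = label (ST ! x)"
            using xn by (simp_all only: encode_input_nth) auto
          \<comment> \<open>Here \<open>v < ?m\<close> guarantees that \<open>?m\<close> has a
            predecessor, and \<open>?m \<le> Suc u\<close> that it is a pattern node.\<close>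
          have im: "2 * ?m < length (encode_input P T)"
            "encode_input P T ! (2 * ?m) = label (SP ! (?m - 1))" if pos: "v < ?m"
          proof -
            obtain m where m: "?m = Suc m" using pos by (cases ?m) auto
            then have "m < nP" using mu vu by simp
            then show "2 * ?m < length (encode_input P T)"
              "encode_input P T ! (2 * ?m) = label (SP ! (?m - 1))"
              using encode_input_nth(4)[of m P T] m by (simp_all add: encode_input_nth(3))
          qed
          have "jumps ST x = Suc (jumps ST (stop ST x))" using xn by (intro jumps_stop) simp
          then have time: "ticks s2 + 4 * jumps ST x + 6 \<le> ticks s + 1 + 15 * (nT - x)"
            using J \<open>vars s2 vq = stop ST x\<close> by auto
          have E: "\<forall>y. x < y \<and> y < nT \<longrightarrow> ?level {y} (arr s2 aE y)" using E1 J by auto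
          have bounds: "x < M" "Suc x < M" "?m < 2 ^ w" "2 * x < 2 ^ w" "2 * ?m < 2 ^ w" "2 < (2 :: nat) ^ w"
            "1 < (2 :: nat) ^ w" "Suc x < 2 ^ w" "2 * nP < 2 ^ w" "2 + 2 * nP < 2 ^ w" "2 + 2 * nP + 2 * x < 2 ^ w"
            using xn mu vu size_le by (auto intro!: small)
          define e where "e = (if v < ?m \<and> label (ST ! x) = label (SP ! (?m - 1)) \<and>
              (?m \<le> u \<or> ?c) then ?m - 1 else ?m)"
          have "\<forall>y. x \<le> y \<and> y < nT \<longrightarrow> ?level {y} (((arr s2 aE)(x := e)) y)"
            using E step by (auto simp: e_def order_le_less)
          then have I: "?I s'" if "changes {vx, vq, vm} {aE} s s'" "vars s' vx = x"
            "arr s' aE = (arr s2 aE)(x := e)" "ticks s' \<le> ticks s2 + 6" for s'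
            using that time xn by auto
          have changes: "changes {vx, vq, vm} {aE} s s2" using J by blast
          have m0: "v < ?m \<Longrightarrow> 1 \<le> ?m" by simp
          consider "v < ?m" "label (ST ! x) = label (SP ! (?m - 1))" "u < ?m" "?c"
            | "v < ?m" "label (ST ! x) = label (SP ! (?m - 1))" "u < ?m" "\<not> ?c"
            | "v < ?m" "label (ST ! x) = label (SP ! (?m - 1))" "?m \<le> u"
            | "\<not> (v < ?m \<and> label (ST ! x) = label (SP ! (?m - 1)))" by linarith
          note cases = this
          \<comment> \<open>Six ticks: the failed loop test, at most three further tests, one
            assignment and the write.\<close>
          let ?post = "\<lambda>s'. changes {vx, vq, vm} {aE} s s' \<and> vars s' vx = x \<and>
            arr s' aE = (arr s2 aE)(x := e) \<and> ticks s' \<le> ticks s2 + 6"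
          show ?thesis
            unfolding wp_Seq[symmetric]
          proof (rule wp_mono[where Q = ?post], goal_cases)
            case (2 s')
            then have "?I s'" by (intro I) blast+
            moreover have "vars s' vx < vars s1 vx" using 2 vx by simp
            ultimately show ?case by (rule conjI)
          next
            case 1
            show ?case
              using cases
            proof cases
              case 1
              then have "e = ?m - 1" by (simp add: e_def)
              then show ?thesis using 1 bounds ix im[OF 1(1)] arr vars changes m0 vx xn
                by (auto simp: changes_def)
            next
              case 2
              then have "e = ?m" by (simp add: e_def)
              then show ?thesis using 2 bounds ix im[OF 2(1)] arr vars changes m0 vx xn
                by (auto simp: changes_def)
            next
              case 3
              then have "e = ?m - 1" by (simp add: e_def)
              then show ?thesis using 3 bounds ix im[OF 3(1)] arr vars changes m0 vx xn
                by (auto simp: changes_def)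
            next
              case 4
              then have e: "e = ?m" by (auto simp: e_def)
              show ?thesis
              proof (cases "v < ?m")
                case True
                then show ?thesis using 4 e bounds ix im[OF True] arr vars changes m0 vx xn
                  by (auto simp: changes_def)
              next
                case False
                then show ?thesis using e bounds ix arr vars changes vx xn
                  by (auto simp: changes_def)
              qed
            qed
          qed
        qed
        done
    qed
    subgoal for s1
      by (intro Q) (auto simp: changes_def)
    done
qed

lemma wp_result:
  assumes env: "env s" and v: "vars s vv = v" "v \<le> u"
    and E: "\<forall>x < nT. is_level ST ((!) SP) v u {x} (arr s aE x)"
    and Q: "\<And>s'. changes {vx} {aR} s s' \<Longrightarrow> (\<forall>p \<le> Suc nT. arr s' aR p = tree_end ST (SP ! v) p) \<Longrightarrow>
      ticks s' \<le> ticks s + 20 * (nT + 1) \<Longrightarrow> Q s'"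
  shows "wp result_com Q s"
proof -
  let ?f = "tree_end ST (SP ! v)"
  let ?I = "\<lambda>s'. changes {vx} {aR} s s' \<and> vars s' vx \<le> nT \<and>
      (\<forall>p. vars s' vx \<le> p \<and> p \<le> Suc nT \<longrightarrow> arr s' aR p = ?f p) \<and>
      ticks s' \<le> ticks s + 3 + 4 * (nT - vars s' vx)"
  have beyond: "?f nT = Suc nT" "?f (Suc nT) = Suc nT" by (simp_all add: next_stop_beyond)
  show ?thesis
    unfolding result_com_def wp_Seq wp_Assign
    apply (simp only: wp_Write aok.simps aval.simps)
    apply (intro conjI)
           apply (use env in \<open>simp_all add: env_def small\<close>)
    apply (rule wp_While[where I = ?I and measure = "\<lambda>s'. vars s' vx"])
    subgoal using env beyond by (auto simp: changes_def env_def le_Suc_eq)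
    subgoal by simp
    subgoal for s1
    proof -
      assume I1: "?I s1" and "bval s1 (Less (N 0) (V vx))"
      then have x: "0 < vars s1 vx" by simp
      define x where "x = vars s1 vx - 1"
      have xn: "x < nT" and vx: "vars s1 vx = Suc x" using I1 x by (auto simp: x_def)
      have arr: "arr s1 aendT x = stop ST x" "arr s1 aR (Suc x) = ?f (Suc x)" "arr s1 aE x = arr s aE x"
        "vars s1 vv = v"
        using I1 env xn vx v by (auto simp: changes_def env_def)
      have R: "\<forall>p. x < p \<and> p \<le> Suc nT \<longrightarrow> arr s1 aR p = ?f p" using I1 vx by auto
      have "is_level ST ((!) SP) v u {x} (arr s aE x)" using E xn by blast
      \<comment> \<open>Level \<open>v\<close> is the least possible one, so it is attained exactly
        where the top tree of the chain occurs.\<close>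
      then have "occurs ST (SP ! v) x \<longleftrightarrow> arr s aE x = v" using v(2) by (auto simp: is_level_def)
      then have f: "?f x = (if arr s aE x = v then min (stop ST x) (?f (Suc x)) else ?f (Suc x))"
        using tree_end_step[OF preT, of x "SP ! v"] xn by simp
      show ?thesis
        using I1 vx xn arr f R by (auto simp: changes_def small order_le_less)
    qed
    subgoal for s1
      by (intro Q) (auto simp: changes_def)
    done
qed

end

section \<open>The main loop\<close>

text \<open>
  The recursion needs no control stack, since the caller of a chain is stored with the chain top. In mode 0
  the chain with top \<open>v\<close> is called, mode 1 returns from it, and mode 2 continues with the child \<open>c\<close> of \<open>u\<close>.
  The child \<open>h\<close> is called before all others, so a return from it starts the iteration over the children.
\<close>

definition "call_com =
  chain_com;;
  Write abottom (V vv) (V vu);;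
  If (Less (V vu \<oplus> N 1) (Rd aendP (V vu)))
    (heavy_com;;
     Write aheavy (V vv) (V vh);;
     Write aparent (V vh) (V vv);;
     vv \<leftarrow> V vh)
    (ident_com;;
     vc \<leftarrow> Rd aendP (V vu);;
     vmode \<leftarrow> N 2)"

text \<open>Node \<open>0\<close> is the top of the outermost chain, which has no caller; mode
  \<open>3\<close> ends the loop.\<close>

definition "return_com =
  If (Eq (V vv) (N 0))
    (vmode \<leftarrow> N 3)
    (vc \<leftarrow> V vv;;
     vv \<leftarrow> Rd aparent (V vc);;
     vu \<leftarrow> Rd abottom (V vv);;
     vh \<leftarrow> Rd aheavy (V vv);;
     vmode \<leftarrow> N 2;;
     If (Eq (V vc) (V vh))
       (push_com aR;;
        ident_com;;
        vc \<leftarrow> V vu \<oplus> N 1)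
       (pop_com aA;;
        compose_com;;
        vc \<leftarrow> Rd aendP (V vc)))"

text \<open>The function of \<open>h\<close> is computed early but composed late. Each light child
  to the left of \<open>h\<close> pushes \<open>A\<close> above it and pops \<open>A\<close> again
  on return, so it is on top of the stacks when \<open>c\<close> reaches \<open>h\<close>.\<close>

definition "children_com =
  If (Less (V vc) (Rd aendP (V vu)))
    (If (Eq (V vc) (V vh))
      (pop_com aR;;
       compose_com;;
       vc \<leftarrow> Rd aendP (V vc))
      (push_com aA;;
       Write aparent (V vc) (V vv);;
       vv \<leftarrow> V vc;;
       vmode \<leftarrow> N 0))
    (levels_com;;
     result_com;;
     vmode \<leftarrow> N 1)"

definition "body_com =
  If (Eq (V vmode) (N 0)) call_com (If (Eq (V vmode) (N 1)) return_com children_com)"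

lemma num_nodes_neq_0 [simp]: "num_nodes t \<noteq> 0"
  using num_nodes_pos[of t] by (simp only: neq0_conv)

context inclusion_problem
begin

text \<open>A round consists of a bounded number of linear passes, so the time bound reduces to
  counting rounds.\<close>

definition main_round :: "state \<Rightarrow> state \<Rightarrow> bool" where
  "main_round s s' \<longleftrightarrow> vars s vmode < 3 \<and> exec body_com (tick s) s' \<and> ticks s' \<le> ticks s + 100 * (nT + 1)"

lemma wp_round:
  assumes "vars s vmode < 3"
    and "wp body_com (\<lambda>s'. ticks s' \<le> ticks s + 100 * (nT + 1) \<and> Q s') (tick s)"
  shows "\<exists>s'. main_round s s' \<and> Q s'"
  using assms unfolding main_round_def wp_def by blast

lemma mode_cases:
  "vars s vmode = 0 \<Longrightarrow> wp body_com Q s \<longleftrightarrow> wp call_com Q (tick s)"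
  "vars s vmode = 1 \<Longrightarrow> wp body_com Q s \<longleftrightarrow> wp return_com Q (tick (tick s))"
  "vars s vmode = 2 \<Longrightarrow> wp body_com Q s \<longleftrightarrow> wp children_com Q (tick (tick s))"
  by (simp_all add: body_com_def small)

text \<open>
  A call of \<open>v\<close> may change the control arrays only within the subtree of \<open>v\<close>, and not its return address.
\<close>

definition keeps :: "nat \<Rightarrow> state \<Rightarrow> state \<Rightarrow> bool" where
  "keeps v s s' \<longleftrightarrow> written s' = written s \<and>
    (\<forall>i. i < v \<or> stop SP v \<le> i \<longrightarrow>
      arr s' aparent i = arr s aparent i \<and> arr s' abottom i = arr s abottom i \<and> arr s' aheavy i = arr s aheavy i) \<and>
    arr s' aparent v = arr s aparent v"

section \<open>The transitions between the modes of the main loop\<close>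

lemma round_call:
  assumes "env s" "vars s vmode = 0" "vars s vv = v" "v < nP"
    and Q: "\<And>s' u. env s' \<Longrightarrow> vars s' vmode = 2 \<Longrightarrow> vars s' vv = v \<Longrightarrow> vars s' vu = u \<Longrightarrow>
       vars s' vc = stop SP u \<Longrightarrow> v \<le> u \<Longrightarrow> u < nP \<Longrightarrow> stop SP u = stop SP v \<Longrightarrow>
       (\<forall>j. v \<le> j \<and> j < u \<longrightarrow> children (SP ! j) = [SP ! Suc j]) \<Longrightarrow> children (SP ! u) = [] \<Longrightarrow>
       (\<forall>p \<le> Suc nT. arr s' aA p = p) \<Longrightarrow> arr s' aS = arr s aS \<Longrightarrow> keeps v s s' \<Longrightarrow> Q s'"
    and Q': "\<And>s' u ds h es. env s' \<Longrightarrow> vars s' vmode = 0 \<Longrightarrow> vars s' vv = h \<Longrightarrow>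
       v \<le> u \<Longrightarrow> u < nP \<Longrightarrow> stop SP u = stop SP v \<Longrightarrow>
       (\<forall>j. v \<le> j \<and> j < u \<longrightarrow> children (SP ! j) = [SP ! Suc j]) \<Longrightarrow>
       length (children (SP ! u)) \<ge> 2 \<Longrightarrow> num_leaves (SP ! u) = num_leaves (SP ! v) \<Longrightarrow>
       children (SP ! u) = ds @ SP ! h # es \<Longrightarrow> fpath SP (Suc u) ds h \<Longrightarrow>
       (\<forall>g \<in> set (children (SP ! u)). num_nodes g \<le> num_nodes (SP ! h)) \<Longrightarrow>
       arr s' abottom v = u \<Longrightarrow> arr s' aheavy v = h \<Longrightarrow> arr s' aparent h = v \<Longrightarrow>
       arr s' aS = arr s aS \<Longrightarrow> keeps v s s' \<Longrightarrow> Q s'"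
  shows "\<exists>s'. main_round s s' \<and> Q s'"
proof (rule wp_round)
  have mode: "vars (tick s) vmode = 0" using assms by simp
  show "wp body_com (\<lambda>s'. ticks s' \<le> ticks s + 100 * (nT + 1) \<and> Q s') (tick s)"
    unfolding call_com_def wp_Seq mode_cases(1)[OF mode]
  proof (rule wp_chain[of _ v])
    show "env (tick (tick s))" "vars (tick (tick s)) vv = v" "v < nP"
      using assms by (simp_all add: env_def)
    fix s1 u
    assume s1: "changes {vu} {} (tick (tick s)) s1" "vars s1 vu = u"
      and u: "v \<le> u" "u < nP"
        "\<forall>j. v \<le> j \<and> j < u \<longrightarrow> children (SP ! j) = [SP ! Suc j]" "length (children (SP ! u)) \<noteq> 1"
        "stop SP u = stop SP v" "num_leaves (SP ! u) = num_leaves (SP ! v)"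
      and t1: "ticks s1 \<le> ticks (tick (tick s)) + 20 * (nT + 1)"
    let ?s2 = "tick (s1\<lparr>arr := (arr s1)(abottom := (arr s1 abottom)(v := u))\<rparr>)"
    have vars1: "vars s1 vv = v" "vars s1 vmode = 0" using s1 assms by (simp_all add: changes_def)
    have env2: "env ?s2" using s1 assms(1) by (simp add: env_def changes_def)
    have end_u: "arr ?s2 aendP u = stop SP u" using env2 u(2) by (simp add: env_def)
    have kids: "Suc u < stop SP u \<longleftrightarrow> children (SP ! u) \<noteq> []" using only_child_iff(2)[OF preP] u(2) by simp
    have bounds: "v < M" "u < M" "Suc u < 2 ^ w" "2 < (2 :: nat) ^ w" "1 < (2 :: nat) ^ w"
      using assms(4) u size_le by (auto intro!: small)
    have "v < stop SP v" by simp
    have "wp (If (Less (V vu \<oplus> N 1) (Rd aendP (V vu)))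
        (heavy_com;; Write aheavy (V vv) (V vh);; Write aparent (V vh) (V vv);; vv \<leftarrow> V vh)
        (ident_com;; vc \<leftarrow> Rd aendP (V vu);; vmode \<leftarrow> N 2))
        (\<lambda>s'. ticks s' \<le> ticks s + 100 * (nT + 1) \<and> Q s') ?s2"
    proof (cases "children (SP ! u) = []")
      case True
      have "wp ident_com (wp (vc \<leftarrow> Rd aendP (V vu)) (wp (vmode \<leftarrow> N 2) 
          (\<lambda>s'. ticks s' \<le> ticks s + 100 * (nT + 1) \<and> Q s'))) (tick ?s2)"
      proof (rule wp_ident)
        show "vars (tick ?s2) vnT = nT" using env2 by (simp add: env_def)
        fix s3
        assume s3: "changes {vp} {aA} (tick ?s2) s3" "\<forall>p \<le> Suc nT. arr s3 aA p = p"
          "ticks s3 \<le> ticks (tick ?s2) + 20 * (nT + 1)"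
        have "arr s3 aendP u = stop SP u" "vars s3 vu = u" using s3 s1(2) end_u by (auto simp: changes_def)
        moreover have "keeps v s (s3\<lparr>vars := x, ticks := y\<rparr>)" for x y
          using s1 s3 \<open>v < stop SP v\<close> by (auto simp: keeps_def changes_def)
        ultimately show "wp (vc \<leftarrow> Rd aendP (V vu)) (wp (vmode \<leftarrow> N 2) 
          (\<lambda>s'. ticks s' \<le> ticks s + 100 * (nT + 1) \<and> Q s')) s3"
          using s1 s3 t1 bounds True u vars1 env2
          by (auto simp: changes_def env_def tick_def intro!: Q[of _ u])
      qed
      then show ?thesis using True kids end_u s1(2) bounds by simp
    next
      case False
      have "wp heavy_com (wp (Write aheavy (V vv) (V vh)) (wp (Write aparent (V vh) (V vv)) (wp (vv \<leftarrow> V vh) 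
          (\<lambda>s'. ticks s' \<le> ticks s + 100 * (nT + 1) \<and> Q s')))) (tick ?s2)"
      proof (rule wp_heavy)
        show "env (tick ?s2)" "vars (tick ?s2) vu = u" "u < nP" "children (SP ! u) \<noteq> []"
          using env2 s1 u False by (simp_all add: env_def)
        fix s3 ds es h
        assume s3: "changes {vh, vc} {} (tick ?s2) s3" "vars s3 vh = h"
          and h: "children (SP ! u) = ds @ SP ! h # es" "fpath SP (Suc u) ds h"
            "\<forall>g \<in> set (children (SP ! u)). num_nodes g \<le> num_nodes (SP ! h)"
          and t3: "ticks s3 \<le> ticks (tick ?s2) + 20 * (nT + 1)"
        have path: "fpath SP (Suc u) (children (SP ! u)) (stop SP u)" "stop SP u \<le> nP"
          using preP u(2) by (auto simp: preorder_list_def)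
        then obtain r where r: "fpath SP (Suc u) ds r" "fpath SP r (SP ! h # es) (stop SP u)"
          using h(1) by (auto simp: fpath_append)
        \<comment> \<open>Both are the position reached from \<open>Suc u\<close> after the trees
          \<open>ds\<close>.\<close>
        have "r = h" using fpath_size[OF r(1)] fpath_size[OF h(2)] by simp
        then have "stop SP h \<le> stop SP u" using r(2) fpath_le[of SP "stop SP h" es] by auto
        moreover have "h < stop SP h" by simp
        ultimately have hv: "h < stop SP v" "h < nP" using u(5) path(2) by linarith+
        have vh: "v < h" using fpath_le[OF h(2)] u(1) by linarith
        \<comment> \<open>The chain was extended as far as possible, so a bottom that is no leaf has
          at least two children. The count of rounds against leaves depends on this.\<close>
        have len: "2 \<le> length (children (SP ! u))"
          using False u(4) by (cases "children (SP ! u)"; cases "tl (children (SP ! u))") auto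
        have "keeps v s (s3\<lparr>arr := (arr s3)(aheavy := (arr s3 aheavy)(v := h),
            aparent := (arr s3 aparent)(h := v)), vars := x, ticks := y\<rparr>)" for x y
          using s1 s3 \<open>v < stop SP v\<close> hv vh by (auto simp: keeps_def changes_def)
        moreover have "vars s3 vv = v" "vars s3 vmode = 0" "vars s3 vh = h"
          using s1 s3 vars1 by (auto simp: changes_def)
        moreover have "env s3" "arr s3 aS = arr s aS" "arr s3 abottom v = u"
          using s3 s1 env2 by (auto simp: changes_def env_def)
        ultimately have "wp (Write aheavy (V vv) (V vh);; Write aparent (V vh) (V vv);; vv \<leftarrow> V vh)
          (\<lambda>s'. ticks s' \<le> ticks s + 100 * (nT + 1) \<and> env s' \<and> vars s' vmode = 0 \<and> vars s' vv = h \<and>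
            arr s' abottom v = u \<and> arr s' aheavy v = h \<and> arr s' aparent h = v \<and> arr s' aS = arr s aS \<and>
            keeps v s s') s3"
          using t1 t3 bounds(1) hv(2) size_le by (simp add: env_def tick_def)
        then have "wp (Write aheavy (V vv) (V vh);; Write aparent (V vh) (V vv);; vv \<leftarrow> V vh)
          (\<lambda>s'. ticks s' \<le> ticks s + 100 * (nT + 1) \<and> Q s') s3"
          by (rule wp_mono) (use Q' u h len in blast)
        then show "wp (Write aheavy (V vv) (V vh)) (wp (Write aparent (V vh) (V vv)) (wp (vv \<leftarrow> V vh)
          (\<lambda>s'. ticks s' \<le> ticks s + 100 * (nT + 1) \<and> Q s'))) s3"
          by (simp only: wp_Seq)
      qed
      then show ?thesis using False kids end_u s1(2) bounds by simp
    qed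
    then show "wp (Write abottom (V vv) (V vu)) (wp (If (Less (V vu \<oplus> N 1) (Rd aendP (V vu)))
        (heavy_com;; Write aheavy (V vv) (V vh);; Write aparent (V vh) (V vv);; vv \<leftarrow> V vh)
        (ident_com;; vc \<leftarrow> Rd aendP (V vu);; vmode \<leftarrow> N 2))
        (\<lambda>s'. ticks s' \<le> ticks s + 100 * (nT + 1) \<and> Q s')) s1"
      using vars1 s1(2) bounds by (simp del: wp_If wp_Seq)
  qed
qed (use assms(2) in simp)


abbreviation "array s k f \<equiv> \<forall>p \<le> Suc nT. arr s k p = f p"
abbreviation "stack s B \<equiv> \<forall>t < 2 * nT + 2. arr s aS t = B t"

definition at_child :: "nat \<Rightarrow> nat \<Rightarrow> nat \<Rightarrow> nat \<Rightarrow> state \<Rightarrow> bool" where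
  "at_child v u h c s \<longleftrightarrow> env s \<and> vars s vmode = 2 \<and> vars s vv = v \<and> vars s vu = u \<and> vars s vh = h \<and>
    vars s vc = c"

text \<open>Monotonicity and the upper bound are what the bit coding needs. The lower bound makes
  \<open>Suc nT\<close> a fixed point, so infinity survives composition.\<close>

definition end_function :: "(nat \<Rightarrow> nat) \<Rightarrow> bool" where
  "end_function f \<longleftrightarrow> mono f \<and> (\<forall>p \<le> Suc nT. p \<le> f p \<and> f p \<le> Suc nT)"

lemma end_function_forest_end: "end_function (forest_end ST F)"
  using forest_end_mono[of _ _ ST F] forest_end_le[of _ ST F] forest_end_ge[of _ ST F]
  by (simp add: end_function_def mono_def)

lemma end_function_tree_end: "end_function (tree_end ST f)"
  using end_function_forest_end[of "[f]"] by simp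

lemma array_end_function:
  assumes "array s k f" "end_function f"
  shows "mono_on {..nT} (arr s k)" "\<forall>p \<le> nT. arr s k p \<le> Suc nT" "arr s k (Suc nT) = Suc nT"
    "push_marks nT (arr s k) B t = push_marks nT f B t"
proof -
  show "mono_on {..nT} (arr s k)" using assms by (auto simp: end_function_def mono_def intro!: mono_onI)
  show "\<forall>p \<le> nT. arr s k p \<le> Suc nT" using assms by (auto simp: end_function_def)
  show "arr s k (Suc nT) = Suc nT" using assms by (metis end_function_def le_antisym order_refl)
  show "push_marks nT (arr s k) B t = push_marks nT f B t"
    using assms(1) by (simp add: push_marks_def marked_def)
qed

lemma round_finish:
  assumes "at_child v u h (stop SP u) s" "v \<le> u" "u < nP"
    and chain: "\<forall>j. v \<le> j \<and> j < u \<longrightarrow> children (SP ! j) = [SP ! Suc j]"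
    and A: "array s aA (forest_end ST (children (SP ! u)))"
  shows "\<exists>s'. main_round s s' \<and> env s' \<and> vars s' vmode = 1 \<and> vars s' vv = v \<and>
    array s' aR (tree_end ST (SP ! v)) \<and> arr s' aS = arr s aS \<and> keeps v s s'"
proof (rule wp_round)
  let ?Q = "\<lambda>s'. ticks s' \<le> ticks s + 100 * (nT + 1) \<and> env s' \<and> vars s' vmode = 1 \<and> vars s' vv = v \<and>
    array s' aR (tree_end ST (SP ! v)) \<and> arr s' aS = arr s aS \<and> keeps v s s'"
  have mode: "vars (tick s) vmode = 2" using assms by (simp add: at_child_def)
  let ?s1 = "tick (tick (tick (tick s)))"
  have s1: "env ?s1" "vars ?s1 vu = u" "vars ?s1 vv = v" "array ?s1 aA (forest_end ST (children (SP ! u)))"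
    using assms by (simp_all add: at_child_def env_def)
  have "wp levels_com (wp result_com (wp (vmode \<leftarrow> N 1) ?Q)) ?s1"
  proof (rule wp_levels[OF s1(1-3) assms(2,3) chain s1(4)])
    fix s2
    assume s2: "changes {vx, vq, vm} {aE} ?s1 s2"
      "\<forall>x < nT. is_level ST ((!) SP) v u {x} (arr s2 aE x)" "ticks s2 \<le> ticks ?s1 + 20 * (nT + 1)"
    have "env s2" "vars s2 vv = v" using s1 s2 by (auto simp: changes_def env_def)
    then show "wp result_com (wp (vmode \<leftarrow> N 1) ?Q) s2"
    proof (rule wp_result[OF _ _ assms(2) s2(2)])
      fix s3
      assume s3: "changes {vx} {aR} s2 s3" "array s3 aR (tree_end ST (SP ! v))"
        "ticks s3 \<le> ticks s2 + 20 * (nT + 1)"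
      have "env s3" "vars s3 vv = v" "keeps v s s3" "arr s3 aS = arr s aS"
        using s1 s2 s3 by (auto simp: changes_def env_def keeps_def)
      moreover have "ticks s3 \<le> ticks s + 4 + 40 * (nT + 1)" using s2(3) s3(3) by simp
      ultimately show "wp (vmode \<leftarrow> N 1) ?Q s3"
        using s3(2) by (simp add: small env_def keeps_def)
    qed
  qed
  moreover have "arr s aendP u = stop SP u" "u < M" using assms size_le by (auto simp: at_child_def env_def)
  ultimately show "wp body_com ?Q (tick s)"
    using assms(1) unfolding mode_cases(3)[OF mode] children_com_def by (simp add: at_child_def)
qed (use assms in \<open>simp add: at_child_def\<close>)

lemma round_light_child:
  assumes s: "at_child v u h c s" and u: "u < nP" and c: "c < stop SP u" "c \<noteq> h" "v < c"
    and A: "array s aA f" "end_function f"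
    and D: "\<forall>t < 2 * nT + 2. arr s aS t < D" "2 * D \<le> 2 ^ w"
  shows "\<exists>s'. main_round s s' \<and> env s' \<and> vars s' vmode = 0 \<and> vars s' vv = c \<and> arr s' aparent c = v \<and>
    stack s' (push_marks nT f (arr s aS)) \<and> written s' = written s \<and>
    (\<forall>i. i \<noteq> c \<longrightarrow> arr s' aparent i = arr s aparent i) \<and>
    arr s' abottom = arr s abottom \<and> arr s' aheavy = arr s aheavy"
proof (rule wp_round)
  let ?Q = "\<lambda>s'. ticks s' \<le> ticks s + 100 * (nT + 1) \<and> env s' \<and> vars s' vmode = 0 \<and> vars s' vv = c \<and>
    arr s' aparent c = v \<and> stack s' (push_marks nT f (arr s aS)) \<and> written s' = written s \<and>
    (\<forall>i. i \<noteq> c \<longrightarrow> arr s' aparent i = arr s aparent i) \<and>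
    arr s' abottom = arr s abottom \<and> arr s' aheavy = arr s aheavy"
  have mode: "vars (tick s) vmode = 2" using s by (simp add: at_child_def)
  let ?s1 = "tick (tick (tick (tick (tick s))))"
  have "wp (push_com aA) (wp (Write aparent (V vc) (V vv)) (wp (vv \<leftarrow> V vc) (wp (vmode \<leftarrow> N 0) ?Q))) ?s1"
  proof (rule wp_push)
    show "vars ?s1 vnT = nT" "aA \<noteq> aS" using s by (simp_all add: at_child_def env_def)
    show "mono_on {..nT} (arr ?s1 aA)" "\<forall>p \<le> nT. arr ?s1 aA p \<le> Suc nT" "arr ?s1 aA (Suc nT) = Suc nT"
      using array_end_function[of ?s1 aA f] A by simp_all
    show "\<forall>t < 2 * nT + 2. arr ?s1 aS t < D" "2 * D \<le> 2 ^ w" using D by simp_all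
    fix s2
    assume s2: "changes {vp, vt} {aS} ?s1 s2"
      "\<forall>t < 2 * nT + 2. arr s2 aS t = push_marks nT (arr ?s1 aA) (arr ?s1 aS) t"
      "ticks s2 \<le> ticks ?s1 + 20 * (nT + 1)"
    have "stack s2 (push_marks nT f (arr s aS))"
      using s2(2) array_end_function(4)[of ?s1 aA f] A by simp
    moreover have "env s2" "vars s2 vv = v" "vars s2 vc = c" "written s2 = written s"
      "arr s2 aparent = arr s aparent" "arr s2 abottom = arr s abottom" "arr s2 aheavy = arr s aheavy"
      using s s2 by (auto simp: changes_def at_child_def env_def)
    moreover have "c < M" using c stopP_le[OF u] size_le by linarith
    ultimately show "wp (Write aparent (V vc) (V vv)) (wp (vv \<leftarrow> V vc) (wp (vmode \<leftarrow> N 0) ?Q)) s2"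
      using s2(3) by (simp add: env_def)
  qed
  moreover have "arr s aendP u = stop SP u" "u < M" using s u size_le by (auto simp: at_child_def env_def)
  ultimately show "wp body_com ?Q (tick s)"
    using s c unfolding mode_cases(3)[OF mode] children_com_def by (simp add: at_child_def)
qed (use s in \<open>simp add: at_child_def\<close>)

text \<open>No pending result is in \<open>aR\<close> now, so the saved function \<open>g\<close> of
  \<open>h\<close> is unpacked there and applied after the composition \<open>f\<close> over the
  earlier siblings.\<close>

lemma round_heavy_child:
  assumes s: "at_child v u h h s" and u: "u < nP" and h: "h < stop SP u"
    and A: "array s aA f" "end_function f"
    and B: "stack s (push_marks nT g B)" "end_function g"
  shows "\<exists>s'. main_round s s' \<and> at_child v u h (stop SP h) s' \<and> array s' aA (\<lambda>p. g (f p)) \<and> stack s' B \<and>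
    written s' = written s \<and> arr s' aparent = arr s aparent \<and>
    arr s' abottom = arr s abottom \<and> arr s' aheavy = arr s aheavy"
proof (rule wp_round)
  let ?Q = "\<lambda>s'. ticks s' \<le> ticks s + 100 * (nT + 1) \<and> at_child v u h (stop SP h) s' \<and>
    array s' aA (\<lambda>p. g (f p)) \<and> stack s' B \<and> written s' = written s \<and> arr s' aparent = arr s aparent \<and>
    arr s' abottom = arr s abottom \<and> arr s' aheavy = arr s aheavy"
  have mode: "vars (tick s) vmode = 2" using s by (simp add: at_child_def)
  let ?s1 = "tick (tick (tick (tick (tick s))))"
  have "wp (pop_com aR) (wp compose_com (wp (vc \<leftarrow> Rd aendP (V vc)) ?Q)) ?s1"
  proof (rule wp_pop)
    show "vars ?s1 vnT = nT" "aR \<noteq> aS" using s by (simp_all add: at_child_def env_def)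
    show "mono_on {..nT} g" "\<forall>p \<le> nT. g p \<le> Suc nT"
      using B(2) by (auto simp: end_function_def mono_def intro!: mono_onI)
    show "stack ?s1 (push_marks nT g B)" using B(1) by simp
    fix s2
    assume s2: "changes {vp, vt} {aR, aS} ?s1 s2" "stack s2 B" "\<forall>p \<le> nT. arr s2 aR p = g p"
      "arr s2 aR (Suc nT) = Suc nT" "ticks s2 \<le> ticks ?s1 + 20 * (nT + 1)"
    have g: "array s2 aR g" using s2(3,4) B(2) by (auto simp: end_function_def le_Suc_eq le_antisym)
    have f: "array s2 aA f" using A(1) s2(1) by (auto simp: changes_def)
    show "wp compose_com (wp (vc \<leftarrow> Rd aendP (V vc)) ?Q) s2"
    proof (rule wp_compose)
      show "vars s2 vnT = nT" using s s2 by (auto simp: changes_def at_child_def env_def)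
      show "\<forall>p \<le> Suc nT. arr s2 aA p \<le> Suc nT" using f A(2) by (simp add: end_function_def)
      fix s3
      assume s3: "changes {vp} {aA} s2 s3" "array s3 aA (\<lambda>p. arr s2 aR (arr s2 aA p))"
        "ticks s3 \<le> ticks s2 + 20 * (nT + 1)"
      have "array s3 aA (\<lambda>p. g (f p))" using s3(2) f g A(2) by (simp add: end_function_def)
      moreover have "at_child v u h h s3" "stack s3 B" "written s3 = written s"
        "arr s3 aparent = arr s aparent" "arr s3 abottom = arr s abottom" "arr s3 aheavy = arr s aheavy"
        using s s2 s3 by (auto simp: changes_def at_child_def env_def)
      moreover have "h < nP" using h stopP_le[OF u] by linarith
      ultimately show "wp (vc \<leftarrow> Rd aendP (V vc)) ?Q s3"
        using s2(5) s3(3) size_le by (simp add: at_child_def env_def)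
    qed
  qed
  moreover have "arr s aendP u = stop SP u" "u < M" using s u size_le by (auto simp: at_child_def env_def)
  ultimately show "wp body_com ?Q (tick s)"
    using s h unfolding mode_cases(3)[OF mode] children_com_def by (simp add: at_child_def)
qed (use s in \<open>simp add: at_child_def\<close>)

lemma round_return_heavy:
  assumes s: "env s" "vars s vmode = 1" "vars s vv = h" "0 < h" "h < nP" "v < nP" "u < nP"
    and p: "arr s aparent h = v" "arr s abottom v = u" "arr s aheavy v = h"
    and R: "array s aR f" "end_function f"
    and D: "\<forall>t < 2 * nT + 2. arr s aS t < D" "2 * D \<le> 2 ^ w"
  shows "\<exists>s'. main_round s s' \<and> at_child v u h (Suc u) s' \<and> array s' aA (\<lambda>p. p) \<and>
    stack s' (push_marks nT f (arr s aS)) \<and> written s' = written s \<and> arr s' aparent = arr s aparent \<and>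
    arr s' abottom = arr s abottom \<and> arr s' aheavy = arr s aheavy"
proof (rule wp_round)
  let ?Q = "\<lambda>s'. ticks s' \<le> ticks s + 100 * (nT + 1) \<and> at_child v u h (Suc u) s' \<and> array s' aA (\<lambda>p. p) \<and>
    stack s' (push_marks nT f (arr s aS)) \<and> written s' = written s \<and> arr s' aparent = arr s aparent \<and>
    arr s' abottom = arr s abottom \<and> arr s' aheavy = arr s aheavy"
  have mode: "vars (tick s) vmode = 1" using s by simp
  have bounds: "h < M" "v < M" "Suc u < 2 ^ w" "2 < (2 :: nat) ^ w" "1 < (2 :: nat) ^ w"
    using s size_le by (auto intro!: small)
  have "wp (push_com aR) (wp ident_com (wp (vc \<leftarrow> V vu \<oplus> N 1) ?Q)) s1"
    if s1: "arr s1 = arr s" "written s1 = written s" "ticks s1 \<le> ticks s + 20"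
      "at_child v u h h s1" for s1
  proof (rule wp_push)
    show "vars s1 vnT = nT" "aR \<noteq> aS" using s1 by (simp_all add: at_child_def env_def)
    show "mono_on {..nT} (arr s1 aR)" "\<forall>p \<le> nT. arr s1 aR p \<le> Suc nT" "arr s1 aR (Suc nT) = Suc nT"
      using array_end_function[of s1 aR f] R s1 by simp_all
    show "\<forall>t < 2 * nT + 2. arr s1 aS t < D" "2 * D \<le> 2 ^ w" using D s1 by simp_all
    fix s2
    assume s2: "changes {vp, vt} {aS} s1 s2"
      "\<forall>t < 2 * nT + 2. arr s2 aS t = push_marks nT (arr s1 aR) (arr s1 aS) t"
      "ticks s2 \<le> ticks s1 + 20 * (nT + 1)"
    have stack: "stack s2 (push_marks nT f (arr s aS))"
      using s2(2) array_end_function(4)[of s1 aR f] R s1 by simp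
    show "wp ident_com (wp (vc \<leftarrow> V vu \<oplus> N 1) ?Q) s2"
    proof (rule wp_ident)
      show "vars s2 vnT = nT" using s1 s2 by (auto simp: changes_def at_child_def env_def)
      fix s3
      assume s3: "changes {vp} {aA} s2 s3" "array s3 aA (\<lambda>p. p)" "ticks s3 \<le> ticks s2 + 20 * (nT + 1)"
      have "at_child v u h h s3" "written s3 = written s" "stack s3 (push_marks nT f (arr s aS))"
        "arr s3 aparent = arr s aparent" "arr s3 abottom = arr s abottom" "arr s3 aheavy = arr s aheavy"
        using s1 s2 s3 stack by (auto simp: changes_def at_child_def env_def)
      moreover have "ticks s3 \<le> ticks s + 20 + 40 * (nT + 1)" using s1 s2(3) s3(3) by simp
      ultimately show "wp (vc \<leftarrow> V vu \<oplus> N 1) ?Q s3"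
        using s3(2) bounds by (simp add: at_child_def env_def)
    qed
  qed
  then show "wp body_com ?Q (tick s)"
    using s p bounds unfolding mode_cases(2)[OF mode] return_com_def
    by (simp add: at_child_def env_def)
qed (use s in simp)

lemma round_return_light:
  assumes s: "env s" "vars s vmode = 1" "vars s vv = c" "0 < c" "c < nP" "v < nP" "u < nP"
    and p: "arr s aparent c = v" "arr s abottom v = u" "arr s aheavy v = h" "c \<noteq> h"
    and R: "array s aR g" "end_function g"
    and B: "stack s (push_marks nT f B)" "end_function f"
  shows "\<exists>s'. main_round s s' \<and> at_child v u h (stop SP c) s' \<and> array s' aA (\<lambda>p. g (f p)) \<and> stack s' B \<and>
    written s' = written s \<and> arr s' aparent = arr s aparent \<and>
    arr s' abottom = arr s abottom \<and> arr s' aheavy = arr s aheavy"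
proof (rule wp_round)
  let ?Q = "\<lambda>s'. ticks s' \<le> ticks s + 100 * (nT + 1) \<and> at_child v u h (stop SP c) s' \<and>
    array s' aA (\<lambda>p. g (f p)) \<and> stack s' B \<and> written s' = written s \<and> arr s' aparent = arr s aparent \<and>
    arr s' abottom = arr s abottom \<and> arr s' aheavy = arr s aheavy"
  have mode: "vars (tick s) vmode = 1" using s by simp
  have bounds: "c < M" "v < M" "Suc u < 2 ^ w" "2 < (2 :: nat) ^ w" "1 < (2 :: nat) ^ w"
    using s size_le by (auto intro!: small)
  have "wp (pop_com aA) (wp compose_com (wp (vc \<leftarrow> Rd aendP (V vc)) ?Q)) s1"
    if s1: "arr s1 = arr s" "written s1 = written s" "ticks s1 \<le> ticks s + 20"
      "at_child v u h c s1" for s1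
  proof (rule wp_pop)
    show "vars s1 vnT = nT" "aA \<noteq> aS" using s1 by (simp_all add: at_child_def env_def)
    show "mono_on {..nT} f" "\<forall>p \<le> nT. f p \<le> Suc nT"
      using B(2) by (auto simp: end_function_def mono_def intro!: mono_onI)
    show "stack s1 (push_marks nT f B)" using B(1) s1 by simp
    fix s2
    assume s2: "changes {vp, vt} {aA, aS} s1 s2" "stack s2 B" "\<forall>p \<le> nT. arr s2 aA p = f p"
      "arr s2 aA (Suc nT) = Suc nT" "ticks s2 \<le> ticks s1 + 20 * (nT + 1)"
    have f: "array s2 aA f" using s2(3,4) B(2) by (auto simp: end_function_def le_Suc_eq le_antisym)
    have g: "array s2 aR g" using R(1) s1 s2(1) by (auto simp: changes_def)
    show "wp compose_com (wp (vc \<leftarrow> Rd aendP (V vc)) ?Q) s2"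
    proof (rule wp_compose)
      show "vars s2 vnT = nT" using s1 s2 by (auto simp: changes_def at_child_def env_def)
      show "\<forall>p \<le> Suc nT. arr s2 aA p \<le> Suc nT" using f B(2) by (simp add: end_function_def)
      fix s3
      assume s3: "changes {vp} {aA} s2 s3" "array s3 aA (\<lambda>p. arr s2 aR (arr s2 aA p))"
        "ticks s3 \<le> ticks s2 + 20 * (nT + 1)"
      have "array s3 aA (\<lambda>p. g (f p))" using s3(2) f g B(2) by (simp add: end_function_def)
      moreover have "at_child v u h c s3" "stack s3 B" "written s3 = written s"
        "arr s3 aparent = arr s aparent" "arr s3 abottom = arr s abottom" "arr s3 aheavy = arr s aheavy"
        using s1 s2 s3 by (auto simp: changes_def at_child_def env_def)
      moreover have "ticks s3 \<le> ticks s + 20 + 40 * (nT + 1)" using s1 s2(5) s3(3) by simp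
      ultimately show "wp (vc \<leftarrow> Rd aendP (V vc)) ?Q s3"
        using s(5) size_le by (simp add: at_child_def env_def)
    qed
  qed
  then show "wp body_com ?Q (tick s)"
    using s p bounds unfolding mode_cases(2)[OF mode] return_com_def
    by (simp add: at_child_def env_def)
qed (use s in simp)

lemma round_return_root:
  assumes "vars s vmode = 1" "vars s vv = 0"
  shows "\<exists>s'. main_round s s' \<and> vars s' vmode = 3 \<and> (\<forall>y. y \<noteq> vmode \<longrightarrow> vars s' y = vars s y) \<and>
    arr s' = arr s \<and> written s' = written s"
proof (rule wp_round)
  have mode: "vars (tick s) vmode = 1" using assms by simp
  show "wp body_com (\<lambda>s'. ticks s' \<le> ticks s + 100 * (nT + 1) \<and> vars s' vmode = 3 \<and>
      (\<forall>y. y \<noteq> vmode \<longrightarrow> vars s' y = vars s y) \<and> arr s' = arr s \<and> written s' = written s) (tick s)"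
    using assms unfolding mode_cases(2)[OF mode] return_com_def by (simp add: small)
qed (use assms in simp)

end

lemma num_leaves_pos [simp]: "0 < num_leaves t"
proof (induction t)
  case (Node a ts)
  then show ?case by (cases ts) auto
qed

context inclusion_problem
begin

section \<open>Induction over the pattern: rounds and stack words of a call\<close>

lemma keeps_refl: "keeps v s s"
  by (simp add: keeps_def)

lemma keeps_trans: "keeps v s s' \<Longrightarrow> keeps v s' s'' \<Longrightarrow> keeps v s s''"
  by (simp add: keeps_def)

lemma keeps_mono:
  assumes "keeps c s s'" "v < c" "stop SP c \<le> stop SP v"
  shows "keeps v s s'"
  using assms unfolding keeps_def by (meson le_trans less_trans order.strict_implies_order)

text \<open>In \<open>4 * D * (num_nodes (SP ! v))\<^sup>2\<close>, halving the size gains a factor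
  \<open>4\<close>, which pays for the two bits that a light child may find added to each word. The
  slack \<open>6\<close> in the count of rounds is the credit left to the parent; a chain ending in
  a leaf takes two rounds, well within \<open>12 - 6\<close>.\<close>

definition call_spec :: "nat \<Rightarrow> bool" where
  "call_spec v \<longleftrightarrow> (\<forall>s D. env s \<and> vars s vmode = 0 \<and> vars s vv = v \<and>
    (\<forall>t < 2 * nT + 2. arr s aS t < D) \<and> 4 * D * (num_nodes (SP ! v))\<^sup>2 \<le> 2 ^ w \<longrightarrow>
    (\<exists>k s'. (main_round ^^ k) s s' \<and> k + 6 \<le> 12 * num_leaves (SP ! v) \<and> env s' \<and> vars s' vmode = 1 \<and>
      vars s' vv = v \<and> array s' aR (tree_end ST (SP ! v)) \<and> stack s' (arr s aS) \<and> keeps v s s'))"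

lemma call_specD:
  assumes "call_spec v" "env s" "vars s vmode = 0" "vars s vv = v"
    "\<forall>t < 2 * nT + 2. arr s aS t < D" "4 * D * (num_nodes (SP ! v))\<^sup>2 \<le> 2 ^ w"
  obtains k s' where "(main_round ^^ k) s s'" "k + 6 \<le> 12 * num_leaves (SP ! v)" "env s'" "vars s' vmode = 1"
    "vars s' vv = v" "array s' aR (tree_end ST (SP ! v))" "stack s' (arr s aS)" "keeps v s s'"
  using assms unfolding call_spec_def by blast

lemma push_marks_less: "B t < D \<Longrightarrow> push_marks n f B t < 2 * D"
  by (simp add: push_marks_def)

lemma rounds_step: "main_round s s' \<Longrightarrow> (main_round ^^ k) s' s'' \<Longrightarrow> (main_round ^^ (1 + k)) s s''"
  using relpowp_Suc_I2[of main_round s s' k s''] by simp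

lemma rounds_trans: "(main_round ^^ k) s s' \<Longrightarrow> (main_round ^^ l) s' s'' \<Longrightarrow> (main_round ^^ (k + l)) s s''"
  by (auto simp: relpowp_add)

text \<open>The segment \<open>gs\<close> avoids \<open>h\<close>, so the statement serves the
  children on both sides of it; on the left, \<open>D\<close> already includes the bit for
  \<open>h\<close>. A light child adds two rounds to those of its call, and \<open>4\<close> of its
  credit of \<open>6\<close> remain.\<close>

lemma light_children:
  assumes spec: "\<And>x. x < nP \<Longrightarrow> num_nodes (SP ! x) < num_nodes (SP ! v) \<Longrightarrow> call_spec x"
    and v: "v \<le> u" "u < nP" "stop SP u = stop SP v"
  shows "fpath SP c gs c' \<Longrightarrow> u < c \<Longrightarrow> c' \<le> stop SP u \<Longrightarrow>
    \<forall>g \<in> set gs. 2 * num_nodes g \<le> num_nodes (SP ! v) \<Longrightarrow> h < c \<or> c' \<le> h \<Longrightarrow>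
    at_child v u h c s \<Longrightarrow> array s aA (forest_end ST ds) \<Longrightarrow> arr s abottom v = u \<Longrightarrow> arr s aheavy v = h \<Longrightarrow>
    \<forall>t < 2 * nT + 2. arr s aS t < D \<Longrightarrow> 2 * D * (num_nodes (SP ! v))\<^sup>2 \<le> 2 ^ w \<Longrightarrow>
    \<exists>k s'. (main_round ^^ k) s s' \<and> k + 4 * length gs \<le> 12 * sum_list (map num_leaves gs) \<and>
      at_child v u h c' s' \<and> array s' aA (forest_end ST (ds @ gs)) \<and> stack s' (arr s aS) \<and> keeps v s s' \<and>
      arr s' abottom v = u \<and> arr s' aheavy v = h"
proof (induction gs arbitrary: c ds s)
  case Nil
  then show ?case using keeps_refl by (intro exI[of _ 0] exI[of _ s]) simp
next
  case (Cons g gs)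
  have c: "c < nP" "SP ! c = g" "fpath SP (stop SP c) gs c'" using Cons.prems(1) by auto
  have stop: "stop SP c \<le> c'" using fpath_le[OF c(3)] .
  have lt: "c < stop SP c" by simp
  have ch: "c \<noteq> h" using Cons.prems(5) stop lt by linarith
  have vc: "v < c" "0 < c" using v(1) Cons.prems(2) by linarith+
  have stop_v: "stop SP c \<le> stop SP v" using stop Cons.prems(3) v(3) by linarith
  have N: "1 \<le> (num_nodes (SP ! v))\<^sup>2" by (simp add: Suc_le_eq)
  have D: "2 * D \<le> 2 ^ w" using mult_le_mono2[OF N, of "2 * D"] Cons.prems(11) by linarith
  have light: "2 * num_nodes (SP ! c) \<le> num_nodes (SP ! v)" using Cons.prems(4) c(2) by simp
  let ?f = "forest_end ST ds"
  have cu: "c < stop SP u" using stop lt Cons.prems(3) by linarith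
  obtain s1 where s1: "main_round s s1" "env s1" "vars s1 vmode = 0" "vars s1 vv = c" "arr s1 aparent c = v"
    "stack s1 (push_marks nT ?f (arr s aS))" "written s1 = written s"
    "\<forall>i. i \<noteq> c \<longrightarrow> arr s1 aparent i = arr s aparent i"
    "arr s1 abottom = arr s abottom" "arr s1 aheavy = arr s aheavy"
    using round_light_child[OF Cons.prems(6) v(2) cu ch vc(1) Cons.prems(7) end_function_forest_end
        Cons.prems(10) D] by blast
  have spec_c: "call_spec c" using light c(1) num_nodes_pos[of "SP ! c"] by (intro spec) (simp_all del: num_nodes_pos)
  have D1: "\<forall>t < 2 * nT + 2. arr s1 aS t < 2 * D" using s1(6) Cons.prems(10) push_marks_less by simp
  \<comment> \<open>After the push of \<open>A\<close> the bound is \<open>2 * D\<close>; the factor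
    \<open>4\<close> is moved into the square, where it is absorbed because twice the size of the
    child is at most that of \<open>v\<close>.\<close>
  have D2: "4 * (2 * D) * (num_nodes (SP ! c))\<^sup>2 \<le> 2 ^ w"
  proof -
    have "(2 * num_nodes (SP ! c))\<^sup>2 \<le> (num_nodes (SP ! v))\<^sup>2" using light by (rule power_mono) simp
    then have "2 * D * (2 * num_nodes (SP ! c))\<^sup>2 \<le> 2 * D * (num_nodes (SP ! v))\<^sup>2" by (rule mult_le_mono2)
    moreover have "4 * (2 * D) * (num_nodes (SP ! c))\<^sup>2 = 2 * D * (2 * num_nodes (SP ! c))\<^sup>2"
      by (simp add: power2_eq_square)
    ultimately show ?thesis using Cons.prems(11) by linarith
  qed
  obtain k s2 where s2: "(main_round ^^ k) s1 s2" "k + 6 \<le> 12 * num_leaves (SP ! c)" "env s2"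
    "vars s2 vmode = 1" "vars s2 vv = c" "array s2 aR (tree_end ST (SP ! c))" "stack s2 (arr s1 aS)"
    "keeps c s1 s2"
    by (rule call_specD[OF spec_c s1(2-4) D1 D2])
  have control: "arr s2 aparent c = v" "arr s2 abottom v = u" "arr s2 aheavy v = h"
    using s2(8) s1 vc Cons.prems(8,9) by (simp_all add: keeps_def)
  have "stack s2 (push_marks nT ?f (arr s aS))" using s2(7) s1(6) by simp
  from round_return_light[OF s2(3-5) vc(2) c(1) _ v(2) control ch s2(6) end_function_tree_end this end_function_forest_end]
  obtain s3 where s3: "main_round s2 s3" "at_child v u h (stop SP c) s3"
    "array s3 aA (\<lambda>p. tree_end ST (SP ! c) (?f p))" "stack s3 (arr s aS)" "written s3 = written s2"
    "arr s3 aparent = arr s2 aparent" "arr s3 abottom = arr s2 abottom" "arr s3 aheavy = arr s2 aheavy"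
    using vc(1) c(1) by auto
  have A3: "array s3 aA (forest_end ST (ds @ [g]))" using s3(3) c(2) by simp
  have control3: "arr s3 abottom v = u" "arr s3 aheavy v = h" using s3 control by simp_all
  have D3: "\<forall>t < 2 * nT + 2. arr s3 aS t < D" using s3(4) Cons.prems(10) by simp
  have uc: "u < stop SP c" using Cons.prems(2) lt by linarith
  have hc: "h < stop SP c \<or> c' \<le> h" using Cons.prems(5) lt by linarith
  have light': "\<forall>g \<in> set gs. 2 * num_nodes g \<le> num_nodes (SP ! v)" using Cons.prems(4) by simp
  obtain k' s4 where s4: "(main_round ^^ k') s3 s4"
    "k' + 4 * length gs \<le> 12 * sum_list (map num_leaves gs)" "at_child v u h c' s4"
    "array s4 aA (forest_end ST ((ds @ [g]) @ gs))" "stack s4 (arr s3 aS)" "keeps v s3 s4"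
    "arr s4 abottom v = u" "arr s4 aheavy v = h"
    using Cons.IH[OF c(3) uc Cons.prems(3) light' hc s3(2) A3 control3 D3 Cons.prems(11)] by blast
  have "(main_round ^^ (1 + (k + (1 + k')))) s s4"
    by (rule rounds_step[OF s1(1) rounds_trans[OF s2(1) rounds_step[OF s3(1) s4(1)]]])
  moreover have "c < stop SP v" using lt stop_v by linarith
  then have "keeps v s s1" using s1(7-10) vc by (auto simp: keeps_def)
  then have "keeps v s s4"
    using keeps_mono[OF s2(8) vc(1) stop_v] s3(5-8) s4(6) by (simp add: keeps_def)
  moreover have "stack s4 (arr s aS)" using s4(5) s3(4) by simp
  moreover have "1 + (k + (1 + k')) + 4 * length (g # gs) \<le> 12 * sum_list (map num_leaves (g # gs))"
    using s2(2) s4(2) c(2) by simp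
  ultimately show ?case using s4 by (intro exI[of _ "1 + (k + (1 + k'))"] exI[of _ s4]) simp
qed


lemma call_correct: "v < nP \<Longrightarrow> call_spec v"
proof (induction v rule: measure_induct_rule[where f = "\<lambda>v. num_nodes (SP ! v)"])
  case (less v)
  let ?f = "\<lambda>v. tree_end ST (SP ! v)"
  have "\<exists>k s'. (main_round ^^ k) s s' \<and> k + 6 \<le> 12 * num_leaves (SP ! v) \<and> env s' \<and> vars s' vmode = 1 \<and>
      vars s' vv = v \<and> array s' aR (?f v) \<and> stack s' (arr s aS) \<and> keeps v s s'"
    if s: "env s" "vars s vmode = 0" "vars s vv = v"
      and D: "\<forall>t < 2 * nT + 2. arr s aS t < D" "4 * D * (num_nodes (SP ! v))\<^sup>2 \<le> 2 ^ w" for s D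
  proof -
    define post where "post s' \<longleftrightarrow> env s' \<and> vars s' vmode = 1 \<and>
      vars s' vv = v \<and> array s' aR (?f v) \<and> stack s' (arr s aS) \<and> keeps v s s'" for s'
    \<comment> \<open>\<open>7\<close> instead of \<open>6\<close>: the round of the call itself is
      counted separately.\<close>
    define rest where "rest s1 \<longleftrightarrow>
      (\<exists>k s'. (main_round ^^ k) s1 s' \<and> k + 7 \<le> 12 * num_leaves (SP ! v) \<and> post s')" for s1
    have "\<exists>s1. main_round s s1 \<and> rest s1"
    proof (rule round_call[OF s less.prems])
      fix s1 u
      assume s1: "env s1" "vars s1 vmode = 2" "vars s1 vv = v" "vars s1 vu = u" "vars s1 vc = stop SP u"
        and u: "v \<le> u" "u < nP" "stop SP u = stop SP v"
        and chain: "\<forall>j. v \<le> j \<and> j < u \<longrightarrow> children (SP ! j) = [SP ! Suc j]"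
        and leaf: "children (SP ! u) = []"
        and A: "array s1 aA (\<lambda>p. p)" "arr s1 aS = arr s aS" "keeps v s s1"
      have at: "at_child v u (vars s1 vh) (stop SP u) s1" using s1 by (simp add: at_child_def)
      have A': "array s1 aA (forest_end ST (children (SP ! u)))" using A(1) leaf by simp
      obtain s2 where s2: "main_round s1 s2" "env s2" "vars s2 vmode = 1" "vars s2 vv = v"
        "array s2 aR (?f v)" "arr s2 aS = arr s1 aS" "keeps v s1 s2"
        using round_finish[OF at u(1,2) chain A'] by blast
      have "post s2" using s2 A(2) keeps_trans[OF A(3) s2(7)] by (simp add: post_def)
      moreover have "(main_round ^^ 1) s1 s2" using s2(1) by (simp only: relpowp_1)
      moreover have "1 + 7 \<le> 12 * num_leaves (SP ! v)" using num_leaves_pos[of "SP ! v"] by linarith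
      ultimately show "rest s1" unfolding rest_def by blast
    next
      fix s1 u ds h es
      assume s1: "env s1" "vars s1 vmode = 0" "vars s1 vv = h"
        and u: "v \<le> u" "u < nP" "stop SP u = stop SP v"
        and chain: "\<forall>j. v \<le> j \<and> j < u \<longrightarrow> children (SP ! j) = [SP ! Suc j]"
        and branching: "2 \<le> length (children (SP ! u))"
        and leaves: "num_leaves (SP ! u) = num_leaves (SP ! v)"
        and split: "children (SP ! u) = ds @ SP ! h # es" "fpath SP (Suc u) ds h"
        and heavy: "\<forall>g \<in> set (children (SP ! u)). num_nodes g \<le> num_nodes (SP ! h)"
        and control: "arr s1 abottom v = u" "arr s1 aheavy v = h" "arr s1 aparent h = v"
        and S1: "arr s1 aS = arr s aS" and keeps1: "keeps v s s1"
      let ?N = "num_nodes (SP ! v)"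
      have path: "fpath SP (Suc u) (children (SP ! u)) (stop SP u)" "stop SP u \<le> nP"
        using preP u(2) by (auto simp: preorder_list_def)
      then obtain r where "fpath SP (Suc u) ds r" "fpath SP r (SP ! h # es) (stop SP u)"
        using split(1) by (auto simp: fpath_append)
      then have h: "h < nP" "fpath SP (stop SP h) es (stop SP u)"
        using fpath_size[of SP "Suc u" ds] split(2) by auto
      have uh: "Suc u \<le> h" using fpath_le[OF split(2)] .
      have hu: "stop SP h \<le> stop SP u" using fpath_le[OF h(2)] .
      have lt: "h < stop SP h" by simp
      have vh: "v < h" "0 < h" using u(1) uh by linarith+
      have size: "num_nodes (SP ! u) = Suc (forest_size (children (SP ! u)))" by (cases "SP ! u") simp
      have size_uv: "num_nodes (SP ! u) \<le> ?N" using u by linarith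
      have size_h: "num_nodes (SP ! h) < ?N" using size size_uv split(1) by simp
      \<comment> \<open>Such a child is no larger than \<open>h\<close>, and together with
        \<open>h\<close> it fits into the subtree of \<open>u\<close>, so it has at most half the
        size.\<close>
      have light: "2 * num_nodes g \<le> ?N" if "g \<in> set ds \<union> set es" for g
      proof -
        have "num_nodes g \<le> forest_size ds + forest_size es"
          using that member_le_sum_list[of "num_nodes g" "map num_nodes ds"]
            member_le_sum_list[of "num_nodes g" "map num_nodes es"] by fastforce
        moreover have "num_nodes g \<le> num_nodes (SP ! h)" using heavy that split(1) by auto
        moreover have "forest_size (children (SP ! u)) = forest_size ds + num_nodes (SP ! h) + forest_size es"
          using split(1) by simp
        ultimately show ?thesis using size size_uv by linarith
      qed
      have N: "1 \<le> ?N\<^sup>2" by (simp add: Suc_le_eq)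
      have D2: "2 * D \<le> 2 ^ w" using mult_le_mono2[OF N, of "4 * D"] D(2) by linarith
      have Dh: "4 * D * (num_nodes (SP ! h))\<^sup>2 \<le> 2 ^ w"
      proof -
        have "(num_nodes (SP ! h))\<^sup>2 \<le> ?N\<^sup>2" using size_h by (intro power_mono) simp_all
        then have "4 * D * (num_nodes (SP ! h))\<^sup>2 \<le> 4 * D * ?N\<^sup>2" by (rule mult_le_mono2)
        then show ?thesis using D(2) by linarith
      qed
      have spec: "\<And>x. x < nP \<Longrightarrow> num_nodes (SP ! x) < ?N \<Longrightarrow> call_spec x" using less.IH by blast
      have D1: "\<forall>t < 2 * nT + 2. arr s1 aS t < D" using D(1) S1 by simp
      obtain k1 s2 where s2: "(main_round ^^ k1) s1 s2" "k1 + 6 \<le> 12 * num_leaves (SP ! h)" "env s2"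
        "vars s2 vmode = 1" "vars s2 vv = h" "array s2 aR (?f h)" "stack s2 (arr s1 aS)" "keeps h s1 s2"
        by (rule call_specD[OF spec[OF h(1) size_h] s1 D1 Dh])
      have control2: "arr s2 aparent h = v" "arr s2 abottom v = u" "arr s2 aheavy v = h"
        using s2(8) vh control by (simp_all add: keeps_def)
      have stack2: "stack s2 (arr s aS)" using s2(7) S1 by simp
      have D2': "\<forall>t < 2 * nT + 2. arr s2 aS t < D" using stack2 D(1) by simp
      have keeps2: "keeps v s s2"
        using keeps_trans[OF keeps1 keeps_mono[OF s2(8) vh(1)]] hu u(3) by simp
      obtain s3 where s3: "main_round s2 s3" "at_child v u h (Suc u) s3" "array s3 aA (\<lambda>p. p)"
        "stack s3 (push_marks nT (?f h) (arr s2 aS))" "written s3 = written s2"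
        "arr s3 aparent = arr s2 aparent" "arr s3 abottom = arr s2 abottom" "arr s3 aheavy = arr s2 aheavy"
        using round_return_heavy[OF s2(3-5) vh(2) h(1) less.prems u(2) control2 s2(6) end_function_tree_end D2' D2]
        by blast
      have A3: "array s3 aA (forest_end ST [])" using s3(3) by simp
      have control3: "arr s3 abottom v = u" "arr s3 aheavy v = h" using s3 control2 by simp_all
      \<comment> \<open>The function of \<open>h\<close> now occupies the lowest bit of every stack
        word, which doubles the bound for the children to its left.\<close>
      have D3: "\<forall>t < 2 * nT + 2. arr s3 aS t < 2 * D" using s3(4) D2' push_marks_less by simp
      have D3': "2 * (2 * D) * ?N\<^sup>2 \<le> 2 ^ w" using D(2) by simp
      have light_ds: "\<forall>g \<in> set ds. 2 * num_nodes g \<le> ?N" using light by blast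
      have "h \<le> stop SP u" using hu lt by linarith
      obtain k2 s4 where s4: "(main_round ^^ k2) s3 s4" "k2 + 4 * length ds \<le> 12 * sum_list (map num_leaves ds)"
        "at_child v u h h s4" "array s4 aA (forest_end ST ([] @ ds))" "stack s4 (arr s3 aS)" "keeps v s3 s4"
        "arr s4 abottom v = u" "arr s4 aheavy v = h"
        using light_children[OF spec u split(2) lessI \<open>h \<le> stop SP u\<close> light_ds disjI2[OF order_refl]
            s3(2) A3 control3 D3 D3'] by blast
      have A4: "array s4 aA (forest_end ST ds)" using s4(4) by simp
      have S4: "stack s4 (push_marks nT (?f h) (arr s2 aS))" using s4(5) s3(4) by simp
      have "h < stop SP u" using hu lt by linarith
      obtain s5 where s5: "main_round s4 s5" "at_child v u h (stop SP h) s5"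
        "array s5 aA (\<lambda>p. ?f h (forest_end ST ds p))" "stack s5 (arr s2 aS)" "written s5 = written s4"
        "arr s5 aparent = arr s4 aparent" "arr s5 abottom = arr s4 abottom" "arr s5 aheavy = arr s4 aheavy"
        using round_heavy_child[OF s4(3) u(2) \<open>h < stop SP u\<close> A4 end_function_forest_end S4 end_function_tree_end]
        by blast
      have A5: "array s5 aA (forest_end ST (ds @ [SP ! h]))" using s5(3) by simp
      have control5: "arr s5 abottom v = u" "arr s5 aheavy v = h" using s5 s4 by simp_all
      \<comment> \<open>The function of \<open>h\<close> has been popped; the children to its right
        work with the original bound.\<close>
      have D5: "\<forall>t < 2 * nT + 2. arr s5 aS t < D" using s5(4) D2' by simp
      have D5': "2 * D * ?N\<^sup>2 \<le> 2 ^ w" using D(2) by simp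
      have light_es: "\<forall>g \<in> set es. 2 * num_nodes g \<le> ?N" using light by blast
      have "u < stop SP h" using uh lt by linarith
      obtain k3 s6 where s6: "(main_round ^^ k3) s5 s6" "k3 + 4 * length es \<le> 12 * sum_list (map num_leaves es)"
        "at_child v u h (stop SP u) s6" "array s6 aA (forest_end ST ((ds @ [SP ! h]) @ es))"
        "stack s6 (arr s5 aS)" "keeps v s5 s6"
        using light_children[OF spec u h(2) \<open>u < stop SP h\<close> order_refl light_es disjI1[OF lt]
            s5(2) A5 control5 D5 D5'] by blast
      have A6: "array s6 aA (forest_end ST (children (SP ! u)))" using s6(4) split(1) by simp
      obtain s7 where s7: "main_round s6 s7" "env s7" "vars s7 vmode = 1" "vars s7 vv = v"
        "array s7 aR (?f v)" "arr s7 aS = arr s6 aS" "keeps v s6 s7"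
        using round_finish[OF s6(3) u(1,2) chain A6] by blast
      have "keeps v s2 s3" "keeps v s4 s5" using s3(5-8) s5(5-8) by (simp_all add: keeps_def)
      then have "keeps v s s7"
        using keeps2 s4(6) s6(6) s7(7) keeps_trans by blast
      moreover have "stack s7 (arr s aS)" using s7(6) s6(5) s5(4) stack2 by simp
      ultimately have "post s7" using s7 by (simp add: post_def)
      moreover have "(main_round ^^ (k1 + (1 + (k2 + (1 + (k3 + 1)))))) s1 s7"
      proof -
        have "(main_round ^^ 1) s6 s7" using s7(1) by (simp only: relpowp_1)
        then show ?thesis
          using rounds_trans[OF s2(1) rounds_step[OF s3(1) rounds_trans[OF s4(1) rounds_step[OF s5(1) rounds_trans[OF s6(1)]]]]]
          by blast
      qed
      \<comment> \<open>Three own rounds and the \<open>7\<close> of \<open>rest\<close> make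
        \<open>10\<close>. This is covered exactly by the credit \<open>6\<close> of
        \<open>h\<close> and at least \<open>4\<close> from the light children, of which there is at
        least one.\<close>
      moreover have "k1 + (1 + (k2 + (1 + (k3 + 1)))) + 7 \<le> 12 * num_leaves (SP ! v)"
      proof -
        have "num_leaves (SP ! u) = sum_list (map num_leaves (children (SP ! u)))"
          using split(1) by (cases "SP ! u") auto
        then have "num_leaves (SP ! v) = sum_list (map num_leaves ds) + num_leaves (SP ! h) + sum_list (map num_leaves es)"
          using leaves split(1) by simp
        moreover have "1 \<le> length ds + length es" using branching split(1) by simp
        ultimately show ?thesis using s2(2) s4(2) s6(2) by linarith
      qed
      ultimately show "rest s1" unfolding rest_def by blast
    qed
    then obtain s1 k s' where 1: "main_round s s1" "(main_round ^^ k) s1 s'" "k + 7 \<le> 12 * num_leaves (SP ! v)" "post s'"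
      unfolding rest_def by blast
    moreover have "(main_round ^^ (1 + k)) s s'" using rounds_step[OF 1(1,2)] .
    moreover have "1 + k + 6 \<le> 12 * num_leaves (SP ! v)" using 1(3) by linarith
    ultimately show ?thesis unfolding post_def by blast
  qed
  then show ?case unfolding call_spec_def by blast
qed

end

section \<open>Output, initialisation and total running time\<close>

definition "output_com =
  If (Less (Rd aR (N 0)) (V vnT \<oplus> N 1))
    (Emit (N 1);;
     vx \<leftarrow> N 0;;
     While (Less (V vx) (V vnT)) (
       If (Less (Rd aendT (V vx)) (Rd aR (V vx)))
         (vx \<leftarrow> V vx)
         (Emit (V vx));;
       incr vx))
    (Emit (N 0))"

definition "main_com =
  vnP \<leftarrow> In (N 0);;
  vnT \<leftarrow> In (N 1);;
  ends_com aendP vnP (N 3);;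
  ends_com aendT vnT (N 3 \<oplus> N 2 \<otimes> V vnP);;
  vv \<leftarrow> N 0;;
  vmode \<leftarrow> N 0;;
  While (Less (V vmode) (N 3)) body_com;;
  output_com"

context inclusion_problem
begin

lemma rounds_While:
  assumes "(main_round ^^ k) s s'" "vars s' vmode = 3"
  shows "exec (While (Less (V vmode) (N 3)) body_com) s (tick s') \<and> ticks s' \<le> ticks s + k * (100 * (nT + 1))"
  using assms(1)
proof (induction k arbitrary: s)
  case 0
  then show ?case using assms(2) by (auto simp: small intro!: exec_While_False)
next
  case (Suc k)
  then obtain s1 where s1: "main_round s s1" "(main_round ^^ k) s1 s'" using relpowp_Suc_D2 by metis
  have "exec (While (Less (V vmode) (N 3)) body_com) s (tick s')"
    using s1(1) Suc.IH[OF s1(2)] unfolding main_round_def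
    by (intro exec_While_True[of s _ _ s1]) (simp_all add: small)
  moreover have "ticks s' \<le> ticks s + Suc k * (100 * (nT + 1))"
    using s1(1) Suc.IH[OF s1(2)] unfolding main_round_def by simp
  ultimately show ?case by blast
qed

lemma wp_output:
  assumes "env s" "array s aR (tree_end ST P)" "written s = []"
    and Q: "\<And>s'. correct_answer P T (written s') \<Longrightarrow> ticks s' \<le> ticks s + 20 * (nT + 1) \<Longrightarrow> Q s'"
  shows "wp output_com Q s"
proof -
  have nT: "0 < nT" by simp
  have included: "P \<sqsubseteq> subtree_at T x \<longleftrightarrow> occurs ST P x" if "x < nT" for x
    using tree_included_iff_tree_end that .
  have root: "P \<sqsubseteq> T \<longleftrightarrow> tree_end ST P 0 \<le> nT"
    using included[OF nT] by (simp add: subtree_at_def)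
  have R0: "arr s aR 0 = tree_end ST P 0" and vnT: "vars s vnT = nT" using assms(1,2) by (simp_all add: env_def)
  show ?thesis
  proof (cases "P \<sqsubseteq> T")
    case False
    then show ?thesis using R0 vnT root unfolding output_com_def
      by (auto simp: small correct_answer_def assms(3) intro!: Q)
  next
    case True
    let ?I = "\<lambda>s'. vars s' vnT = nT \<and> arr s' = arr s \<and> vars s' vx \<le> nT \<and>
        written s' = 1 # filter (occurs ST P) [0..<vars s' vx] \<and> ticks s' \<le> ticks s + 3 + 4 * vars s' vx"
    have "wp (While (Less (V vx) (V vnT)) (
       If (Less (Rd aendT (V vx)) (Rd aR (V vx))) (vx \<leftarrow> V vx) (Emit (V vx));; incr vx)) Q s1"
      if "?I s1" for s1
    proof (rule wp_While[where I = ?I and measure = "\<lambda>s'. nT - vars s' vx"])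
      fix s2
      assume I: "?I s2" and guard: "bval s2 (Less (V vx) (V vnT))"
      have "arr s2 aendT (vars s2 vx) = stop ST (vars s2 vx)"
        "arr s2 aR (vars s2 vx) = tree_end ST P (vars s2 vx)"
        using I guard assms(1,2) by (auto simp: env_def)
      then show "wp (If (Less (Rd aendT (V vx)) (Rd aR (V vx))) (vx \<leftarrow> V vx) (Emit (V vx));; incr vx)
          (\<lambda>s'. ?I s' \<and> nT - vars s' vx < nT - vars s2 vx) (tick s2)"
        using I guard by (auto simp: incr_def small)
    next
      fix s2
      assume I: "?I s2" and "\<not> bval s2 (Less (V vx) (V vnT))"
      then have vx: "vars s2 vx = nT" by simp
      have "correct_answer P T (written s2)"
        using True I vx included by (auto simp: correct_answer_def intro!: exI[of _ "filter (occurs ST P) [0..<nT]"])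
      then show "Q (tick s2)" using I vx by (intro Q) auto
    qed (use that in auto)
    then show ?thesis using True R0 vnT root assms(3) unfolding output_com_def by (simp add: small)
  qed
qed

lemma wp_main:
  "wp main_com (\<lambda>s. correct_answer P T (written s) \<and> ticks s \<le> 4000 * (num_leaves P * nT)) (initial_state vs)"
proof -
  let ?Q = "\<lambda>s. correct_answer P T (written s) \<and> ticks s \<le> 4000 * (num_leaves P * nT)"
  let ?loop = "While (Less (V vmode) (N 3)) body_com"
  define n1 where "n1 = nT + 1"
  have final: "wp (vv \<leftarrow> N 0;; vmode \<leftarrow> N 0;; ?loop;; output_com) ?Q s"
    if s: "env s" "written s = []" "ticks s \<le> 2 + 40 * n1" "\<forall>t. arr s aS t = 0" for s
  proof -
    define s1 where "s1 = tick (tick (s\<lparr>vars := (vars s)(vv := 0, vmode := 0)\<rparr>))"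
    have s1: "env s1" "vars s1 vmode = 0" "vars s1 vv = 0" "\<forall>t < 2 * nT + 2. arr s1 aS t < 1"
      using s by (simp_all add: s1_def env_def)
    \<comment> \<open>The stacks are empty at the start, so the words are bounded by
      \<open>D = 1\<close>.\<close>
    have "4 * 1 * (num_nodes (SP ! 0))\<^sup>2 \<le> 2 ^ w"
    proof -
      have "4 * (nP * nP) \<le> 1000 * ((nT + 1) * (nT + 1))" using size_le by (intro mult_le_mono) auto
      then show ?thesis using word by (simp add: power2_eq_square algebra_simps)
    qed
    then obtain k s2 where s2: "(main_round ^^ k) s1 s2" "k + 6 \<le> 12 * num_leaves (SP ! 0)" "env s2"
      "vars s2 vmode = 1" "vars s2 vv = 0" "array s2 aR (tree_end ST (SP ! 0))" "keeps 0 s1 s2"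
      using call_specD[OF call_correct s1] num_nodes_pos by metis
    obtain s3 where s3: "main_round s2 s3" "vars s3 vmode = 3" "\<forall>y. y \<noteq> vmode \<longrightarrow> vars s3 y = vars s2 y"
      "arr s3 = arr s2" "written s3 = written s2"
      using round_return_root[OF s2(4,5)] by blast
    have "(main_round ^^ (k + 1)) s1 s3"
      using rounds_trans[OF s2(1), of 1 s3] s3(1) by (simp only: relpowp_1)
    note loop = rounds_While[OF this s3(2)]
    have t3: "ticks s3 \<le> 4 + 40 * n1 + (k + 1) * (100 * n1)"
      using loop s(3) by (simp add: s1_def n1_def)
    have "wp output_com ?Q (tick s3)"
    proof (rule wp_output)
      show "env (tick s3)" using s2(3) s3 by (simp add: env_def)
      show "array (tick s3) aR (tree_end ST P)" using s2(6) s3 by simp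
      show "written (tick s3) = []" using s2(7) s3 s(2) by (simp add: keeps_def s1_def)
      fix s4
      assume s4: "correct_answer P T (written s4)" "ticks s4 \<le> ticks (tick s3) + 20 * (nT + 1)"
      have "k + 1 \<le> 12 * num_leaves P" using s2(2) by simp
      then have "(k + 1) * (100 * n1) \<le> 12 * num_leaves P * (100 * n1)" by (rule mult_le_mono1)
      moreover have "n1 \<le> 2 * nT" using num_nodes_pos[of T] unfolding n1_def by linarith
      then have "num_leaves P * n1 \<le> 2 * (num_leaves P * nT)"
        using mult_le_mono2[of n1 "2 * nT" "num_leaves P"] by simp
      moreover have "n1 \<le> num_leaves P * n1" using mult_le_mono1[of 1 "num_leaves P" n1]
        by (simp add: Suc_le_eq)
      moreover have "1 \<le> n1" by (simp add: n1_def)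
      \<comment> \<open>With \<open>n1\<close> at most twice \<open>nT\<close>, the rounds
        contribute at most \<open>2400\<close> and the other terms at most \<open>130\<close> per
        leaf and node of \<open>T\<close>; \<open>4000\<close> is a generous round figure.\<close>
      ultimately have "5 + 40 * n1 + (k + 1) * (100 * n1) + 20 * n1 \<le> 4000 * (num_leaves P * nT)" by linarith
      then show "?Q s4" using s4 t3 by (simp add: n1_def)
    qed
    then have "wp ?loop (wp output_com ?Q) s1" using loop unfolding wp_def by blast
    then show ?thesis using s(1) by (simp add: s1_def small tick_def fun_upd_twist)
  qed
  let ?s0 = "tick (tick ((initial_state vs)\<lparr>vars := vs(vnP := nP, vnT := nT)\<rparr>))"
  have "wp (ends_com aendP vnP (N 3)) (wp (ends_com aendT vnT (N 3 \<oplus> N 2 \<otimes> V vnP))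
      (wp (vv \<leftarrow> N 0;; vmode \<leftarrow> N 0;; ?loop;; output_com) ?Q)) ?s0"
  proof (rule wp_ends[of P _ _ _ 3])
    fix s1
    assume s1: "changes {vx, vq, vj} {aendP} ?s0 s1" "\<forall>i < nP. arr s1 aendP i = stop SP i"
      "ticks s1 \<le> ticks ?s0 + 20 * (nT + 1)"
    show "wp (ends_com aendT vnT (N 3 \<oplus> N 2 \<otimes> V vnP)) (wp (vv \<leftarrow> N 0;; vmode \<leftarrow> N 0;; ?loop;; output_com) ?Q) s1"
    proof (rule wp_ends[of T _ _ _ "3 + 2 * nP"])
      fix s2
      assume s2: "changes {vx, vq, vj} {aendT} s1 s2" "\<forall>i < nT. arr s2 aendT i = stop ST i"
        "ticks s2 \<le> ticks s1 + 20 * (nT + 1)"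
      show "wp (vv \<leftarrow> N 0;; vmode \<leftarrow> N 0;; ?loop;; output_com) ?Q s2"
      proof (rule final)
        show "env s2" using s1(1,2) s2(1,2) by (auto simp: env_def changes_def)
        show "written s2 = []" "\<forall>t. arr s2 aS t = 0"
          using s1(1) s2(1) by (auto simp: changes_def initial_state_def)
        show "ticks s2 \<le> 2 + 40 * n1" using s1(3) s2(3) by (simp add: n1_def initial_state_def)
      qed
    next
      show "vars s1 vnT = nT" using s1(1) by (simp add: changes_def)
      fix s' :: state
      assume "\<forall>y. y \<notin> {vx, vq, vj} \<longrightarrow> vars s' y = vars s1 y"
      then have "vars s' vnP = nP" using s1(1) by (simp add: changes_def)
      then show "aok s' (N 3 \<oplus> N 2 \<otimes> V vnP) \<and> aval s' (N 3 \<oplus> N 2 \<otimes> V vnP) = 3 + 2 * nP"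
        using size_le by (simp add: small)
    next
      fix i assume "i < nT"
      then show "3 + 2 * nP + 2 * i < length (encode_input P T) \<and>
          encode_input P T ! (3 + 2 * nP + 2 * i) = length (children (ST ! i))"
        by (simp only: encode_input_nth) auto
    qed simp_all
  next
    fix i assume "i < nP"
    then show "3 + 2 * i < length (encode_input P T) \<and>
        encode_input P T ! (3 + 2 * i) = length (children (SP ! i))"
      by (simp only: encode_input_nth) auto
  qed (simp_all add: small)
  then show ?thesis
    using encode_input_nth(1,2)[of P T] encode_input_nth(3)[of P T]
    by (simp add: main_com_def small initial_state_def tick_def fun_upd_twist)
qed

end

text \<open>\<open>x\<close> is the power of two just above \<open>n\<close>. Of the
  \<open>20\<close> factors \<open>x\<close> in the bound for \<open>2 ^ w\<close>, two cover the
  square and the other \<open>18\<close>, each at least \<open>2\<close>, outweigh the constant,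
  even for \<open>n = 1\<close>.\<close>

lemma word_size_bound:
  assumes "log_word_size 20 b n w" "0 < n"
  shows "1000 * (n + 1) * (n + 1) < 2 ^ w"
proof -
  define x :: nat where "x = 2 ^ floorlog 2 n"
  have "n < x" using floorlog_bounds[of n 2] assms(2) by (simp add: x_def)
  then have x: "n + 1 \<le> x" "2 \<le> x" using assms(2) by simp_all
  have "1000 * ((n + 1) * (n + 1)) < 2 ^ 18 * (x * x)"
  proof -
    have "(n + 1) * (n + 1) \<le> x * x" using x(1) by (intro mult_le_mono) simp_all
    moreover have "0 < x * x" using x(2) by simp
    ultimately show ?thesis by simp
  qed
  also have "\<dots> \<le> x ^ 18 * (x * x)" using x(2) by (intro mult_le_mono1 power_mono) simp_all
  also have "\<dots> = x ^ 20" using power_add[of x 18 2] by (simp add: power2_eq_square)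
  also have "\<dots> = 2 ^ (20 * floorlog 2 n)" unfolding x_def by (simp add: mult.commute flip: power_mult)
  also have "\<dots> \<le> 2 ^ w" using assms(1) by (intro power_increasing) (simp_all add: log_word_size_def)
  finally show ?thesis by (simp only: mult.assoc)
qed

lemma wf_main: "wf_com main_com"
  by (simp add: main_com_def ends_com_def body_com_def call_com_def return_com_def children_com_def
      output_com_def chain_com_def heavy_com_def ident_com_def compose_com_def push_com_def pop_com_def
      levels_com_def result_com_def incr_def)

theorem theorem2:
  "\<exists>prog a. 0 < a \<and> (\<forall>b\<ge>a. \<exists>C. \<forall>(P :: nat tree) (T :: nat tree) w.
     1 \<le> num_nodes P \<and> num_nodes P \<le> num_nodes T \<and>
     log_word_size a b (num_nodes T) w \<and>
     (\<forall>x \<in> set_tree P \<union> set_tree T. x < 2 ^ w) \<longrightarrow>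
     (\<exists>t out. ram_computes w (C * num_nodes T) prog (encode_input P T) t out \<and>
              t \<le> C * (num_leaves P * num_nodes T) \<and>
              correct_answer P T out))"
proof (rule exI[of _ "ram_program main_com"], rule exI[of _ "20 :: nat"], intro conjI allI impI)
  fix b :: nat
  \<comment> \<open>The summand \<open>100\<close> covers the memory, input and nine arrays
    together, as well as the seven start-up instructions; the other summand turns ticks into
    instructions.\<close>
  define C where "C = 100 + com_length main_com * 4000"
  show "\<exists>C. \<forall>(P :: nat tree) (T :: nat tree) w.
     1 \<le> num_nodes P \<and> num_nodes P \<le> num_nodes T \<and>
     log_word_size 20 b (num_nodes T) w \<and>
     (\<forall>x \<in> set_tree P \<union> set_tree T. x < 2 ^ w) \<longrightarrow>
     (\<exists>t out. ram_computes w (C * num_nodes T) (ram_program main_com) (encode_input P T) t out \<and>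
              t \<le> C * (num_leaves P * num_nodes T) \<and>
              correct_answer P T out)"
  proof (rule exI[of _ C], intro allI impI, elim conjE)
    fix P T :: "nat tree" and w :: nat
    assume A: "num_nodes P \<le> num_nodes T" "log_word_size 20 b (num_nodes T) w"
    let ?l = "num_leaves P" and ?n = "num_nodes T"
    interpret inclusion_problem P T w
      by unfold_locales (use A word_size_bound[OF A(2)] in auto)
    have n: "1 \<le> ?n" "1 \<le> ?l" by (simp_all add: Suc_le_eq)
    have len: "length (encode_input P T) = 2 + 2 * (num_nodes P + ?n)" by (rule encode_input_nth(3))
    have "length (encode_input P T) + num_arrays * (2 * ?n + 4) \<le> 100 * ?n"
      using len A(1) n(1) by simp
    also have "100 * ?n \<le> C * ?n" by (rule mult_le_mono1) (simp add: C_def)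
    finally have space: "length (encode_input P T) + num_arrays * (2 * ?n + 4) \<le> C * ?n" .
    have space': "length (encode_input P T) + num_arrays * (2 * ?n + 4) < 2 ^ w"
      using len A(1) by (intro small) simp
    have "length (encode_input P T) = 2 + 2 * (encode_input P T ! 0 + encode_input P T ! 1)"
      by (simp only: encode_input_nth)
    from ram_program_computes[OF this space space' wf_main wp_main]
    obtain t and s :: state where s: "correct_answer P T (written s)" "ticks s \<le> 4000 * (?l * ?n)"
      "ram_computes w (C * ?n) (ram_program main_com) (encode_input P T) t (written s)"
      "t \<le> 7 + com_length main_com * ticks s" by blast
    have "1 \<le> ?l * ?n" using mult_le_mono[OF n(2,1)] by simp
    moreover have "com_length main_com * ticks s \<le> com_length main_com * (4000 * (?l * ?n))"
      using s(2) by (rule mult_le_mono2)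
    ultimately have "t \<le> 100 * (?l * ?n) + com_length main_com * (4000 * (?l * ?n))" using s(4) by linarith
    then have "t \<le> C * (?l * ?n)" unfolding C_def distrib_right by (simp only: mult.assoc)
    then show "\<exists>t out. ram_computes w (C * ?n) (ram_program main_com) (encode_input P T) t out \<and>
        t \<le> C * (?l * ?n) \<and> correct_answer P T out"
      using s(1,3) by blast
  qed
qed simp

end
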